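(* Let $n\ge1$, let $\Omega$ be a bounded domain with smooth boundary in the Heisenberg group $\mathbb{H}^n$, and let $0<\lambda_1\le\lambda_2\le\cdots\to+\infty$ be the eigenvalues of the problem $$(-\Delta_{\mathbb{H}^n})^2u=\lambda u\ \text{ in }\Omega,\qquad u=\frac{\partial u}{\partial\nu}=0\ \text{ on }\partial\Omega.$$ Then, for each $k=1,2,\ldots$, $$\sum_{i=1}^k(\lambda_{k+1}-\lambda_i)^2\le\frac{2\sqrt{n+1}}{n}\bigg[\sum_{i=1}^k(\lambda_{k+1}-\lambda_i)\lambda_i^{\frac12}\bigg]^{\frac12}\bigg[\sum_{i=1}^k(\lambda_{k+1}-\lambda_i)^2\lambda_i^{\frac12}\bigg]^{\frac12}.$$
   Context: The Heisenberg group $\mathbb{H}^n$ is $\mathbb{R}^{2n+1}$ with coordinates $(x,y,t)$, $x,y\in\mathbb{R}^n$, $t\in\mathbb{R}$, and group law $(x,y,t)(x',y',t')=\big(x+x',\,y+y',\,t+t'+\tfrac12(\langle x',y\rangle_{\mathbb{R}^n}-\langle x,y'\rangle_{\mathbb{R}^n})\big)$. For $p=1,\dots,n$ set $X_p=\frac{\partial}{\partial x_p}+\frac{y_p}{2}\frac{\partial}{\partial t}$ and $Y_p=\frac{\partial}{\partial y_p}-\frac{x_p}{2}\frac{\partial}{\partial t}$. The (real) Kohn Laplacian is $\Delta_{\mathbb{H}^n}=\sum_{p=1}^n(X_p^2+Y_p^2)$. $\nu$ denotes the outward unit normal to $\partial\Omega$. For a positive integer $l$ (here $l=2$), $S^{l,2}(\Omega)$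 is the Hilbert space of functions $u\in L^2(\Omega)$ such that $X_p^du,Y_p^du\in L^2(\Omega)$ for $1\le d\le l$, $1\le p\le n$, with norm $\|u\|_{S^{l,2}}^2=\int_\Omega\big(\sum_{d=1}^l\sum_{p=1}^n(|X_p^du|^2+|Y_p^du|^2)+|u|^2\big)\,dx\,dy\,dt$, and $S_0^{l,2}(\Omega)$ is the closure of $C_0^\infty(\Omega)$ in it. The eigenvalues of the problem are listed with multiplicity, with corresponding eigenfunctions $u_i\in S_0^{l,2}(\Omega)$, orthonormal in $L^2(\Omega)$. *)

theory Defs
  imports "HOL-Analysis.Analysis"
begin

section \<open>The Heisenberg group\<close>

text \<open>The index type \<open>'n\<close> plays the role of \<open>{1..n}\<close>, so that \<open>n = CARD('n) \<ge> 1\<close>;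
  a point of the group is a triple \<open>(x, y, t)\<close>. Lebesgue measure on this type is
  Lebesgue measure \<open>dx dy dt\<close> on \<open>(2n+1)\<close>-space.\<close>

type_synonym 'n heis = "(real^'n) \<times> (real^'n) \<times> real"

definition heis_mult :: "'n::finite heis \<Rightarrow> 'n heis \<Rightarrow> 'n heis" where
  "heis_mult = (\<lambda>(x, y, t) (x', y', t'). (x + x', y + y', t + t' + (x' \<bullet> y - x \<bullet> y') / 2))"

text \<open>The coefficient vectors of \<open>X\<^sub>p = \<partial>/\<partial>x\<^sub>p + (y\<^sub>p/2) \<partial>/\<partial>t\<close> and
  \<open>Y\<^sub>p = \<partial>/\<partial>y\<^sub>p - (x\<^sub>p/2) \<partial>/\<partial>t\<close>.\<close>

definition X_field :: "'n::finite \<Rightarrow> 'n heis \<Rightarrow> 'n heis" where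
  "X_field p = (\<lambda>(x, y, t). (axis p 1, 0, y $ p / 2))"

definition Y_field :: "'n::finite \<Rightarrow> 'n heis \<Rightarrow> 'n heis" where
  "Y_field p = (\<lambda>(x, y, t). (0, axis p 1, - (x $ p / 2)))"

text \<open>Both are the left-invariant fields given by the group law.\<close>

lemma X_field_left_invariant:
  "((\<lambda>s. heis_mult z (s *\<^sub>R axis p 1, 0, 0)) has_vector_derivative X_field p z) (at 0)"
  by (cases z) (auto simp: heis_mult_def X_field_def inner_axis' 
      intro!: derivative_eq_intros has_vector_derivative_Pair)

lemma Y_field_left_invariant:
  "((\<lambda>s. heis_mult z (0, s *\<^sub>R axis p 1, 0)) has_vector_derivative Y_field p z) (at 0)"
  by (cases z) (auto simp: heis_mult_def Y_field_def inner_axis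
      intro!: derivative_eq_intros has_vector_derivative_Pair)

text \<open>The action of a vector field as a first-order differential operator.\<close>

definition vf_deriv :: "('a::euclidean_space \<Rightarrow> 'a) \<Rightarrow> ('a \<Rightarrow> real) \<Rightarrow> 'a \<Rightarrow> real" where
  "vf_deriv V f = (\<lambda>z. frechet_derivative f (at z) (V z))"

definition kohn_laplacian :: "('n::finite heis \<Rightarrow> real) \<Rightarrow> 'n heis \<Rightarrow> real" where
  "kohn_laplacian f = (\<lambda>z. \<Sum>p\<in>UNIV. (vf_deriv (X_field p) ^^ 2) f z + (vf_deriv (Y_field p) ^^ 2) f z)"


section \<open>Smooth functions and smooth domains\<close>

text \<open>To be used on open sets \<open>S\<close> only.\<close>

primrec Ck_on :: "nat \<Rightarrow> 'a::euclidean_space set \<Rightarrow> ('a \<Rightarrow> real) \<Rightarrow> bool" where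
  "Ck_on 0 S f \<longleftrightarrow> continuous_on S f"
| "Ck_on (Suc k) S f \<longleftrightarrow> (\<forall>z\<in>S. f differentiable (at z)) \<and>
     (\<forall>b\<in>Basis. Ck_on k S (\<lambda>z. frechet_derivative f (at z) b))"

definition smooth_on :: "'a::euclidean_space set \<Rightarrow> ('a \<Rightarrow> real) \<Rightarrow> bool" where
  "smooth_on S f \<longleftrightarrow> (\<forall>k. Ck_on k S f)"

text \<open>Near each boundary point the domain is the sublevel set of a smooth function with
  non-vanishing differential.\<close>

definition smooth_boundary :: "'a::euclidean_space set \<Rightarrow> bool" where
  "smooth_boundary \<Omega> \<longleftrightarrow> (\<forall>z\<in>frontier \<Omega>. \<exists>U \<rho>. open U \<and> z \<in> U \<and> smooth_on U \<rho> \<and>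
     (\<forall>w\<in>U. frechet_derivative \<rho> (at w) \<noteq> (\<lambda>_. 0)) \<and> \<Omega> \<inter> U = {w \<in> U. \<rho> w < 0})"

definition bounded_smooth_domain :: "'a::euclidean_space set \<Rightarrow> bool" where
  "bounded_smooth_domain \<Omega> \<longleftrightarrow>
     \<Omega> \<noteq> {} \<and> open \<Omega> \<and> connected \<Omega> \<and> bounded \<Omega> \<and> smooth_boundary \<Omega>"

definition test_functions :: "'a::euclidean_space set \<Rightarrow> ('a \<Rightarrow> real) set" where
  "test_functions \<Omega> = {\<phi>. smooth_on UNIV \<phi> \<and> (\<exists>K. compact K \<and> K \<subseteq> \<Omega> \<and> (\<forall>z. z \<notin> K \<longrightarrow> \<phi> z = 0))}"


section \<open>The spaces \<open>S\<^sup>l\<^sup>,\<^sup>2(\<Omega>)\<close>\<close>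

text \<open>Elements of function spaces are genuine functions; equality in the space is equality
  almost everywhere in \<open>\<Omega>\<close>, and values outside \<open>\<Omega>\<close> are irrelevant.\<close>

definition L2 :: "'a::euclidean_space set \<Rightarrow> ('a \<Rightarrow> real) set" where
  "L2 \<Omega> = {u \<in> borel_measurable (lebesgue_on \<Omega>). integrable (lebesgue_on \<Omega>) (\<lambda>z. (u z)\<^sup>2)}"

text \<open>\<open>g\<close> is the distributional derivative \<open>V\<^sup>d u\<close> in \<open>L2 \<Omega>\<close>. The sign is \<open>(-1)\<^sup>d\<close> because
  the fields used here are divergence free, hence formally skew-adjoint.\<close>

definition is_weak_deriv ::
    "'a::euclidean_space set \<Rightarrow> ('a \<Rightarrow> 'a) \<Rightarrow> nat \<Rightarrow> ('a \<Rightarrow> real) \<Rightarrow> ('a \<Rightarrow> real) \<Rightarrow> bool" where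
  "is_weak_deriv \<Omega> V d u g \<longleftrightarrow> g \<in> L2 \<Omega> \<and> (\<forall>\<phi>\<in>test_functions \<Omega>.
     (\<integral>z. u z * (vf_deriv V ^^ d) \<phi> z \<partial>lebesgue_on \<Omega>) = (-1) ^ d * (\<integral>z. g z * \<phi> z \<partial>lebesgue_on \<Omega>))"

text \<open>Unique up to null sets when it exists.\<close>

definition weak_deriv ::
    "'a::euclidean_space set \<Rightarrow> ('a \<Rightarrow> 'a) \<Rightarrow> nat \<Rightarrow> ('a \<Rightarrow> real) \<Rightarrow> 'a \<Rightarrow> real" where
  "weak_deriv \<Omega> V d u = (SOME g. is_weak_deriv \<Omega> V d u g)"

definition S_space :: "nat \<Rightarrow> 'n::finite heis set \<Rightarrow> ('n heis \<Rightarrow> real) set" where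
  "S_space l \<Omega> = {u \<in> L2 \<Omega>. \<forall>d\<in>{1..l}. \<forall>p.
     (\<exists>g. is_weak_deriv \<Omega> (X_field p) d u g) \<and> (\<exists>g. is_weak_deriv \<Omega> (Y_field p) d u g)}"

definition S_norm :: "nat \<Rightarrow> 'n::finite heis set \<Rightarrow> ('n heis \<Rightarrow> real) \<Rightarrow> real" where
  "S_norm l \<Omega> u = sqrt (\<integral>z. (\<Sum>d=1..l. \<Sum>p\<in>UNIV.
     (weak_deriv \<Omega> (X_field p) d u z)\<^sup>2 + (weak_deriv \<Omega> (Y_field p) d u z)\<^sup>2) + (u z)\<^sup>2
     \<partial>lebesgue_on \<Omega>)"

definition S0_space :: "nat \<Rightarrow> 'n::finite heis set \<Rightarrow> ('n heis \<Rightarrow> real) set" where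
  "S0_space l \<Omega> = {u \<in> S_space l \<Omega>.
     \<forall>\<epsilon>>0. \<exists>\<phi>\<in>test_functions \<Omega>. S_norm l \<Omega> (\<lambda>z. u z - \<phi> z) < \<epsilon>}"


section \<open>The clamped plate problem for the Kohn Laplacian\<close>

text \<open>The equation \<open>(-\<Delta>)\<^sup>2 u = \<mu> u\<close> holds in \<open>\<Omega>\<close> in the sense of distributions
  (\<open>-\<Delta>\<close> being formally self-adjoint), and the boundary conditions
  \<open>u = \<partial>u/\<partial>\<nu> = 0\<close> are expressed by membership in \<open>S0_space 2 \<Omega>\<close>.\<close>

definition eigenfunction :: "'n::finite heis set \<Rightarrow> real \<Rightarrow> ('n heis \<Rightarrow> real) \<Rightarrow> bool" where
  "eigenfunction \<Omega> \<mu> u \<longleftrightarrow> u \<in> S0_space 2 \<Omega> \<and> \<not> (AE z in lebesgue_on \<Omega>. u z = 0) \<and>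
     (\<forall>\<phi>\<in>test_functions \<Omega>.
        (\<integral>z. u z * ((\<lambda>f w. - kohn_laplacian f w) ^^ 2) \<phi> z \<partial>lebesgue_on \<Omega>)
          = \<mu> * (\<integral>z. u z * \<phi> z \<partial>lebesgue_on \<Omega>))"

text \<open>\<open>lam 1 \<le> lam 2 \<le> \<dots>\<close> (the index \<open>0\<close> is unused) are all the eigenvalues, each repeated
  according to the dimension of its eigenspace, and \<open>u 1, u 2, \<dots>\<close> are corresponding
  orthonormal eigenfunctions. The last clause says that the listing is complete: those
  \<open>u i\<close> with \<open>lam i = \<mu>\<close> span the eigenspace of \<open>\<mu>\<close>. In particular every eigenvalue occurs.\<close>

definition eigenvalue_listing ::
    "'n::finite heis set \<Rightarrow> (nat \<Rightarrow> real) \<Rightarrow> (nat \<Rightarrow> 'n heis \<Rightarrow> real) \<Rightarrow> bool" where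
  "eigenvalue_listing \<Omega> lam u \<longleftrightarrow>
     (\<forall>i\<ge>1. 0 < lam i) \<and> (\<forall>i\<ge>1. lam i \<le> lam (Suc i)) \<and> filterlim lam at_top sequentially \<and>
     (\<forall>i\<ge>1. eigenfunction \<Omega> (lam i) (u i)) \<and>
     (\<forall>i\<ge>1. \<forall>j\<ge>1. (\<integral>z. u i z * u j z \<partial>lebesgue_on \<Omega>) = (if i = j then 1 else 0)) \<and>
     (\<forall>\<mu> v. eigenfunction \<Omega> \<mu> v \<longrightarrow>
        (\<exists>c. AE z in lebesgue_on \<Omega>. v z = (\<Sum>i | 1 \<le> i \<and> lam i = \<mu>. c i * u i z)))"

end

theory Submission
  imports Defs
begin

text \<open>The trial functions \<open>a u\<^sub>i\<close>, projected away from \<open>u\<^sub>1, \<dots>, u\<^sub>k\<close>, with \<open>a\<close> any of the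
  \<open>2n\<close> horizontal coordinates, are tested in the variational characterisation of
  \<open>\<lambda>\<^sub>k\<^sub>+\<^sub>1\<close>. With \<open>L = \<Delta>\<^sup>2\<close> the double commutator \<open>[[L, a], a] = 4 \<Delta> + 8 D\<^sup>2\<close>
  (\<open>D\<close> the field dual to \<open>a\<close>) sums to \<open>8 (n + 1) \<Delta>\<close> over all coordinates, and
  \<open>\<langle>-\<Delta> u\<^sub>i, u\<^sub>i\<rangle> \<le> \<lambda>\<^sub>i\<^sup>1\<^sup>/\<^sup>2\<close>; completing squares and optimising a parameter gives the claim.

  The variational characterisation needs a minimiser in \<open>S\<^sub>0\<^sup>2\<^sup>,\<^sup>2\<close>, hence the estimates
  \<open>\<parallel>T f\<parallel>, \<parallel>D\<^sup>2 f\<parallel> \<le> C \<parallel>\<Delta> f\<parallel>\<close> for test functions, where \<open>T = \<partial>/\<partial>t\<close>. They turn the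
  energy \<open>\<parallel>\<Delta> f\<parallel>\<close> into control of the full Euclidean gradient on bounded sets, so Rellich's
  theorem applies. The bound on \<open>T\<close> is not a consequence of integration by parts alone: one squares
  the form inequality \<open>|T| \<le> C (-\<Delta>)\<close> by means of the group of translations in \<open>t\<close>, which
  commutes with \<open>\<Delta>\<close>.\<close>

subsection \<open>Unitary flows\<close>

text \<open>A form inequality between operators cannot be squared in general; it can when the
  operators commute. Here the joint spectral calculus is replaced by second differences of the
  translations at dyadic steps: their symbols \<open>sin^2\<close> are tied together by the
  double-angle formula, and this alone carries the squaring.

  The eigenvalues are given by a complete listing and not by a minimax formula. A Rayleigh quotient
  below \<open>\<lambda>\<^sub>k\<^sub>+\<^sub>1\<close> orthogonal to the first \<open>k\<close>
  eigenfunctions is excluded as follows: its infimum would be attained at an eigenfunction that the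
  listing cannot accommodate.

  The Hilbert space argument lives on \<open>lap_graph\<close>, the closure of the pairs
  \<open>(\<phi>, \<Delta> \<phi>)\<close> with test functions \<open>\<phi>\<close>. Since the norm
  of \<open>S_space\<close> contains the pure second derivatives, it is the bound on
  \<open>D^2\<close> that identifies the domain of this closure with
  \<open>S0_space 2 \<Omega>\<close>.

  Write \<open>S\<close> for the left-hand side, \<open>a\<close> and \<open>b\<close> for the two
  sums on the right. The \<open>2n\<close> directions together give
  \<open>2 n S \<le> 4 (n + 1) \<delta> b + a / \<delta>\<close>. The best \<open>\<delta>\<close>
  makes the right-hand side \<open>4 sqrt ((n + 1) a b)\<close>, and division by \<open>2n\<close>
  yields the constant \<open>2 sqrt (n + 1) / n\<close>.\<close>

locale unitary_flow =
  fixes U :: "real \<Rightarrow> 'h::real_inner \<Rightarrow> 'h"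
  assumes linear_U: "linear (U r)"
    and U_add: "U (r + t) f = U r (U t f)"
    and U_zero: "U 0 f = f"
    and U_isometry: "U r f \<bullet> U r g = f \<bullet> g"
begin

lemmas U_simps = linear_add[OF linear_U] linear_diff[OF linear_U] linear_scale[OF linear_U]
  linear_0[OF linear_U]

lemma U_adjoint: "U r f \<bullet> g = f \<bullet> U (-r) g"
  using U_isometry[of "-r" "U r f" g] U_add[of "-r" r f] by (simp add: U_zero)

lemma U_commute: "U r (U t f) = U t (U r f)"
  by (metis U_add add.commute)

lemma norm_U: "norm (U r f) = norm f"
  by (simp add: norm_eq_sqrt_inner U_isometry)

definition sdiff :: "real \<Rightarrow> 'h \<Rightarrow> 'h" where
  "sdiff r f = (1/4) *\<^sub>R (2 *\<^sub>R f - U r f - U (-r) f)"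

lemma sdiff_lin:
  "sdiff r (f + g) = sdiff r f + sdiff r g"
  "sdiff r (c *\<^sub>R f) = c *\<^sub>R sdiff r f"
  "sdiff r (f - g) = sdiff r f - sdiff r g"
  "sdiff r 0 = 0"
  by (simp_all add: sdiff_def U_simps algebra_simps)

lemma sdiff_self_adjoint: "sdiff r f \<bullet> g = f \<bullet> sdiff r g"
  by (simp add: sdiff_def inner_simps U_adjoint[of r] U_adjoint[of "-r"])

lemma sdiff_U: "sdiff r (U t f) = U t (sdiff r f)"
  by (simp add: sdiff_def U_simps U_commute[of r t] U_commute[of "-r" t])

lemma sdiff_commute: "sdiff r (sdiff t f) = sdiff t (sdiff r f)"
proof -
  have "sdiff r (sdiff t f) = (1/4) *\<^sub>R (2 *\<^sub>R sdiff r f - U t (sdiff r f) - U (-t) (sdiff r f))"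
    unfolding sdiff_def[of t f]
    by (simp add: sdiff_lin sdiff_U)
  then show ?thesis by (simp add: sdiff_def[of t])
qed

text \<open>The double-angle formula
  \<open>sin^2 \<theta> = 4 sin^2 (\<theta>/2) - 4 sin^4 (\<theta>/2)\<close>, the only
  trigonometric input.\<close>

lemma sdiff_double: "sdiff (2 * r) f = 4 *\<^sub>R sdiff r f - 4 *\<^sub>R sdiff r (sdiff r f)"
proof -
  have "U (2 * r) f = U r (U r f)" "U (-(2 * r)) f = U (-r) (U (-r) f)"
    using U_add[of r r f] U_add[of "-r" "-r" f] by simp_all
  moreover have "U r (U (-r) f) = f" "U (-r) (U r f) = f"
    using U_add[of r "-r" f] U_add[of "-r" r f] by (simp_all add: U_zero)
  ultimately have "sdiff (2 * r) f \<bullet> z = (4 *\<^sub>R sdiff r f - 4 *\<^sub>R sdiff r (sdiff r f)) \<bullet> z" for z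
    by (simp add: sdiff_def U_simps inner_simps field_simps)
  then show ?thesis using vector_eq_rdot by blast
qed

lemma sdiff_inner_self: "sdiff r f \<bullet> f = (norm (U r f - f))\<^sup>2 / 4"
proof -
  have "U (-r) f \<bullet> f = U r f \<bullet> f" using U_adjoint[of "-r" f f] by (simp add: inner_commute)
  then have "sdiff r f \<bullet> f = (2 * (f \<bullet> f) - 2 * (U r f \<bullet> f)) / 4"
    by (simp add: sdiff_def inner_diff_left)
  moreover have "(norm (U r f - f))\<^sup>2 = 2 * (f \<bullet> f) - 2 * (U r f \<bullet> f)"
    using inner_commute[of f "U r f"]
    by (simp add: power2_norm_eq_inner inner_diff_left inner_diff_right U_isometry)
  ultimately show ?thesis by simp
qed

lemma norm_sdiff_le: "norm (sdiff r f) \<le> norm f"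
proof -
  have "norm (2 *\<^sub>R f - U r f - U (-r) f) \<le> norm (2 *\<^sub>R f) + norm (U r f) + norm (U (-r) f)"
    using norm_triangle_ineq4[of "2 *\<^sub>R f - U r f" "U (-r) f"] norm_triangle_ineq4[of "2 *\<^sub>R f" "U r f"]
    by linarith
  then show ?thesis by (simp add: sdiff_def norm_U)
qed

text \<open>\<open>U r f \<mapsto> exp (i \<theta>)\<close> turns \<open>sdiff r\<close> into \<open>sin\<^sup>2 (\<theta>/2)\<close>, and \<open>ssum J r\<close> is
  \<open>r\<close> times a truncated Littlewood--Paley sum for \<open>\<theta>/r\<close>.\<close>

primrec ssum :: "nat \<Rightarrow> real \<Rightarrow> 'h \<Rightarrow> 'h" where
  "ssum 0 r f = 0"
| "ssum (Suc J) r f = sdiff r f + (1/2) *\<^sub>R ssum J (2 * r) f"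

lemma ssum_sdiff: "ssum J r (sdiff t f) = sdiff t (ssum J r f)"
  by (induction J arbitrary: r f) (auto simp: sdiff_lin sdiff_commute[of _ t])

lemma norm_ssum_le: "norm (ssum J r f) \<le> 2 * norm f"
proof (induction J arbitrary: r f)
  case (Suc J)
  have "norm (ssum (Suc J) r f) \<le> norm (sdiff r f) + norm (ssum J (2 * r) f) / 2"
    by (simp add: norm_triangle_le)
  then show ?case using norm_sdiff_le[of r f] Suc[of "2 * r" f] by simp
qed simp

text \<open>With \<open>s = sin^2 (\<theta>/2)\<close> this says that the dyadic sum is at most a
  multiple of \<open>sqrt s\<close>, uniformly in \<open>J\<close>. Adding \<open>sdiff r f\<close>
  once more makes the induction close: the new quantity is half the old one at scale
  \<open>2 * r\<close> plus \<open>2 s^2\<close>, and the double-angle formula turns the old bound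
  into one with a negative \<open>s^2\<close> term.\<close>

lemma ssum_bound_aux: "(norm (ssum J r f + sdiff r f))\<^sup>2 \<le> 16 * (sdiff r f \<bullet> f)"
proof (induction J arbitrary: r)
  case 0
  have "(norm (sdiff r f))\<^sup>2 = sdiff r (sdiff r f) \<bullet> f"
    by (simp add: power2_norm_eq_inner sdiff_self_adjoint inner_commute)
  also have "\<dots> = sdiff r f \<bullet> f - (sdiff (2 * r) f \<bullet> f) / 4"
    by (simp add: sdiff_double inner_simps diff_divide_distrib)
  also have "\<dots> \<le> 16 * (sdiff r f \<bullet> f)"
  proof -
    have "sdiff r f \<bullet> f \<ge> 0" "sdiff (2 * r) f \<bullet> f \<ge> 0" by (simp_all add: sdiff_inner_self)
    then show ?thesis by linarith
  qed
  finally show ?case by simp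
next
  case (Suc J)
  define k where "k = ssum J (2 * r) f + sdiff (2 * r) f"
  define a where "a = sdiff r f"
  have eq: "ssum (Suc J) r f + sdiff r f = (1/2) *\<^sub>R k + 2 *\<^sub>R sdiff r a"
  proof -
    have "(ssum (Suc J) r f + sdiff r f) \<bullet> z = ((1/2) *\<^sub>R k + 2 *\<^sub>R sdiff r a) \<bullet> z" for z
      by (simp add: k_def a_def sdiff_double inner_simps add_divide_distrib diff_divide_distrib)
    then show ?thesis using vector_eq_rdot by blast
  qed
  have "k \<bullet> sdiff r a = sdiff r k \<bullet> a" by (simp add: sdiff_self_adjoint)
  also have "sdiff r k = ssum J (2 * r) a + sdiff (2 * r) a"
    unfolding k_def a_def by (simp add: sdiff_lin ssum_sdiff sdiff_commute[of r])
  also have "\<dots> \<bullet> a \<le> (2 * norm a + norm a) * norm a"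
    by (intro order_trans[OF norm_cauchy_schwarz] mult_right_mono norm_triangle_le add_mono
        norm_ssum_le norm_sdiff_le) auto
  finally have 1: "k \<bullet> sdiff r a \<le> 3 * (norm a)\<^sup>2" by (simp add: power2_eq_square)
  have 2: "(norm (sdiff r a))\<^sup>2 \<le> (norm a)\<^sup>2" by (simp add: norm_sdiff_le)
  have "(norm k)\<^sup>2 \<le> 16 * (sdiff (2 * r) f \<bullet> f)" unfolding k_def by (rule Suc)
  also have "\<dots> = 64 * (sdiff r f \<bullet> f) - 64 * (norm a)\<^sup>2"
    by (simp add: a_def sdiff_double inner_simps power2_norm_eq_inner sdiff_self_adjoint inner_commute)
  finally have 3: "(norm k)\<^sup>2 \<le> 64 * (sdiff r f \<bullet> f) - 64 * (norm a)\<^sup>2" .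
  have "(norm (ssum (Suc J) r f + sdiff r f))\<^sup>2
      = (norm k)\<^sup>2 / 4 + 2 * (k \<bullet> sdiff r a) + 4 * (norm (sdiff r a))\<^sup>2"
    unfolding eq power2_norm_eq_inner inner_add_left inner_add_right inner_scaleR_left inner_scaleR_right
      inner_commute[of "sdiff r a" k] by simp
  \<comment> \<open>The balance in units of \<open>(norm a)^2\<close>: \<open>3\<close> contributes
    -16, \<open>1\<close> at most 6 and \<open>2\<close> at most 4.\<close>
  then show ?case using 1 2 3 zero_le_power2[of "norm a"] by linarith
qed

lemma ssum_bound: "norm (ssum J r f) \<le> 5 * sqrt (sdiff r f \<bullet> f)"
proof -
  have "norm (ssum J r f + sdiff r f) \<le> 4 * sqrt (sdiff r f \<bullet> f)"
    using real_le_rsqrt[OF ssum_bound_aux] by (simp add: real_sqrt_mult)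
  moreover have "(norm (sdiff r f))\<^sup>2 = sdiff r f \<bullet> f - (sdiff (2 * r) f \<bullet> f) / 4"
    by (simp add: sdiff_double inner_simps power2_norm_eq_inner sdiff_self_adjoint inner_commute
        diff_divide_distrib)
  then have "(norm (sdiff r f))\<^sup>2 \<le> sdiff r f \<bullet> f"
    by (simp add: sdiff_inner_self[of "2 * r"])
  then have "norm (sdiff r f) \<le> sqrt (sdiff r f \<bullet> f)" by (rule real_le_rsqrt)
  moreover have "norm (ssum J r f) \<le> norm (ssum J r f + sdiff r f) + norm (sdiff r f)"
    using norm_triangle_ineq4[of "ssum J r f + sdiff r f" "sdiff r f"] by simp
  ultimately show ?thesis by simp
qed

text \<open>The hypothesis says that \<open>|\<theta>| \<le> C r A\<close> in the sense of quadratic forms (for the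
  vectors \<open>U r f - f\<close> and \<open>a = A f\<close>). Since \<open>A\<close> commutes with the flow, this can be squared.\<close>

lemma flow_increment_bound:
  assumes hyp: "\<And>r. r > 0 \<Longrightarrow> (norm (U r (U r f - f) - (U r f - f)))\<^sup>2
      \<le> C * r * ((U r a - a) \<bullet> (U r f - f))"
    and "C \<ge> 0" and "h > 0"
  shows "norm (U h f - f) \<le> 5 * C / 2 * h * norm a"
proof -
  define q where "q = (\<lambda>r. sdiff r f \<bullet> f)"
  have q: "q r = (norm (U r f - f))\<^sup>2 / 4" for r unfolding q_def by (rule sdiff_inner_self)
  \<comment> \<open>By the double-angle formula \<open>q r\<close> is the squared norm of
    \<open>sdiff r f\<close> plus \<open>q (2 * r) / 4\<close>, and the hypothesis bounds that
    squared norm.\<close>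
  have step: "q r \<le> C / 4 * r * (a \<bullet> sdiff r f) + q (2 * r) / 4" if "r > 0" for r
  proof -
    have "U r (U r f - f) - (U r f - f) = - 4 *\<^sub>R U r (sdiff r f)"
      using U_add[of r "-r" f] by (simp add: sdiff_def U_simps U_zero algebra_simps scaleR_2)
    then have "(norm (U r (U r f - f) - (U r f - f)))\<^sup>2 = 16 * (norm (sdiff r f))\<^sup>2"
      by (simp add: norm_U power_mult_distrib)
    moreover have "(U r a - a) \<bullet> (U r f - f) = 4 * (a \<bullet> sdiff r f)"
      by (simp add: sdiff_def inner_simps U_isometry U_adjoint[of r a f])
    moreover have "(norm (sdiff r f))\<^sup>2 = q r - q (2 * r) / 4"
      by (simp add: q_def sdiff_double inner_simps power2_norm_eq_inner sdiff_self_adjoint inner_commute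
          diff_divide_distrib)
    ultimately show ?thesis using hyp[OF that] by simp
  qed
  \<comment> \<open>Each round doubles the step and divides by 4; the resulting weights
    \<open>2^j r / 4^j = r / 2^j\<close> are exactly those of \<open>ssum\<close>.\<close>
  have iter: "q r \<le> C / 4 * r * (a \<bullet> ssum J r f) + q (2 ^ J * r) / 4 ^ J" if "r > 0" for r J
    using that
  proof (induction J arbitrary: r)
    case (Suc J)
    have "q (2 * r) \<le> C / 4 * (2 * r) * (a \<bullet> ssum J (2 * r) f) + q (2 ^ J * (2 * r)) / 4 ^ J"
      using Suc.IH[of "2 * r"] Suc.prems by simp
    then have "q (2 * r) / 4 \<le> C / 4 * r * (a \<bullet> ssum J (2 * r) f) / 2 + q (2 ^ Suc J * r) / 4 ^ Suc J"
      by (simp add: mult_ac)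
    then show ?case using step[OF Suc.prems] by (simp add: inner_simps distrib_left)
  qed simp
  have "q (2 ^ J * h) \<le> (norm f)\<^sup>2" for J
  proof -
    have "norm (U (2 ^ J * h) f - f) \<le> 2 * norm f"
      using norm_triangle_ineq4[of "U (2 ^ J * h) f" f] by (simp add: norm_U)
    then have "(norm (U (2 ^ J * h) f - f))\<^sup>2 \<le> (2 * norm f)\<^sup>2" by (rule power_mono) simp
    then show ?thesis by (simp add: q power_mult_distrib)
  qed
  then have tail: "q (2 ^ J * h) / 4 ^ J \<le> (norm f)\<^sup>2 * (1 / 4) ^ J" for J
    by (simp add: power_one_over field_simps)
  \<comment> \<open>\<open>ssum_bound\<close> brings back \<open>sqrt (q h)\<close> on the right, so
    one such factor cancels once the tail has been sent to 0.\<close>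
  have "q h \<le> C / 4 * h * norm a * (5 * sqrt (q h)) + (norm f)\<^sup>2 * (1 / 4) ^ J" for J
  proof -
    have "a \<bullet> ssum J h f \<le> norm a * (5 * sqrt (q h))"
      unfolding q_def by (intro order_trans[OF norm_cauchy_schwarz] mult_left_mono ssum_bound) simp
    then have "C / 4 * h * (a \<bullet> ssum J h f) \<le> C / 4 * h * (norm a * (5 * sqrt (q h)))"
      using assms by (intro mult_left_mono) auto
    then show ?thesis using iter[OF \<open>h > 0\<close>, of J] tail[of J] by (simp add: mult.assoc)
  qed
  moreover have "(\<lambda>J. C / 4 * h * norm a * (5 * sqrt (q h)) + (norm f)\<^sup>2 * (1 / 4) ^ J)
      \<longlonglongrightarrow> C / 4 * h * norm a * (5 * sqrt (q h)) + (norm f)\<^sup>2 * 0"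
    by (intro tendsto_intros LIMSEQ_realpow_zero) auto
  ultimately have "q h \<le> C / 4 * h * norm a * (5 * sqrt (q h)) + (norm f)\<^sup>2 * 0"
    by (meson LIMSEQ_le_const)
  then have "q h \<le> 5 * C / 4 * h * norm a * sqrt (q h)" by (simp add: algebra_simps)
  moreover have q': "sqrt (q h) = norm (U h f - f) / 2" by (simp add: q real_sqrt_divide)
  moreover have "q h = sqrt (q h) * sqrt (q h)" by (simp add: q)
  ultimately have "sqrt (q h) * sqrt (q h) \<le> (5 * C / 4 * h * norm a) * sqrt (q h)" by linarith
  moreover have "0 \<le> 5 * C / 4 * h * norm a" using assms by simp
  ultimately have "sqrt (q h) \<le> 5 * C / 4 * h * norm a"
  proof (cases "sqrt (q h) > 0")
    case True
    show ?thesis by (rule mult_right_le_imp_le) fact+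
  qed linarith
  then show ?thesis unfolding q' by simp
qed

end

subsection \<open>A variational principle\<close>

lemma Cauchy_if_norm_square_le:
  fixes x :: "nat \<Rightarrow> 'h::real_normed_vector"
  assumes "\<And>m l. (norm (x m - x l))\<^sup>2 \<le> \<eta> m + \<eta> l" and "\<eta> \<longlonglongrightarrow> (0::real)"
  shows "Cauchy x"
proof (rule CauchyI)
  fix e :: real assume "e > 0"
  then have "eventually (\<lambda>m. \<eta> m < e\<^sup>2 / 2) sequentially"
    by (intro order_tendstoD(2)[OF assms(2)]) simp
  then obtain N where N: "\<And>m. m \<ge> N \<Longrightarrow> \<eta> m < e\<^sup>2 / 2" by (auto simp: eventually_sequentially)
  have "norm (x m - x l) < e" if "m \<ge> N" "l \<ge> N" for m l
  proof -
    have "(norm (x m - x l))\<^sup>2 < e\<^sup>2" using assms(1)[of m l] N[OF that(1)] N[OF that(2)] by simp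
    then show ?thesis by (rule power2_less_imp_less) (use \<open>e > 0\<close> in simp)
  qed
  then show "\<exists>M. \<forall>m\<ge>M. \<forall>n\<ge>M. norm (x m - x n) < e" by blast
qed

text \<open>Bolzano-Weierstrass for one functional after the other. This replaces weak compactness,
  because the compactness inequality below involves finitely many functionals only.\<close>

lemma bounded_seq_finite_functionals:
  fixes v :: "nat \<Rightarrow> 'h::real_inner"
  assumes "finite W" and "\<And>m. norm (v m) \<le> B"
  shows "\<exists>r. strict_mono r \<and> (\<forall>w\<in>W. convergent (\<lambda>m. v (r m) \<bullet> w))"
  using assms(1)
proof induction
  case empty show ?case by (intro exI[of _ id]) (simp add: strict_mono_def)
next
  case (insert w W)
  then obtain r where r: "strict_mono r" "\<And>w. w \<in> W \<Longrightarrow> convergent (\<lambda>m. v (r m) \<bullet> w)" by blast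
  have "bounded (range (\<lambda>m. v (r m) \<bullet> w))"
    unfolding bounded_iff
    by (intro exI[of _ "B * norm w"])
      (auto intro!: order_trans[OF Cauchy_Schwarz_ineq2] mult_right_mono assms(2))
  then obtain l s where s: "strict_mono s" "((\<lambda>m. v (r m) \<bullet> w) \<circ> s) \<longlonglongrightarrow> l"
    using bounded_imp_convergent_subsequence by blast
  have "convergent (\<lambda>m. v ((r \<circ> s) m) \<bullet> w')" if "w' \<in> insert w W" for w'
  proof (cases "w' = w")
    case True then show ?thesis using s(2) by (auto simp: convergent_def o_def)
  next
    case False
    then have "convergent (\<lambda>m. v (r m) \<bullet> w')" using r(2) that by auto
    from convergent_subseq_convergent[OF this s(1)] show ?thesis by (simp add: o_def)
  qed
  then show ?case using strict_mono_o[OF r(1) s(1)] by blast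
qed

text \<open>\<open>G\<close> is the graph of a closed operator \<open>v \<mapsto> g\<close>; the form \<open>\<parallel>g\<parallel>\<^sup>2\<close> plays the role of
  the energy of \<open>v\<close>. A single \<open>\<epsilon>\<close> is enough for the minimum below level \<open>L\<close> to be attained.\<close>

lemma eigenvector_below_level:
  fixes G :: "('h::{real_inner, complete_space} \<times> 'h) set"
  assumes G: "subspace G" "closed G"
    and W: "finite W" "\<epsilon> > 0" "\<epsilon> * L \<le> 1/2"
      "\<And>v g. (v, g) \<in> G \<Longrightarrow> (norm v)\<^sup>2 \<le> \<epsilon> * (norm g)\<^sup>2 + (\<Sum>w\<in>W. (v \<bullet> F w)\<^sup>2)"
    and I: "finite I" "\<And>i. i \<in> I \<Longrightarrow> (U i, A i) \<in> G"
      "\<And>i j. i \<in> I \<Longrightarrow> j \<in> I \<Longrightarrow> U i \<bullet> U j = (if i = j then 1 else 0)"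
      "\<And>i v g. i \<in> I \<Longrightarrow> (v, g) \<in> G \<Longrightarrow> A i \<bullet> g = lam i * (U i \<bullet> v)"
    and v0: "(v0, g0) \<in> G" "\<And>i. i \<in> I \<Longrightarrow> v0 \<bullet> U i = 0" "(norm g0)\<^sup>2 < L * (norm v0)\<^sup>2"
  obtains v g \<mu> where "(v, g) \<in> G" "\<mu> < L" "v \<noteq> 0" "\<And>i. i \<in> I \<Longrightarrow> v \<bullet> U i = 0"
    "\<And>v' g'. (v', g') \<in> G \<Longrightarrow> g \<bullet> g' = \<mu> * (v \<bullet> v')"
proof -
  \<comment> \<open>The minimisation runs over the orthogonal complement of the known eigenvectors;
    the restriction is lifted at the end.\<close>
  define G0 where "G0 = {(v, g). (v, g) \<in> G \<and> (\<forall>i\<in>I. v \<bullet> U i = 0)}"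
  have G0_add: "(v + v', g + g') \<in> G0" if "(v, g) \<in> G0" "(v', g') \<in> G0" for v g v' g'
    using that subspace_add[OF G(1), of "(v, g)" "(v', g')"] by (auto simp: G0_def inner_simps)
  have G0_scale: "(c *\<^sub>R v, c *\<^sub>R g) \<in> G0" if "(v, g) \<in> G0" for v g c
    using that subspace_scale[OF G(1), of "(v, g)" c] by (auto simp: G0_def inner_simps)
  have G0_diff: "(v - v', g - g') \<in> G0" if "(v, g) \<in> G0" "(v', g') \<in> G0" for v g v' g'
    using that subspace_diff[OF G(1), of "(v, g)" "(v', g')"] by (auto simp: G0_def inner_simps)
  define S where "S = {(norm g)\<^sup>2 | v g. (v, g) \<in> G0 \<and> norm v = 1}"
  define \<mu> where "\<mu> = Inf S"
  have v0nz: "v0 \<noteq> 0" using v0(3) by auto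
  have bdd: "bdd_below S" unfolding S_def by (rule bdd_belowI[of _ 0]) auto
  have scaled: "(norm g)\<^sup>2 / (norm v)\<^sup>2 \<in> S" if "(v, g) \<in> G0" "v \<noteq> 0" for v g
  proof -
    have "(norm ((1 / norm v) *\<^sub>R g))\<^sup>2 = (norm g)\<^sup>2 / (norm v)\<^sup>2"
      by (simp add: power_mult_distrib power_divide)
    moreover have "norm ((1 / norm v) *\<^sub>R v) = 1" using that by simp
    ultimately show ?thesis unfolding S_def using G0_scale[OF that(1), of "1 / norm v"]
      by (metis (mono_tags, lifting) mem_Collect_eq)
  qed
  have v0G0: "(v0, g0) \<in> G0" using v0 by (simp add: G0_def)
  have Sne: "S \<noteq> {}" using scaled[OF v0G0 v0nz] by auto
  have "\<mu> \<le> (norm g0)\<^sup>2 / (norm v0)\<^sup>2" unfolding \<mu>_def by (rule cInf_lower[OF scaled[OF v0G0 v0nz] bdd])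
  also have "\<dots> < L" using v0(3) v0nz by (simp add: field_simps)
  finally have muL: "\<mu> < L" .
  have mu0: "\<mu> \<ge> 0" unfolding \<mu>_def by (rule cInf_greatest[OF Sne]) (auto simp: S_def)
  have low: "\<mu> * (norm v)\<^sup>2 \<le> (norm g)\<^sup>2" if "(v, g) \<in> G0" for v g
  proof (cases "v = 0")
    case False
    then have "\<mu> \<le> (norm g)\<^sup>2 / (norm v)\<^sup>2" unfolding \<mu>_def by (intro cInf_lower[OF _ bdd] scaled that)
    then show ?thesis using False by (simp add: field_simps)
  qed simp
  define e where "e = (\<lambda>m::nat. 1 / real (Suc m))"
  have e0: "e \<longlonglongrightarrow> 0" unfolding e_def by (rule LIMSEQ_Suc[OF lim_1_over_n])
  have "\<exists>v g. (v, g) \<in> G0 \<and> norm v = 1 \<and> (norm g)\<^sup>2 < \<mu> + e m" for m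
  proof -
    have "Inf S < \<mu> + e m" by (simp add: \<mu>_def e_def)
    from cInf_lessD[OF Sne this] show ?thesis by (auto simp: S_def)
  qed
  then obtain v0' g0' where vg0: "\<And>m. (v0' m, g0' m) \<in> G0" "\<And>m. norm (v0' m) = 1"
      "\<And>m. (norm (g0' m))\<^sup>2 < \<mu> + e m" by metis
  obtain r where r: "strict_mono r" "\<And>w. w \<in> W \<Longrightarrow> convergent (\<lambda>m. v0' (r m) \<bullet> F w)"
    using bounded_seq_finite_functionals[OF finite_imageI[OF W(1)], of v0' 1 F] vg0(2)
    by (metis order_refl imageI)
  define vs gs es where "vs = v0' \<circ> r" and "gs = g0' \<circ> r" and "es = e \<circ> r"
  have vg: "\<And>m. (vs m, gs m) \<in> G0" "\<And>m. norm (vs m) = 1" "\<And>m. (norm (gs m))\<^sup>2 < \<mu> + es m"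
    using vg0 by (auto simp: vs_def gs_def es_def)
  have es0: "es \<longlonglongrightarrow> 0" unfolding es_def by (rule LIMSEQ_subseq_LIMSEQ[OF e0 r(1)])
  define x where "x = (\<lambda>w. lim (\<lambda>m. vs m \<bullet> F w))"
  have xlim: "(\<lambda>m. vs m \<bullet> F w) \<longlonglongrightarrow> x w" if "w \<in> W" for w
    unfolding x_def using r(2)[OF that] by (simp add: vs_def convergent_LIMSEQ_iff)
  define \<tau> where "\<tau> = (\<lambda>m. \<Sum>w\<in>W. (vs m \<bullet> F w - x w)\<^sup>2)"
  have "\<tau> \<longlonglongrightarrow> (\<Sum>w\<in>W. (x w - x w)\<^sup>2)" unfolding \<tau>_def by (intro tendsto_intros xlim)
  then have tau0: "\<tau> \<longlonglongrightarrow> 0" by simp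
  have \<sigma>: "(\<Sum>w\<in>W. ((vs m - vs l) \<bullet> F w)\<^sup>2) \<le> 2 * \<tau> m + 2 * \<tau> l" for m l
  proof -
    have "((vs m - vs l) \<bullet> F w)\<^sup>2 \<le> 2 * (vs m \<bullet> F w - x w)\<^sup>2 + 2 * (vs l \<bullet> F w - x w)\<^sup>2" for w
      using zero_le_power2[of "(vs m \<bullet> F w - x w) + (vs l \<bullet> F w - x w)"]
      by (simp add: inner_simps power2_eq_square algebra_simps)
    then show ?thesis unfolding \<tau>_def sum_distrib_left sum.distrib[symmetric] by (rule sum_mono)
  qed
  \<comment> \<open>Parallelogram law in both components, with the lower bound \<open>low\<close>
    applied to the sum of two almost minimal pairs.\<close>
  have key: "(norm (gs m - gs l))\<^sup>2 \<le> 2 * es m + 2 * es l + \<mu> * (norm (vs m - vs l))\<^sup>2" for m l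
  proof -
    have par: "(norm (a - b))\<^sup>2 = 2 * (norm a)\<^sup>2 + 2 * (norm b)\<^sup>2 - (norm (a + b))\<^sup>2" for a b :: 'h
      by (simp add: power2_norm_eq_inner inner_simps inner_commute)
    have "\<mu> * (norm (vs m + vs l))\<^sup>2 \<le> (norm (gs m + gs l))\<^sup>2" by (rule low[OF G0_add[OF vg(1) vg(1)]])
    moreover have "(norm (vs m + vs l))\<^sup>2 = 4 - (norm (vs m - vs l))\<^sup>2"
      using par[of "vs m" "vs l"] by (simp add: vg)
    ultimately have "\<mu> * (4 - (norm (vs m - vs l))\<^sup>2) \<le> (norm (gs m + gs l))\<^sup>2"
      by simp
    then have "4 * \<mu> - \<mu> * (norm (vs m - vs l))\<^sup>2 \<le> (norm (gs m + gs l))\<^sup>2"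
      by (simp add: right_diff_distrib)
    then show ?thesis using par[of "gs m" "gs l"] vg(3)[of m] vg(3)[of l] by simp
  qed
  have comp: "(norm (vs m - vs l))\<^sup>2 \<le> \<epsilon> * (norm (gs m - gs l))\<^sup>2 + (2 * \<tau> m + 2 * \<tau> l)" for m l
    using W(4)[of "vs m - vs l" "gs m - gs l"] G0_diff[OF vg(1) vg(1), of m l] \<sigma>[of m l]
    by (auto simp: G0_def)
  define \<eta> where "\<eta> = (\<lambda>m. 4 * es m + 4 * L * \<tau> m)"
  \<comment> \<open>\<open>comp\<close> is inserted into \<open>key\<close>. As
    \<open>\<mu> < L\<close> and \<open>\<epsilon> * L \<le> 1/2\<close>, at most half of the
    left-hand side reappears on the right and is absorbed.\<close>
  have gC: "(norm (gs m - gs l))\<^sup>2 \<le> \<eta> m + \<eta> l" for m l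
  proof -
    have t0: "0 \<le> 2 * \<tau> m + 2 * \<tau> l" by (simp add: \<tau>_def sum_nonneg)
    have "\<mu> * (norm (vs m - vs l))\<^sup>2 \<le> L * (norm (vs m - vs l))\<^sup>2"
      using muL by (intro mult_right_mono) auto
    also have "\<dots> \<le> L * (\<epsilon> * (norm (gs m - gs l))\<^sup>2 + (2 * \<tau> m + 2 * \<tau> l))"
      using muL mu0 by (intro mult_left_mono comp) auto
    also have "\<dots> = (\<epsilon> * L) * (norm (gs m - gs l))\<^sup>2 + L * (2 * \<tau> m + 2 * \<tau> l)" by (simp add: algebra_simps)
    also have "\<dots> \<le> 1/2 * (norm (gs m - gs l))\<^sup>2 + L * (2 * \<tau> m + 2 * \<tau> l)"
      using W(3) by (intro add_right_mono mult_right_mono) auto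
    finally show ?thesis using key[of m l] by (simp add: \<eta>_def algebra_simps)
  qed
  have eta0: "\<eta> \<longlonglongrightarrow> 0"
    using tendsto_add[OF tendsto_mult_right_zero[OF es0, of 4] tendsto_mult_right_zero[OF tau0, of "4 * L"]]
    by (simp add: \<eta>_def)
  have "Cauchy gs" by (rule Cauchy_if_norm_square_le[OF gC eta0])
  then obtain g where g: "gs \<longlonglongrightarrow> g" using Cauchy_convergent_iff convergent_def by blast
  have vC: "(norm (vs m - vs l))\<^sup>2 \<le> (\<epsilon> * \<eta> m + 2 * \<tau> m) + (\<epsilon> * \<eta> l + 2 * \<tau> l)" for m l
    using comp[of m l] mult_left_mono[OF gC[of m l] less_imp_le[OF W(2)]] by (simp add: algebra_simps)
  have "(\<lambda>m. \<epsilon> * \<eta> m + 2 * \<tau> m) \<longlonglongrightarrow> 0"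
    using tendsto_add[OF tendsto_mult_right_zero[OF eta0, of \<epsilon>] tendsto_mult_right_zero[OF tau0, of 2]]
    by simp
  then have "Cauchy vs" by (rule Cauchy_if_norm_square_le[OF vC])
  then obtain v where v: "vs \<longlonglongrightarrow> v" using Cauchy_convergent_iff convergent_def by blast
  have "(\<lambda>m. (vs m, gs m)) \<longlonglongrightarrow> (v, g)" using v g by (rule tendsto_Pair)
  then have vgG: "(v, g) \<in> G"
    using closed_sequentially[OF G(2), of "\<lambda>m. (vs m, gs m)" "(v, g)"] vg(1) by (auto simp: G0_def)
  have orth: "v \<bullet> U i = 0" if "i \<in> I" for i
  proof -
    have "(\<lambda>m. vs m \<bullet> U i) \<longlonglongrightarrow> v \<bullet> U i" by (intro tendsto_intros v)
    moreover have "vs m \<bullet> U i = 0" for m using vg(1)[of m] that by (simp add: G0_def)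
    ultimately show ?thesis by (simp add: LIMSEQ_const_iff)
  qed
  then have vgG0: "(v, g) \<in> G0" using vgG by (simp add: G0_def)
  have "(\<lambda>m. norm (vs m)) \<longlonglongrightarrow> norm v" by (intro tendsto_intros v)
  then have nv: "norm v = 1" by (simp add: vg(2) LIMSEQ_const_iff)
  have "(\<lambda>m. (norm (gs m))\<^sup>2) \<longlonglongrightarrow> (norm g)\<^sup>2" by (intro tendsto_intros g)
  moreover have "(\<lambda>m. \<mu> + es m) \<longlonglongrightarrow> \<mu> + 0" by (intro tendsto_intros es0)
  ultimately have ng: "(norm g)\<^sup>2 \<le> \<mu>"
    using vg(3) by (intro LIMSEQ_le[where X="\<lambda>m. (norm (gs m))\<^sup>2" and Y="\<lambda>m. \<mu> + es m"]) (auto intro: less_imp_le)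
  have var0: "g \<bullet> g' = \<mu> * (v \<bullet> v')" if "(v', g') \<in> G0" for v' g'
  proof -
    define b where "b = g \<bullet> g' - \<mu> * (v \<bullet> v')"
    define c where "c = (norm g')\<^sup>2 - \<mu> * (norm v')\<^sup>2"
    \<comment> \<open>Minimality along the line through the minimiser; a quadratic in
      \<open>t\<close> that vanishes at 0 and is never negative has no linear term.\<close>
    have pos: "0 \<le> 2 * t * b + t\<^sup>2 * c" for t
    proof -
      have "\<mu> * (norm (v + t *\<^sub>R v'))\<^sup>2 \<le> (norm (g + t *\<^sub>R g'))\<^sup>2"
        by (rule low[OF G0_add[OF vgG0 G0_scale[OF that]]])
      then have "\<mu> * (norm v)\<^sup>2 + 2 * t * (\<mu> * (v \<bullet> v')) + t\<^sup>2 * (\<mu> * (norm v')\<^sup>2)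
          \<le> (norm g)\<^sup>2 + 2 * t * (g \<bullet> g') + t\<^sup>2 * (norm g')\<^sup>2"
        unfolding power2_norm_eq_inner
        by (simp add: inner_simps inner_commute power2_eq_square algebra_simps)
      then show ?thesis using ng nv by (simp add: b_def c_def algebra_simps)
    qed
    have c0: "c \<ge> 0" using low[OF that] by (simp add: c_def)
    have "b = 0"
    proof (rule ccontr)
      assume "b \<noteq> 0"
      define s where "s = 1 / (c + 1)"
      have s: "s > 0" "s * c < 1" using c0 by (simp_all add: s_def field_simps)
      have "0 \<le> 2 * (- b * s) * b + (- b * s)\<^sup>2 * c" by (rule pos)
      also have "\<dots> = b\<^sup>2 * s * (s * c - 2)" by (simp add: power2_eq_square algebra_simps)
      also have "\<dots> < 0" using s \<open>b \<noteq> 0\<close> by (intro mult_pos_neg) auto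
      finally show False by simp
    qed
    then show ?thesis by (simp add: b_def)
  qed
  \<comment> \<open>From constrained to arbitrary pairs: subtracting the projection changes neither
    side, since \<open>g\<close> is orthogonal to every \<open>A i\<close> by the eigenvalue
    equation of \<open>U i\<close> tested with the minimiser.\<close>
  have "g \<bullet> g' = \<mu> * (v \<bullet> v')" if vg': "(v', g') \<in> G" for v' g'
  proof -
    define v1 g1 where "v1 = v' - (\<Sum>i\<in>I. (v' \<bullet> U i) *\<^sub>R U i)" and "g1 = g' - (\<Sum>i\<in>I. (v' \<bullet> U i) *\<^sub>R A i)"
    have "((\<Sum>i\<in>I. (v' \<bullet> U i) *\<^sub>R U i), (\<Sum>i\<in>I. (v' \<bullet> U i) *\<^sub>R A i)) = (\<Sum>i\<in>I. (v' \<bullet> U i) *\<^sub>R (U i, A i))"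
      by (simp add: prod_eq_iff fst_sum snd_sum)
    also have "\<dots> \<in> G" by (intro subspace_sum[OF G(1)] subspace_scale[OF G(1)] I(2))
    finally have "(v1, g1) \<in> G" unfolding v1_def g1_def using subspace_diff[OF G(1) vg'] by fastforce
    moreover have "v1 \<bullet> U i = 0" if "i \<in> I" for i
      using that I(1) by (simp add: v1_def inner_simps inner_sum_left I(3) if_distrib cong: sum.cong if_cong)
    ultimately have "g \<bullet> g1 = \<mu> * (v \<bullet> v1)" by (intro var0) (simp add: G0_def)
    moreover have "g \<bullet> g1 = g \<bullet> g'"
    proof -
      have "g \<bullet> A i = 0" if "i \<in> I" for i
        using I(4)[OF that vgG] orth[OF that] by (simp add: inner_commute)
      then show ?thesis by (simp add: g1_def inner_simps inner_sum_right)
    qed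
    moreover have "v \<bullet> v1 = v \<bullet> v'" by (simp add: v1_def inner_simps inner_sum_right orth)
    ultimately show ?thesis by simp
  qed
  moreover have "v \<noteq> 0" using nv by auto
  ultimately show ?thesis using that vgG muL orth by blast
qed

subsection \<open>The inequality of Yang type\<close>

lemma sum_antisymmetric_eq_0:
  fixes h :: "'i \<Rightarrow> 'i \<Rightarrow> real"
  assumes "\<And>i j. i \<in> I \<Longrightarrow> j \<in> I \<Longrightarrow> h j i = - h i j"
  shows "(\<Sum>i\<in>I. \<Sum>j\<in>I. h i j) = 0"
proof -
  have "(\<Sum>i\<in>I. \<Sum>j\<in>I. h i j) = (\<Sum>j\<in>I. \<Sum>i\<in>I. h i j)" by (rule sum.swap)
  also have "\<dots> = (\<Sum>j\<in>I. \<Sum>i\<in>I. - h j i)" by (intro sum.cong refl) (metis assms)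
  also have "\<dots> = - (\<Sum>i\<in>I. \<Sum>j\<in>I. h i j)" by (simp add: sum_negf)
  finally show ?thesis by simp
qed

text \<open>In the application \<open>A i = \<Delta> u\<^sub>i\<close>, \<open>M i = x u\<^sub>i\<close>, \<open>N i = \<Delta> (x u\<^sub>i)\<close> and \<open>B i = X u\<^sub>i\<close>
  for a coordinate \<open>x\<close> and a field \<open>X\<close> with \<open>X x = 1\<close>; the trial functions are \<open>x u\<^sub>i\<close>
  projected away from \<open>u\<^sub>1, \<dots>, u\<^sub>k\<close>.\<close>

lemma yang_inequality_one_direction:
  fixes U A M N B :: "'i \<Rightarrow> 'h::real_inner" and lam :: "'i \<Rightarrow> real"
  assumes I: "finite I"
    and UU: "\<And>i j. i \<in> I \<Longrightarrow> j \<in> I \<Longrightarrow> U i \<bullet> U j = (if i = j then 1 else 0)"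
    and AA: "\<And>i j. i \<in> I \<Longrightarrow> j \<in> I \<Longrightarrow> A i \<bullet> A j = lam i * (U i \<bullet> U j)"
    and AN: "\<And>i j. i \<in> I \<Longrightarrow> j \<in> I \<Longrightarrow> A j \<bullet> N i = lam j * (U j \<bullet> M i)"
    and MU: "\<And>i j. i \<in> I \<Longrightarrow> j \<in> I \<Longrightarrow> M i \<bullet> U j = M j \<bullet> U i"
    and BU: "\<And>i j. i \<in> I \<Longrightarrow> j \<in> I \<Longrightarrow> B i \<bullet> U j = - (B j \<bullet> U i)"
    and MB: "\<And>i. i \<in> I \<Longrightarrow> M i \<bullet> B i = - (1/2)"
    and NN: "\<And>i. i \<in> I \<Longrightarrow> (norm (N i))\<^sup>2 = lam i * (norm (M i))\<^sup>2 + P i"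
    and var: "\<And>i. i \<in> I \<Longrightarrow> L * (norm (M i - (\<Sum>j\<in>I. (M i \<bullet> U j) *\<^sub>R U j)))\<^sup>2
        \<le> (norm (N i - (\<Sum>j\<in>I. (M i \<bullet> U j) *\<^sub>R A j)))\<^sup>2"
    and lamL: "\<And>i. i \<in> I \<Longrightarrow> lam i \<le> L"
    and \<delta>: "\<delta> > 0"
  shows "(\<Sum>i\<in>I. (L - lam i)\<^sup>2)
    \<le> \<delta> * (\<Sum>i\<in>I. (L - lam i)\<^sup>2 * P i) + (1/\<delta>) * (\<Sum>i\<in>I. (L - lam i) * (norm (B i))\<^sup>2)"
proof -
  define a where "a = (\<lambda>i j. M i \<bullet> U j)"
  define c where "c = (\<lambda>i j. B i \<bullet> U j)"
  define l where "l = (\<lambda>i. L - lam i)"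
  have l0: "l i \<ge> 0" if "i \<in> I" for i using lamL[OF that] by (simp add: l_def)
  have asym: "a j i = a i j" if "i \<in> I" "j \<in> I" for i j using MU[OF that] by (simp add: a_def)
  have casym: "c j i = - c i j" if "i \<in> I" "j \<in> I" for i j using BU[OF that] by (simp add: c_def)
  \<comment> \<open>The estimate from a single trial function. The sums over \<open>j\<close>, which
    come from the projection, are kept exactly: they are disposed of only after summation over
    \<open>i\<close>.\<close>
  have row: "(l i)\<^sup>2 + 2 * (\<Sum>j\<in>I. (l i)\<^sup>2 * (a i j * c i j))
      \<le> \<delta> * ((l i)\<^sup>2 * P i) + \<delta> * (\<Sum>j\<in>I. (l i)\<^sup>2 * ((l j - l i) * (a i j)\<^sup>2))
        + (1/\<delta>) * (l i * (norm (B i))\<^sup>2) - (1/\<delta>) * (\<Sum>j\<in>I. l i * (c i j)\<^sup>2)" if i: "i \<in> I" for i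
  proof -
    define \<psi> where "\<psi> = M i - (\<Sum>j\<in>I. a i j *\<^sub>R U j)"
    define D where "D = B i - (\<Sum>j\<in>I. c i j *\<^sub>R U j)"
    have orth: "x \<bullet> (\<Sum>j\<in>I. d j *\<^sub>R U j) = (\<Sum>j\<in>I. d j * (x \<bullet> U j))" for x d
      by (simp add: inner_sum_right)
    have UUs: "(\<Sum>j\<in>I. d j *\<^sub>R U j) \<bullet> U m = d m" if "m \<in> I" for d m
      using that I by (simp add: inner_sum_left UU if_distrib cong: sum.cong if_cong)
    have \<psi>U: "\<psi> \<bullet> U m = 0" if "m \<in> I" for m
      unfolding \<psi>_def inner_diff_left UUs[OF that] by (simp add: a_def)
    have n\<psi>: "(norm \<psi>)\<^sup>2 = (norm (M i))\<^sup>2 - (\<Sum>j\<in>I. (a i j)\<^sup>2)"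
    proof -
      have "\<psi> \<bullet> \<psi> = \<psi> \<bullet> M i - \<psi> \<bullet> (\<Sum>j\<in>I. a i j *\<^sub>R U j)" by (subst (2) \<psi>_def) (simp add: inner_diff_right)
      also have "\<dots> = \<psi> \<bullet> M i" by (simp add: orth \<psi>U)
      also have "\<dots> = M i \<bullet> M i - (\<Sum>j\<in>I. (a i j)\<^sup>2)"
        by (simp add: \<psi>_def inner_diff_left inner_commute[of "sum _ _"] orth a_def power2_eq_square)
      finally show ?thesis by (simp add: power2_norm_eq_inner)
    qed
    have nD: "(norm D)\<^sup>2 = (norm (B i))\<^sup>2 - (\<Sum>j\<in>I. (c i j)\<^sup>2)"
    proof -
      have DU: "D \<bullet> U m = 0" if "m \<in> I" for m
        unfolding D_def inner_diff_left UUs[OF that] by (simp add: c_def)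
      have "D \<bullet> D = D \<bullet> B i - D \<bullet> (\<Sum>j\<in>I. c i j *\<^sub>R U j)" by (subst (2) D_def) (simp add: inner_diff_right)
      also have "\<dots> = D \<bullet> B i" by (simp add: orth DU)
      also have "\<dots> = B i \<bullet> B i - (\<Sum>j\<in>I. (c i j)\<^sup>2)"
        by (simp add: D_def inner_diff_left inner_commute[of "sum _ _"] orth c_def power2_eq_square)
      finally show ?thesis by (simp add: power2_norm_eq_inner)
    qed
    have \<psi>D: "- 2 * (\<psi> \<bullet> D) = 1 + 2 * (\<Sum>j\<in>I. a i j * c i j)"
    proof -
      have "\<psi> \<bullet> D = \<psi> \<bullet> B i" by (simp add: D_def inner_diff_right orth \<psi>U)
      also have "\<dots> = - (1/2) - (\<Sum>j\<in>I. a i j * c i j)"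
        by (simp add: \<psi>_def inner_diff_left MB[OF i] inner_commute[of "sum _ _"] orth c_def)
      finally show ?thesis by simp
    qed
    have nN: "(norm (N i - (\<Sum>j\<in>I. a i j *\<^sub>R A j)))\<^sup>2 = (norm (N i))\<^sup>2 - (\<Sum>j\<in>I. lam j * (a i j)\<^sup>2)"
    proof -
      have 1: "N i \<bullet> (\<Sum>j\<in>I. a i j *\<^sub>R A j) = (\<Sum>j\<in>I. lam j * (a i j)\<^sup>2)"
        by (auto simp: inner_sum_right intro!: sum.cong)
          (metis AN[OF i] a_def inner_commute mult.left_commute power2_eq_square)
      have 2: "(\<Sum>j\<in>I. a i j *\<^sub>R A j) \<bullet> (\<Sum>j\<in>I. a i j *\<^sub>R A j) = (\<Sum>j\<in>I. lam j * (a i j)\<^sup>2)"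
      proof -
        have "A m \<bullet> (\<Sum>j\<in>I. a i j *\<^sub>R A j) = lam m * a i m" if "m \<in> I" for m
          using that I by (simp add: inner_sum_right AA UU if_distrib cong: sum.cong if_cong)
        then show ?thesis
          by (auto simp: inner_sum_left power2_eq_square intro!: sum.cong)
      qed
      show ?thesis unfolding power2_norm_eq_inner inner_diff_left inner_diff_right 2 1
          inner_commute[of "\<Sum>j\<in>I. a i j *\<^sub>R A j" "N i"] by simp
    qed
    \<comment> \<open>The Rayleigh bound for \<open>\<psi>\<close>, from which \<open>lam i\<close>
      times the squared norm of \<open>\<psi>\<close> has been subtracted.\<close>
    have "l i * (norm \<psi>)\<^sup>2 \<le> P i + (\<Sum>j\<in>I. (l j - l i) * (a i j)\<^sup>2)"
    proof -
      have "L * (norm \<psi>)\<^sup>2 \<le> (norm (N i - (\<Sum>j\<in>I. a i j *\<^sub>R A j)))\<^sup>2"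
        using var[OF i] by (simp add: \<psi>_def a_def)
      moreover have "(\<Sum>j\<in>I. (l j - l i) * (a i j)\<^sup>2) = lam i * (\<Sum>j\<in>I. (a i j)\<^sup>2) - (\<Sum>j\<in>I. lam j * (a i j)\<^sup>2)"
        by (simp add: l_def left_diff_distrib sum_subtractf sum_distrib_left)
      moreover have "lam i * (norm \<psi>)\<^sup>2 = lam i * (norm (M i))\<^sup>2 - lam i * (\<Sum>j\<in>I. (a i j)\<^sup>2)"
        by (simp add: n\<psi> right_diff_distrib)
      ultimately show ?thesis using nN NN[OF i] by (simp add: l_def left_diff_distrib)
    qed
    then have w: "\<delta> * (l i)\<^sup>2 * (l i * (norm \<psi>)\<^sup>2) \<le> \<delta> * (l i)\<^sup>2 * (P i + (\<Sum>j\<in>I. (l j - l i) * (a i j)\<^sup>2))"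
      using \<delta> by (intro mult_left_mono) auto
    \<comment> \<open>The square to be completed. The later factor \<open>l i / \<delta>\<close>
      gives the cross term the weight \<open>(l i)^2\<close> wanted on the left.\<close>
    have "0 \<le> (norm ((\<delta> * l i) *\<^sub>R \<psi> + D))\<^sup>2" by simp
    also have "\<dots> = \<delta>\<^sup>2 * (l i)\<^sup>2 * (norm \<psi>)\<^sup>2 + 2 * \<delta> * l i * (\<psi> \<bullet> D) + (norm D)\<^sup>2"
      unfolding power2_norm_eq_inner
      by (simp add: inner_simps inner_commute[of D \<psi>] power2_eq_square[of \<delta>] power2_eq_square[of "l i"]
          distrib_left)
    finally have "0 \<le> (l i / \<delta>) * (\<delta>\<^sup>2 * (l i)\<^sup>2 * (norm \<psi>)\<^sup>2 + 2 * \<delta> * l i * (\<psi> \<bullet> D) + (norm D)\<^sup>2)"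
      using \<delta> l0[OF i] by simp
    also have "\<dots> = \<delta> * (l i)\<^sup>2 * (l i * (norm \<psi>)\<^sup>2) - (l i)\<^sup>2 * (- 2 * (\<psi> \<bullet> D)) + (l i / \<delta>) * (norm D)\<^sup>2"
      using \<delta> by (simp add: field_simps power2_eq_square)
    finally have "(l i)\<^sup>2 * (1 + 2 * (\<Sum>j\<in>I. a i j * c i j))
        \<le> \<delta> * (l i)\<^sup>2 * (P i + (\<Sum>j\<in>I. (l j - l i) * (a i j)\<^sup>2)) + (l i / \<delta>) * ((norm (B i))\<^sup>2 - (\<Sum>j\<in>I. (c i j)\<^sup>2))"
      using w unfolding \<psi>D nD by linarith
    then show ?thesis unfolding sum_distrib_left[symmetric]
      by (simp add: distrib_left right_diff_distrib mult.assoc)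
  qed
  \<comment> \<open>As \<open>a\<close> is symmetric and \<open>c\<close> antisymmetric, the part
    with the symmetric weight \<open>l i * l j\<close> sums to 0; \<open>2\<close> works in the same
    way.\<close>
  have 1: "(\<Sum>i\<in>I. \<Sum>j\<in>I. (l i)\<^sup>2 * (a i j * c i j)) = (\<Sum>i\<in>I. \<Sum>j\<in>I. l i * (l i - l j) * (a i j * c i j))"
  proof -
    have "(\<Sum>i\<in>I. \<Sum>j\<in>I. l i * l j * (a i j * c i j)) = 0"
    proof (rule sum_antisymmetric_eq_0)
      fix i j assume ij: "i \<in> I" "j \<in> I"
      show "l j * l i * (a j i * c j i) = - (l i * l j * (a i j * c i j))"
        by (simp only: asym[OF ij] casym[OF ij]) simp
    qed
    moreover have "(l i)\<^sup>2 * (a i j * c i j)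
        = l i * l j * (a i j * c i j) + l i * (l i - l j) * (a i j * c i j)" for i j
      by (simp add: algebra_simps power2_eq_square)
    ultimately show ?thesis by (simp add: sum.distrib)
  qed
  have 2: "(\<Sum>i\<in>I. \<Sum>j\<in>I. (l i)\<^sup>2 * ((l j - l i) * (a i j)\<^sup>2)) = - (\<Sum>i\<in>I. \<Sum>j\<in>I. l i * (l i - l j)\<^sup>2 * (a i j)\<^sup>2)"
  proof -
    have "(\<Sum>i\<in>I. \<Sum>j\<in>I. l i * l j * (l j - l i) * (a i j)\<^sup>2) = 0"
    proof (rule sum_antisymmetric_eq_0)
      fix i j assume ij: "i \<in> I" "j \<in> I"
      show "l j * l i * (l i - l j) * (a j i)\<^sup>2 = - (l i * l j * (l j - l i) * (a i j)\<^sup>2)"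
        by (simp only: asym[OF ij]) (simp add: algebra_simps)
    qed
    moreover have "(l i)\<^sup>2 * ((l j - l i) * (a i j)\<^sup>2)
        = l i * l j * (l j - l i) * (a i j)\<^sup>2 - l i * (l i - l j)\<^sup>2 * (a i j)\<^sup>2" for i j
      by (simp add: algebra_simps power2_eq_square)
    ultimately show ?thesis by (simp add: sum_subtractf)
  qed
  \<comment> \<open>What \<open>1\<close>, \<open>2\<close> and the Bessel term of \<open>B\<close>
    leave behind is a perfect square, so the projection terms have a favourable sign in
    total.\<close>
  have 3: "0 \<le> (\<Sum>i\<in>I. \<Sum>j\<in>I. 2 * (l i * (l i - l j) * (a i j * c i j))
      + \<delta> * (l i * (l i - l j)\<^sup>2 * (a i j)\<^sup>2) + (1/\<delta>) * (l i * (c i j)\<^sup>2))"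
  proof (intro sum_nonneg)
    fix i j assume "i \<in> I" "j \<in> I"
    have "2 * (l i * (l i - l j) * (a i j * c i j))
      + \<delta> * (l i * (l i - l j)\<^sup>2 * (a i j)\<^sup>2) + (1/\<delta>) * (l i * (c i j)\<^sup>2)
      = l i / \<delta> * (\<delta> * (l i - l j) * a i j + c i j)\<^sup>2"
      using \<delta> by (simp add: field_simps power2_eq_square)
    also have "\<dots> \<ge> 0" using \<delta> l0[OF \<open>i \<in> I\<close>] by simp
    finally show "0 \<le> 2 * (l i * (l i - l j) * (a i j * c i j))
      + \<delta> * (l i * (l i - l j)\<^sup>2 * (a i j)\<^sup>2) + (1/\<delta>) * (l i * (c i j)\<^sup>2)" .
  qed
  have "(\<Sum>i\<in>I. (l i)\<^sup>2 + 2 * (\<Sum>j\<in>I. (l i)\<^sup>2 * (a i j * c i j)))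
      \<le> (\<Sum>i\<in>I. \<delta> * ((l i)\<^sup>2 * P i) + \<delta> * (\<Sum>j\<in>I. (l i)\<^sup>2 * ((l j - l i) * (a i j)\<^sup>2))
        + (1/\<delta>) * (l i * (norm (B i))\<^sup>2) - (1/\<delta>) * (\<Sum>j\<in>I. l i * (c i j)\<^sup>2))"
    by (intro sum_mono row)
  then have "(\<Sum>i\<in>I. (l i)\<^sup>2) + 2 * (\<Sum>i\<in>I. \<Sum>j\<in>I. (l i)\<^sup>2 * (a i j * c i j))
      \<le> \<delta> * (\<Sum>i\<in>I. (l i)\<^sup>2 * P i) + \<delta> * (\<Sum>i\<in>I. \<Sum>j\<in>I. (l i)\<^sup>2 * ((l j - l i) * (a i j)\<^sup>2))
        + (1/\<delta>) * (\<Sum>i\<in>I. l i * (norm (B i))\<^sup>2) - (1/\<delta>) * (\<Sum>i\<in>I. \<Sum>j\<in>I. l i * (c i j)\<^sup>2)"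
    by (simp only: sum.distrib sum_subtractf sum_distrib_left[symmetric])
  moreover have "L - lam i = l i" for i by (simp add: l_def)
  ultimately show ?thesis using 3 unfolding 1 2
    unfolding sum.distrib sum_distrib_left[symmetric] by simp
qed

subsection \<open>The Hilbert space of square-integrable functions\<close>

definition sqint :: "('a::euclidean_space \<Rightarrow> real) \<Rightarrow> bool" where
  "sqint f \<longleftrightarrow> f \<in> borel_measurable lebesgue \<and> integrable lebesgue (\<lambda>x. (f x)\<^sup>2)"

lemma sqint_measurable [measurable_dest]: "sqint f \<Longrightarrow> f \<in> borel_measurable lebesgue"
  by (simp add: sqint_def)

lemma sqint_integrable_mult:
  assumes "sqint f" "sqint g"
  shows "integrable lebesgue (\<lambda>x. f x * g x)"
proof (rule Bochner_Integration.integrable_bound)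
  show "integrable lebesgue (\<lambda>x. (f x)\<^sup>2 + (g x)\<^sup>2)" using assms by (simp add: sqint_def)
  show "(\<lambda>x. f x * g x) \<in> borel_measurable lebesgue" using assms by measurable
  have "\<bar>f x * g x\<bar> \<le> (f x)\<^sup>2 + (g x)\<^sup>2" for x
  proof -
    have "2 * \<bar>f x\<bar> * \<bar>g x\<bar> \<le> (f x)\<^sup>2 + (g x)\<^sup>2" using sum_squares_bound[of "\<bar>f x\<bar>" "\<bar>g x\<bar>"] by simp
    then show ?thesis using zero_le_power2[of "f x"] zero_le_power2[of "g x"] unfolding abs_mult by linarith
  qed
  then show "AE x in lebesgue. norm (f x * g x) \<le> norm ((f x)\<^sup>2 + (g x)\<^sup>2)" by simp
qed

lemma sqint_add:
  assumes "sqint f" "sqint g"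
  shows "sqint (\<lambda>x. f x + g x)"
proof -
  have "integrable lebesgue (\<lambda>x. (f x)\<^sup>2 + (g x)\<^sup>2 + 2 * (f x * g x))"
    using assms sqint_integrable_mult[OF assms] by (auto simp: sqint_def)
  then show ?thesis using assms by (auto simp: sqint_def power2_sum mult.assoc)
qed

lemma sqint_cmult: "sqint f \<Longrightarrow> sqint (\<lambda>x. c * f x)"
  by (auto simp: sqint_def power_mult_distrib)

lemma sqint_uminus: "sqint f \<Longrightarrow> sqint (\<lambda>x. - f x)"
  by (auto simp: sqint_def)

lemma sqint_diff: "sqint f \<Longrightarrow> sqint g \<Longrightarrow> sqint (\<lambda>x. f x - g x)"
  using sqint_add[of f "\<lambda>x. - g x"] sqint_uminus[of g] by simp

lemma sqint_zero: "sqint (\<lambda>x. 0)"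
  by (simp add: sqint_def)

definition l2rel :: "('a::euclidean_space \<Rightarrow> real) \<Rightarrow> ('a \<Rightarrow> real) \<Rightarrow> bool" where
  "l2rel f g \<longleftrightarrow> sqint f \<and> sqint g \<and> (AE x in lebesgue. f x = g x)"

lemma l2rel_refl: "l2rel f f \<longleftrightarrow> sqint f"
  by (simp add: l2rel_def)

lemma part_equivp_l2rel: "part_equivp l2rel"
proof (rule part_equivpI)
  show "\<exists>f. l2rel f f" using sqint_zero l2rel_refl by blast
  show "symp l2rel" by (auto intro!: sympI simp: l2rel_def elim: AE_mp)
  show "transp l2rel" by (rule transpI) (auto simp: l2rel_def elim!: AE_mp)
qed

\<comment> \<open>A partial quotient excludes functions that are not square-integrable. Having
  classes as a type makes the abstract results on real inner product spaces applicable, including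
  those that need completeness.\<close>
quotient_type (overloaded) 'a l2 = "'a::euclidean_space \<Rightarrow> real" / partial: l2rel
  by (rule part_equivp_l2rel)

instantiation l2 :: (euclidean_space) real_vector
begin

lift_definition zero_l2 :: "'a l2" is "\<lambda>x. 0" by (simp add: l2rel_refl sqint_zero)

lift_definition plus_l2 :: "'a l2 \<Rightarrow> 'a l2 \<Rightarrow> 'a l2" is "\<lambda>f g x. f x + g x"
  unfolding l2rel_def by (auto intro!: sqint_add elim!: AE_mp)

lift_definition minus_l2 :: "'a l2 \<Rightarrow> 'a l2 \<Rightarrow> 'a l2" is "\<lambda>f g x. f x - g x"
  unfolding l2rel_def by (auto intro!: sqint_diff elim!: AE_mp)

lift_definition uminus_l2 :: "'a l2 \<Rightarrow> 'a l2" is "\<lambda>f x. - f x"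
  unfolding l2rel_def by (auto intro!: sqint_uminus elim!: AE_mp)

lift_definition scaleR_l2 :: "real \<Rightarrow> 'a l2 \<Rightarrow> 'a l2" is "\<lambda>c f x. c * f x"
  unfolding l2rel_def by (auto intro!: sqint_cmult elim!: AE_mp)

instance
proof
  fix f g h :: "'a l2" and c d :: real
  show "f + g + h = f + (g + h)"
    by transfer (auto simp: l2rel_def algebra_simps intro!: sqint_add sqint_diff)
  show "f + g = g + f"
    by transfer (auto simp: l2rel_def algebra_simps intro!: sqint_add sqint_diff)
  show "0 + f = f" by transfer (auto simp: l2rel_def)
  show "- f + f = 0" by transfer (auto simp: l2rel_def sqint_zero)
  show "f - g = f + - g" by transfer (auto simp: l2rel_def intro!: sqint_add sqint_diff)
  show "c *\<^sub>R (f + g) = c *\<^sub>R f + c *\<^sub>R g"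
    by transfer (auto simp: l2rel_def distrib_left intro!: sqint_add sqint_cmult)
  show "(c + d) *\<^sub>R f = c *\<^sub>R f + d *\<^sub>R f"
    by transfer (auto simp: l2rel_def distrib_right intro!: sqint_add sqint_cmult)
  show "c *\<^sub>R d *\<^sub>R f = (c * d) *\<^sub>R f"
    by transfer (auto simp: l2rel_def mult.assoc intro!: sqint_add sqint_cmult)
  show "1 *\<^sub>R f = f" by transfer (auto simp: l2rel_def)
qed

end

instantiation l2 :: (euclidean_space) real_inner
begin

lift_definition inner_l2 :: "'a l2 \<Rightarrow> 'a l2 \<Rightarrow> real" is "\<lambda>f g. \<integral>x. f x * g x \<partial>lebesgue"
  unfolding l2rel_def
  by (intro integral_cong_AE) (auto intro!: borel_measurable_times elim!: AE_mp dest: sqint_measurable)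

definition norm_l2 :: "'a l2 \<Rightarrow> real" where "norm_l2 f = sqrt (f \<bullet> f)"
definition sgn_l2 :: "'a l2 \<Rightarrow> 'a l2" where "sgn_l2 f = f /\<^sub>R norm f"
definition dist_l2 :: "'a l2 \<Rightarrow> 'a l2 \<Rightarrow> real" where "dist_l2 f g = norm (f - g)"
definition uniformity_l2 :: "('a l2 \<times> 'a l2) filter" where
  "uniformity_l2 = (INF e\<in>{0<..}. principal {(f, g). dist f g < e})"
definition open_l2 :: "'a l2 set \<Rightarrow> bool" where
  "open_l2 S \<longleftrightarrow> (\<forall>f\<in>S. \<forall>\<^sub>F (f', g) in uniformity. f' = f \<longrightarrow> g \<in> S)"

instance
proof
  fix f g h :: "'a l2" and c :: real
  show "dist f g = norm (f - g)" by (simp add: dist_l2_def)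
  show "sgn f = f /\<^sub>R norm f" by (simp add: sgn_l2_def)
  show "uniformity = (INF e\<in>{0<..}. principal {(f, g :: 'a l2). dist f g < e})"
    by (simp add: uniformity_l2_def)
  show "open S \<longleftrightarrow> (\<forall>f\<in>S. \<forall>\<^sub>F (f', g) in uniformity. f' = f \<longrightarrow> g \<in> S)" for S :: "'a l2 set"
    by (simp add: open_l2_def)
  show "f \<bullet> g = g \<bullet> f" by transfer (simp add: mult.commute)
  show "(f + g) \<bullet> h = f \<bullet> h + g \<bullet> h"
    by transfer (simp add: l2rel_refl distrib_right sqint_integrable_mult)
  show "(c *\<^sub>R f) \<bullet> g = c * (f \<bullet> g)" by transfer (simp add: mult.assoc)
  show "0 \<le> f \<bullet> f" by transfer simp
  show "f \<bullet> f = 0 \<longleftrightarrow> f = 0"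
  proof transfer
    fix f :: "'a \<Rightarrow> real" assume "l2rel f f"
    then have f: "sqint f" by (simp add: l2rel_refl)
    then have "(\<integral>x. f x * f x \<partial>lebesgue) = 0 \<longleftrightarrow> (AE x in lebesgue. f x * f x = 0)"
      by (intro integral_nonneg_eq_0_iff_AE sqint_integrable_mult) auto
    then show "(\<integral>x. f x * f x \<partial>lebesgue) = 0 \<longleftrightarrow> l2rel f (\<lambda>x. 0)"
      using f by (simp add: l2rel_def sqint_zero)
  qed
  show "norm f = sqrt (f \<bullet> f)" by (simp add: norm_l2_def)
qed

end

abbreviation cls :: "('a::euclidean_space \<Rightarrow> real) \<Rightarrow> 'a l2" where
  "cls \<equiv> abs_l2"

lemma l2_cases:
  obtains f where "sqint f" "h = cls f"
proof
  show "sqint (rep_l2 h)" using Quotient3_rep_reflp[OF Quotient3_l2, of h] by (simp add: l2rel_refl)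
  show "h = cls (rep_l2 h)" using Quotient3_abs_rep[OF Quotient3_l2, of h] by simp
qed

lemma cls_eq_iff: "sqint f \<Longrightarrow> sqint g \<Longrightarrow> cls f = cls g \<longleftrightarrow> (AE x in lebesgue. f x = g x)"
  using Quotient3_rel[OF Quotient3_l2, of f g] by (simp add: l2rel_def)

lemma cls_add: "sqint f \<Longrightarrow> sqint g \<Longrightarrow> cls (\<lambda>x. f x + g x) = cls f + cls g"
  by (simp add: plus_l2.abs_eq l2rel_refl)

lemma cls_diff: "sqint f \<Longrightarrow> sqint g \<Longrightarrow> cls (\<lambda>x. f x - g x) = cls f - cls g"
  by (simp add: minus_l2.abs_eq l2rel_refl)

lemma cls_cmult: "sqint f \<Longrightarrow> cls (\<lambda>x. c * f x) = c *\<^sub>R cls f"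
  by (simp add: scaleR_l2.abs_eq l2rel_refl)

lemma cls_zero: "cls (\<lambda>x. 0) = 0"
  by (simp add: zero_l2_def)

lemma inner_cls: "sqint f \<Longrightarrow> sqint g \<Longrightarrow> cls f \<bullet> cls g = (\<integral>x. f x * g x \<partial>lebesgue)"
  by (simp add: inner_l2.abs_eq l2rel_refl)

lemma norm_cls: "sqint f \<Longrightarrow> (norm (cls f))\<^sup>2 = (\<integral>x. (f x)\<^sup>2 \<partial>lebesgue)"
  unfolding power2_norm_eq_inner by (simp add: inner_cls power2_eq_square)

lemma nn_integral_cls: "sqint f \<Longrightarrow> (\<integral>\<^sup>+x. ennreal ((f x)\<^sup>2) \<partial>lebesgue) = ennreal ((norm (cls f))\<^sup>2)"
  by (subst nn_integral_eq_integral) (auto simp: sqint_def norm_cls)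

lemma sqint_if_nn_integral_finite:
  assumes "f \<in> borel_measurable lebesgue" "(\<integral>\<^sup>+x. ennreal ((f x)\<^sup>2) \<partial>lebesgue) < \<infinity>"
  shows "sqint f"
  unfolding sqint_def using assms by (auto intro!: integrableI_nonneg)

text \<open>Riesz--Fischer: along a fast subsequence \<open>\<Sum> 4\<^sup>n |F\<^sub>n\<^sub>+\<^sub>1 - F\<^sub>n|\<^sup>2\<close> is integrable, hence
  finite almost everywhere, which makes \<open>F\<^sub>n\<close> converge geometrically there.\<close>

instance l2 :: (euclidean_space) complete_space
proof
  fix X :: "nat \<Rightarrow> 'a l2" assume X: "Cauchy X"
  have "\<exists>N. \<forall>m\<ge>N. \<forall>n\<ge>N. norm (X m - X n) < (1/4) ^ j" for j
    by (rule CauchyD[OF X]) simp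
  then obtain N where N: "\<And>j m n. m \<ge> N j \<Longrightarrow> n \<ge> N j \<Longrightarrow> norm (X m - X n) < (1/4) ^ j"
    by metis
  \<comment> \<open>The sum dominates every \<open>N j\<close> met so far; the added
    \<open>j\<close> makes \<open>r\<close> strictly increasing.\<close>
  define r where "r = (\<lambda>j. j + (\<Sum>i\<le>j. N i))"
  have rN: "r m \<ge> N j" if "m \<ge> j" for m j
  proof -
    have "N j \<le> (\<Sum>i\<le>m. N i)" using that by (intro member_le_sum) auto
    then show ?thesis by (simp add: r_def)
  qed
  have r_mono: "strict_mono r" unfolding r_def by (rule strict_monoI_Suc) simp
  have "\<exists>F. \<forall>n. sqint (F n) \<and> X (r n) = cls (F n)"
    by (intro choice allI) (metis l2_cases)
  then obtain F where F: "\<And>n. sqint (F n)" "\<And>n. X (r n) = cls (F n)" by blast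
  note [measurable] = sqint_measurable[OF F(1)]
  define D where "D = (\<lambda>n x. F (Suc n) x - F n x)"
  have D: "sqint (D n)" for n unfolding D_def by (intro sqint_diff F)
  note [measurable] = sqint_measurable[OF D]
  have nD: "(norm (cls (D n)))\<^sup>2 \<le> (1/16) ^ n" for n
  proof -
    have "norm (cls (D n)) \<le> (1/4) ^ n"
      unfolding D_def by (subst cls_diff) (auto simp: F simp flip: F(2) intro!: less_imp_le N rN)
    then have "(norm (cls (D n)))\<^sup>2 \<le> ((1/4) ^ n)\<^sup>2" by (rule power_mono) simp
    then show ?thesis by (simp add: power2_eq_square flip: power_mult_distrib)
  qed
  have "(\<integral>\<^sup>+x. (\<Sum>n. ennreal (4 ^ n * (D n x)\<^sup>2)) \<partial>lebesgue) = (\<Sum>n. \<integral>\<^sup>+x. ennreal (4 ^ n * (D n x)\<^sup>2) \<partial>lebesgue)"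
    by (intro nn_integral_suminf) measurable
  also have "\<dots> \<le> (\<Sum>n. ennreal ((1/4) ^ n))"
  proof (intro suminf_le summableI)
    fix n
    have "(\<integral>\<^sup>+x. ennreal (4 ^ n * (D n x)\<^sup>2) \<partial>lebesgue) = ennreal (4 ^ n) * ennreal ((norm (cls (D n)))\<^sup>2)"
      by (simp add: ennreal_mult nn_integral_cmult nn_integral_cls[OF D])
    also have "\<dots> = ennreal (4 ^ n * (norm (cls (D n)))\<^sup>2)" by (simp add: ennreal_mult)
    also have "\<dots> \<le> ennreal (4 ^ n * (1/16) ^ n)" by (intro ennreal_leI mult_left_mono nD) simp
    also have "4 ^ n * (1/16) ^ n = ((1/4) ^ n :: real)" by (simp flip: power_mult_distrib)
    finally show "(\<integral>\<^sup>+x. ennreal (4 ^ n * (D n x)\<^sup>2) \<partial>lebesgue) \<le> ennreal ((1/4) ^ n)" .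
  qed
  also have "\<dots> < \<infinity>"
    by (subst suminf_ennreal2) (auto intro!: summable_geometric)
  finally have fin: "(\<integral>\<^sup>+x. (\<Sum>n. ennreal (4 ^ n * (D n x)\<^sup>2)) \<partial>lebesgue) < \<infinity>" .
  have "AE x in lebesgue. (\<Sum>n. ennreal (4 ^ n * (D n x)\<^sup>2)) \<noteq> \<infinity>"
    by (rule nn_integral_noteq_infinite) (use fin in \<open>auto simp: less_top\<close>)
  then have conv: "AE x in lebesgue. convergent (\<lambda>n. F n x)"
  proof (rule AE_mp, intro AE_I2 impI)
    fix x assume *: "(\<Sum>n. ennreal (4 ^ n * (D n x)\<^sup>2)) \<noteq> \<infinity>"
    define z where "z = (\<Sum>n. ennreal (4 ^ n * (D n x)\<^sup>2))"
    define M where "M = enn2real z"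
    have "z < top" using * unfolding z_def[symmetric] by (simp add: less_top)
    then have M: "M \<ge> 0" "z = ennreal M" by (simp_all add: M_def)
    have bound: "norm (D n x) \<le> sqrt M * (1/2) ^ n" for n
    proof -
      have "(\<Sum>m\<in>{n}. ennreal (4 ^ m * (D m x)\<^sup>2)) \<le> z"
        unfolding z_def by (rule sum_le_suminf[OF summableI]) auto
      then have "ennreal (4 ^ n * (D n x)\<^sup>2) \<le> ennreal M" unfolding M(2)[symmetric] by simp
      then have "4 ^ n * (D n x)\<^sup>2 \<le> M" using M(1) by (subst (asm) ennreal_le_iff) auto
      moreover have "4 ^ n * (D n x)\<^sup>2 = (2 ^ n * D n x)\<^sup>2"
        using power_mult[of "2::real" 2 n] power_mult[of "2::real" n 2]
        by (simp add: power_mult_distrib mult.commute)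
      ultimately have "\<bar>2 ^ n * D n x\<bar> \<le> sqrt M" using real_le_rsqrt[of "\<bar>2 ^ n * D n x\<bar>" M] by simp
      then show ?thesis by (simp add: abs_mult power_one_over field_simps)
    qed
    have "summable (\<lambda>n. D n x)"
      by (rule summable_comparison_test'[OF _ bound]) (auto intro!: summable_mult summable_geometric)
    then have "summable (\<lambda>n. F (Suc n) x - F n x)" by (simp add: D_def)
    then have "convergent (\<lambda>n. F n x - F 0 x)"
      using sum_lessThan_telescope[of "\<lambda>n. F n x"] by (simp add: summable_iff_convergent)
    then have "convergent (\<lambda>n. (F n x - F 0 x) + F 0 x)" by (intro convergent_add convergent_const)
    then show "convergent (\<lambda>n. F n x)" by simp
  qed
  define f where "f = (\<lambda>x. lim (\<lambda>n. F n x))"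
  have [measurable]: "f \<in> borel_measurable lebesgue" unfolding f_def by measurable
  \<comment> \<open>Fatou's lemma turns pointwise convergence into a bound in the mean, which also
    yields that \<open>f\<close> is square-integrable.\<close>
  have close: "sqint (\<lambda>x. f x - F j x) \<and> norm (cls (\<lambda>x. f x - F j x)) \<le> (1/4) ^ j" for j
  proof -
    have "(\<integral>\<^sup>+x. ennreal ((f x - F j x)\<^sup>2) \<partial>lebesgue)
        = (\<integral>\<^sup>+x. liminf (\<lambda>n. ennreal ((F n x - F j x)\<^sup>2)) \<partial>lebesgue)"
    proof (rule nn_integral_cong_AE, rule AE_mp[OF conv], intro AE_I2 impI)
      fix x assume "convergent (\<lambda>n. F n x)"
      then have "(\<lambda>n. F n x) \<longlonglongrightarrow> f x" by (simp add: f_def convergent_LIMSEQ_iff)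
      then have "(\<lambda>n. ennreal ((F n x - F j x)\<^sup>2)) \<longlonglongrightarrow> ennreal ((f x - F j x)\<^sup>2)"
        by (intro tendsto_intros)
      then show "ennreal ((f x - F j x)\<^sup>2) = liminf (\<lambda>n. ennreal ((F n x - F j x)\<^sup>2))"
        by (rule lim_imp_Liminf[symmetric, rotated]) simp
    qed
    also have "\<dots> \<le> liminf (\<lambda>n. \<integral>\<^sup>+x. ennreal ((F n x - F j x)\<^sup>2) \<partial>lebesgue)"
      by (rule nn_integral_liminf) measurable
    also have "\<dots> \<le> ennreal (((1/4) ^ j)\<^sup>2)"
    proof (rule Liminf_le)
      show "\<forall>\<^sub>F n in sequentially. (\<integral>\<^sup>+x. ennreal ((F n x - F j x)\<^sup>2) \<partial>lebesgue) \<le> ennreal (((1/4) ^ j)\<^sup>2)"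
        using eventually_ge_at_top[of j]
      proof eventually_elim
        case (elim n)
        have "norm (cls (\<lambda>x. F n x - F j x)) \<le> (1/4) ^ j"
          using elim by (subst cls_diff) (auto simp: F simp flip: F(2) intro!: less_imp_le N rN)
        then show ?case by (auto simp: nn_integral_cls sqint_diff F intro!: ennreal_leI power_mono)
      qed
    qed simp
    finally have le: "(\<integral>\<^sup>+x. ennreal ((f x - F j x)\<^sup>2) \<partial>lebesgue) \<le> ennreal (((1/4) ^ j)\<^sup>2)" .
    have sq: "sqint (\<lambda>x. f x - F j x)"
      by (rule sqint_if_nn_integral_finite) (use le in \<open>auto intro: le_less_trans\<close>)
    have "(norm (cls (\<lambda>x. f x - F j x)))\<^sup>2 \<le> ((1/4) ^ j)\<^sup>2"
      using le by (simp add: nn_integral_cls[OF sq])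
    then show ?thesis using sq by (auto intro: power2_le_imp_le)
  qed
  have sqf: "sqint f" using sqint_add[OF conjunct1[OF close[of 0]] F(1)[of 0]] by simp
  have "(\<lambda>j. X (r j)) \<longlonglongrightarrow> cls f"
  proof (rule LIM_zero_cancel, rule Lim_null_comparison)
    show "\<forall>\<^sub>F j in sequentially. norm (X (r j) - cls f) \<le> (1/4) ^ j"
      using close by (auto simp: F cls_diff sqf norm_minus_commute)
    show "(\<lambda>j. (1/4) ^ j :: real) \<longlonglongrightarrow> 0" by (rule LIMSEQ_realpow_zero) auto
  qed
  then show "convergent X"
    using Cauchy_converges_subseq[OF X r_mono] by (auto simp: o_def convergent_def)
qed

subsection \<open>Translations\<close>

lemma measurable_lebesgue_shift [measurable]:
  "(\<lambda>x::'a::euclidean_space. x + h) \<in> lebesgue \<rightarrow>\<^sub>M lebesgue"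
  using lebesgue_affine_measurable[of "\<lambda>_. 1" h] by (simp add: euclidean_representation add.commute)

lemma distr_lebesgue_shift: "distr lebesgue lebesgue (\<lambda>x::'a::euclidean_space. x + h) = lebesgue"
  using lebesgue_affine_euclidean[of "\<lambda>_. 1" h]
  by (simp add: euclidean_representation add.commute[of h] density_1)

lemma integral_lebesgue_shift:
  fixes f :: "'a::euclidean_space \<Rightarrow> real"
  assumes "f \<in> borel_measurable lebesgue"
  shows "(\<integral>x. f (x + h) \<partial>lebesgue) = (\<integral>x. f x \<partial>lebesgue)"
  using integral_distr[OF measurable_lebesgue_shift assms, of h] by (simp add: distr_lebesgue_shift)

lemma AE_lebesgue_shift:
  fixes P :: "'a::euclidean_space \<Rightarrow> bool"
  assumes "AE x in lebesgue. P x"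
  shows "AE x in lebesgue. P (x + h)"
  by (rule AE_distrD[OF measurable_lebesgue_shift]) (unfold distr_lebesgue_shift, rule assms)

lemma sqint_shift: 
  assumes "sqint f"
  shows "sqint (\<lambda>x. f (x + h))"
proof -
  have [measurable]: "f \<in> borel_measurable lebesgue" using assms by (simp add: sqint_def)
  have "integrable (distr lebesgue lebesgue (\<lambda>x. x + h)) (\<lambda>x. (f x)\<^sup>2)"
    using assms by (simp add: distr_lebesgue_shift sqint_def)
  then have "integrable lebesgue (\<lambda>x. (f (x + h))\<^sup>2)"
    by (rule integrable_distr[OF measurable_lebesgue_shift])
  then show ?thesis by (simp add: sqint_def)
qed

lift_definition shift :: "'a::euclidean_space \<Rightarrow> 'a l2 \<Rightarrow> 'a l2" is "\<lambda>h f x. f (x + h)"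
  unfolding l2rel_def by (auto intro!: sqint_shift AE_lebesgue_shift)

lemma cls_shift: "sqint f \<Longrightarrow> cls (\<lambda>x. f (x + h)) = shift h (cls f)"
  by (simp add: shift.abs_eq l2rel_refl)

lemma inner_shift: "shift h f \<bullet> shift h g = f \<bullet> g"
proof -
  obtain f' g' where fg: "sqint f'" "f = cls f'" "sqint g'" "g = cls g'" by (metis l2_cases)
  then have [measurable]: "f' \<in> borel_measurable lebesgue" "g' \<in> borel_measurable lebesgue"
    by (auto simp: sqint_def)
  show ?thesis using integral_lebesgue_shift[of "\<lambda>x. f' x * g' x" h]
    by (simp add: fg inner_cls sqint_shift flip: cls_shift)
qed

lemma linear_shift: "linear (shift h)"
proof (rule linearI)
  fix f g :: "'a l2" and c :: real
  show "shift h (f + g) = shift h f + shift h g"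
    by transfer (auto simp: l2rel_def intro!: sqint_add sqint_shift)
  show "shift h (c *\<^sub>R f) = c *\<^sub>R shift h f"
    by transfer (auto simp: l2rel_def intro!: sqint_cmult sqint_shift)
qed

lemma shift_add: "shift (h + k) f = shift h (shift k f)"
  by transfer (auto simp: l2rel_def add.assoc intro!: sqint_shift)

lemma shift_zero: "shift 0 f = f"
  by transfer (auto simp: l2rel_def)

lemma unitary_flow_shift: "unitary_flow (\<lambda>r. shift (r *\<^sub>R h))"
  by (rule unitary_flow.intro) (simp_all add: linear_shift scaleR_left_distrib shift_add shift_zero inner_shift)

subsection \<open>Smooth functions\<close>

lemma vf_deriv_at: "(f has_derivative f') (at z) \<Longrightarrow> vf_deriv V f z = f' (V z)"
  by (simp add: vf_deriv_def frechet_derivative_at[symmetric])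

lemma Ck_on_continuous: "Ck_on k UNIV f \<Longrightarrow> continuous_on UNIV f"
  by (cases k) (auto intro!: continuous_at_imp_continuous_on differentiable_imp_continuous_within)

lemma Ck_on_decSuc: "Ck_on (Suc k) UNIV f \<Longrightarrow> Ck_on k UNIV f"
proof (induction k arbitrary: f)
  case 0 then show ?case using Ck_on_continuous[of "Suc 0" f] by simp
next
  case (Suc k)
  then show ?case unfolding Ck_on.simps(2)[of "Suc k"] Ck_on.simps(2)[of k] by blast
qed

lemma Ck_on_add: "Ck_on k UNIV f \<Longrightarrow> Ck_on k UNIV g \<Longrightarrow> Ck_on k UNIV (\<lambda>z. f z + g z)"
proof (induction k arbitrary: f g)
  case (Suc k)
  have "frechet_derivative (\<lambda>z. f z + g z) (at z) b
      = frechet_derivative f (at z) b + frechet_derivative g (at z) b" for z b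
  proof -
    have "((\<lambda>z. f z + g z) has_derivative
        (\<lambda>b. frechet_derivative f (at z) b + frechet_derivative g (at z) b)) (at z)"
      using Suc.prems by (intro has_derivative_add) (auto simp flip: frechet_derivative_works)
    from frechet_derivative_at[OF this] show ?thesis by (simp add: fun_eq_iff)
  qed
  then show ?case using Suc by (auto intro: differentiable_add)
qed (auto intro: continuous_intros)

lemma Ck_on_mult: "Ck_on k UNIV f \<Longrightarrow> Ck_on k UNIV g \<Longrightarrow> Ck_on k UNIV (\<lambda>z. f z * g z)"
proof (induction k arbitrary: f g)
  case (Suc k)
  have "frechet_derivative (\<lambda>z. f z * g z) (at z) b
      = f z * frechet_derivative g (at z) b + frechet_derivative f (at z) b * g z" for z b
  proof -
    have "((\<lambda>z. f z * g z) has_derivative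
        (\<lambda>b. f z * frechet_derivative g (at z) b + frechet_derivative f (at z) b * g z)) (at z)"
      using Suc.prems by (intro has_derivative_mult) (auto simp flip: frechet_derivative_works)
    from frechet_derivative_at[OF this] show ?thesis by (simp add: fun_eq_iff)
  qed
  then show ?case using Suc Ck_on_decSuc[OF Suc.prems(1)] Ck_on_decSuc[OF Suc.prems(2)]
    by (auto intro!: differentiable_mult Ck_on_add)
qed (auto intro: continuous_intros)

lemma Ck_on_const: "Ck_on k UNIV (\<lambda>z. c)"
  by (induction k arbitrary: c) auto

lemma smooth_const: "smooth_on UNIV (\<lambda>z. c)"
  by (simp add: smooth_on_def Ck_on_const)

lemma smooth_add: "smooth_on UNIV f \<Longrightarrow> smooth_on UNIV g \<Longrightarrow> smooth_on UNIV (\<lambda>z. f z + g z)"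
  by (simp add: smooth_on_def Ck_on_add)

lemma smooth_mult: "smooth_on UNIV f \<Longrightarrow> smooth_on UNIV g \<Longrightarrow> smooth_on UNIV (\<lambda>z. f z * g z)"
  by (simp add: smooth_on_def Ck_on_mult)

lemma smooth_sum: "(\<And>i. i \<in> I \<Longrightarrow> smooth_on UNIV (f i)) \<Longrightarrow> smooth_on UNIV (\<lambda>z. \<Sum>i\<in>I. f i z)"
  by (induction I rule: infinite_finite_induct) (auto intro: smooth_add smooth_const)

lemma smooth_prod: "(\<And>i. i \<in> I \<Longrightarrow> smooth_on UNIV (f i)) \<Longrightarrow> smooth_on UNIV (\<lambda>z. \<Prod>i\<in>I. f i z)"
  by (induction I rule: infinite_finite_induct) (auto intro: smooth_mult smooth_const)

text \<open>Eliminates the order \<open>k\<close>, so that smooth functions can be differentiated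
  any number of times without bookkeeping.\<close>

lemma smooth_iff:
  "smooth_on UNIV f \<longleftrightarrow> (\<forall>z. f differentiable (at z)) \<and> (\<forall>b\<in>Basis. smooth_on UNIV (vf_deriv (\<lambda>_. b) f))"
  (is "?L \<longleftrightarrow> ?R")
proof
  assume L: ?L
  have "Ck_on (Suc k) UNIV f" for k using L by (simp only: smooth_on_def)
  then show ?R by (auto simp: smooth_on_def vf_deriv_def)
next
  assume R: ?R
  have "Ck_on k UNIV f" for k
  proof (cases k)
    case 0
    have "Ck_on (Suc 0) UNIV f" using R unfolding Ck_on.simps(2) smooth_on_def vf_deriv_def by blast
    then show ?thesis using 0 Ck_on_continuous[of "Suc 0" f] by simp
  next
    case (Suc j) then show ?thesis using R by (auto simp: smooth_on_def vf_deriv_def)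
  qed
  then show ?L by (simp add: smooth_on_def)
qed

lemma smooth_differentiable: "smooth_on UNIV f \<Longrightarrow> f differentiable (at z)"
  by (simp add: smooth_iff[of f])

lemma smooth_has_derivative:
  "smooth_on UNIV f \<Longrightarrow> (f has_derivative (\<lambda>b. vf_deriv (\<lambda>_. b) f z)) (at z)"
  using smooth_differentiable[of f z] by (simp add: vf_deriv_def flip: frechet_derivative_works)

lemma smooth_continuous: "smooth_on UNIV f \<Longrightarrow> continuous_on UNIV f"
  unfolding smooth_on_def using Ck_on_continuous by blast

lemma vf_deriv_inner: "vf_deriv V (\<lambda>z. z \<bullet> c) = (\<lambda>z. V z \<bullet> c)"
proof
  fix z
  have "((\<lambda>z. z \<bullet> c) has_derivative (\<lambda>b. b \<bullet> c)) (at z)" by (auto intro!: derivative_eq_intros)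
  then show "vf_deriv V (\<lambda>z. z \<bullet> c) z = V z \<bullet> c" by (simp add: vf_deriv_at)
qed

lemma smooth_inner: "smooth_on UNIV (\<lambda>z. z \<bullet> c)"
  by (subst smooth_iff) (auto simp: vf_deriv_inner smooth_const intro!: derivative_intros)

lemma vf_deriv_expand:
  assumes "smooth_on UNIV f"
  shows "vf_deriv V f z = (\<Sum>b\<in>Basis. (V z \<bullet> b) * vf_deriv (\<lambda>_. b) f z)"
proof -
  have "linear (frechet_derivative f (at z))"
    by (intro linear_frechet_derivative smooth_differentiable assms)
  then have "frechet_derivative f (at z) (\<Sum>b\<in>Basis. (V z \<bullet> b) *\<^sub>R b)
      = (\<Sum>b\<in>Basis. (V z \<bullet> b) * frechet_derivative f (at z) b)"
    by (simp add: linear_sum linear_scale)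
  then show ?thesis by (simp add: vf_deriv_def euclidean_representation)
qed

lemma smooth_vf_deriv:
  assumes "smooth_on UNIV f" "\<And>b. b \<in> Basis \<Longrightarrow> smooth_on UNIV (\<lambda>z. V z \<bullet> b)"
  shows "smooth_on UNIV (vf_deriv V f)"
proof -
  have "smooth_on UNIV (\<lambda>z. \<Sum>b\<in>Basis. (V z \<bullet> b) * vf_deriv (\<lambda>_. b) f z)"
    using assms smooth_iff[of f] by (intro smooth_sum smooth_mult) auto
  then show ?thesis using vf_deriv_expand[OF assms(1), of V] by presburger
qed

lemma has_derivative_shift:
  "(f has_derivative f') (at (z + h)) \<Longrightarrow> ((\<lambda>x. f (x + h)) has_derivative f') (at z)"
  by (rule has_derivative_compose[of "\<lambda>x. x + h" "\<lambda>x. x"]) (auto intro!: derivative_eq_intros)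

lemma smooth_shift: "smooth_on UNIV f \<Longrightarrow> smooth_on UNIV (\<lambda>x. f (x + h))"
proof -
  have "Ck_on k UNIV f \<Longrightarrow> Ck_on k UNIV (\<lambda>x. f (x + h))" for k
  proof (induction k arbitrary: f)
    case 0
    then show ?case by (auto intro!: continuous_on_compose2[of UNIV f] continuous_intros)
  next
    case (Suc k)
    have d: "((\<lambda>x. f (x + h)) has_derivative frechet_derivative f (at (z + h))) (at z)" for z
      using Suc.prems by (intro has_derivative_shift) (auto simp flip: frechet_derivative_works)
    have "(\<lambda>x. f (x + h)) differentiable (at z)" for z using d differentiableI by blast
    then show ?case using Suc by (auto simp flip: frechet_derivative_at[OF d])
  qed
  then show "smooth_on UNIV f \<Longrightarrow> smooth_on UNIV (\<lambda>x. f (x + h))" by (simp add: smooth_on_def)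
qed

lemma vf_deriv_shift:
  assumes "smooth_on UNIV f"
  shows "vf_deriv (\<lambda>_. b) (\<lambda>x. f (x + h)) = (\<lambda>x. vf_deriv (\<lambda>_. b) f (x + h))"
proof
  fix z
  have "((\<lambda>x. f (x + h)) has_derivative (\<lambda>b. vf_deriv (\<lambda>_. b) f (z + h))) (at z)"
    by (intro has_derivative_shift smooth_has_derivative assms)
  then show "vf_deriv (\<lambda>_. b) (\<lambda>x. f (x + h)) z = vf_deriv (\<lambda>_. b) f (z + h)" by (simp add: vf_deriv_at)
qed

lemma vf_deriv_add:
  "smooth_on UNIV f \<Longrightarrow> smooth_on UNIV g \<Longrightarrow> vf_deriv V (\<lambda>z. f z + g z) = (\<lambda>z. vf_deriv V f z + vf_deriv V g z)"
  using vf_deriv_at[OF has_derivative_add[OF smooth_has_derivative smooth_has_derivative]]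
  by (auto simp: fun_eq_iff) (simp add: vf_deriv_def)

lemma vf_deriv_mult:
  "smooth_on UNIV f \<Longrightarrow> smooth_on UNIV g
    \<Longrightarrow> vf_deriv V (\<lambda>z. f z * g z) = (\<lambda>z. f z * vf_deriv V g z + vf_deriv V f z * g z)"
  using vf_deriv_at[OF has_derivative_mult[OF smooth_has_derivative smooth_has_derivative]]
  by (auto simp: fun_eq_iff) (simp add: vf_deriv_def)

lemma vf_deriv_const: "vf_deriv V (\<lambda>z. c) = (\<lambda>z. 0)"
  by (simp add: vf_deriv_def)

lemma vf_deriv_cmult: "smooth_on UNIV f \<Longrightarrow> vf_deriv V (\<lambda>z. c * f z) = (\<lambda>z. c * vf_deriv V f z)"
  by (simp add: vf_deriv_mult[OF smooth_const] vf_deriv_const)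

subsection \<open>Test functions\<close>

lemma test_functions_smooth: "\<phi> \<in> test_functions \<Omega> \<Longrightarrow> smooth_on UNIV \<phi>"
  by (simp add: test_functions_def)

lemma test_functions_mono: "\<phi> \<in> test_functions \<Omega> \<Longrightarrow> \<Omega> \<subseteq> \<Omega>' \<Longrightarrow> \<phi> \<in> test_functions \<Omega>'"
  by (auto simp: test_functions_def)

lemma test_functions_UNIV: "\<phi> \<in> test_functions \<Omega> \<Longrightarrow> \<phi> \<in> test_functions UNIV"
  by (rule test_functions_mono) auto

lemma test_functions_eq_0: "\<phi> \<in> test_functions \<Omega> \<Longrightarrow> z \<notin> \<Omega> \<Longrightarrow> \<phi> z = 0"
  by (auto simp: test_functions_def)

lemma test_functions_zero: "(\<lambda>z. 0) \<in> test_functions \<Omega>"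
  by (auto simp: test_functions_def smooth_const intro!: exI[of _ "{}"])

lemma test_functions_add:
  assumes "\<phi> \<in> test_functions \<Omega>" "\<psi> \<in> test_functions \<Omega>"
  shows "(\<lambda>z. \<phi> z + \<psi> z) \<in> test_functions \<Omega>"
proof -
  obtain K K' where "compact K" "K \<subseteq> \<Omega>" "\<forall>z. z \<notin> K \<longrightarrow> \<phi> z = 0" "compact K'" "K' \<subseteq> \<Omega>" "\<forall>z. z \<notin> K' \<longrightarrow> \<psi> z = 0"
    using assms by (auto simp: test_functions_def)
  then show ?thesis using assms
    by (auto simp: test_functions_def smooth_add intro!: exI[of _ "K \<union> K'"])
qed

lemma test_functions_smooth_mult:
  "smooth_on UNIV g \<Longrightarrow> \<phi> \<in> test_functions \<Omega> \<Longrightarrow> (\<lambda>z. g z * \<phi> z) \<in> test_functions \<Omega>"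
  by (auto simp: test_functions_def smooth_mult)

lemma test_functions_cmult: "\<phi> \<in> test_functions \<Omega> \<Longrightarrow> (\<lambda>z. c * \<phi> z) \<in> test_functions \<Omega>"
  by (rule test_functions_smooth_mult[OF smooth_const])

lemma test_functions_uminus: "\<phi> \<in> test_functions \<Omega> \<Longrightarrow> (\<lambda>z. - \<phi> z) \<in> test_functions \<Omega>"
  using test_functions_cmult[of \<phi> \<Omega> "-1"] by simp

lemma test_functions_diff:
  "\<phi> \<in> test_functions \<Omega> \<Longrightarrow> \<psi> \<in> test_functions \<Omega> \<Longrightarrow> (\<lambda>z. \<phi> z - \<psi> z) \<in> test_functions \<Omega>"
  using test_functions_add[of \<phi> \<Omega> "\<lambda>z. - \<psi> z"] test_functions_uminus[of \<psi>] by simp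

lemma test_functions_sum:
  "(\<And>i. i \<in> I \<Longrightarrow> f i \<in> test_functions \<Omega>) \<Longrightarrow> (\<lambda>z. \<Sum>i\<in>I. f i z) \<in> test_functions \<Omega>"
  by (induction I rule: infinite_finite_induct) (auto intro: test_functions_add test_functions_zero)

lemma test_functions_vf_deriv:
  assumes "\<phi> \<in> test_functions \<Omega>" "\<And>b. b \<in> Basis \<Longrightarrow> smooth_on UNIV (\<lambda>z. V z \<bullet> b)"
  shows "vf_deriv V \<phi> \<in> test_functions \<Omega>"
proof -
  obtain K where K: "compact K" "K \<subseteq> \<Omega>" "\<And>z. z \<notin> K \<Longrightarrow> \<phi> z = 0"
    using assms by (auto simp: test_functions_def)
  have "vf_deriv V \<phi> z = 0" if "z \<notin> K" for z
  proof -
    have "((\<lambda>_. 0) has_derivative (\<lambda>_. 0)) (at z)" by simp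
    then have "(\<phi> has_derivative (\<lambda>_. 0)) (at z)"
      by (rule has_derivative_transform_within_open[of _ _ _ _ "- K"])
        (use K that in \<open>auto simp: open_Compl compact_imp_closed\<close>)
    then show ?thesis by (simp add: vf_deriv_at)
  qed
  then show ?thesis using K smooth_vf_deriv[OF test_functions_smooth[OF assms(1)] assms(2)]
    by (auto simp: test_functions_def)
qed

lemma test_functions_dir_deriv:
  "\<phi> \<in> test_functions \<Omega> \<Longrightarrow> vf_deriv (\<lambda>_. b) \<phi> \<in> test_functions \<Omega>"
  by (rule test_functions_vf_deriv) (auto simp: smooth_const)

lemma test_functions_shift:
  assumes "\<phi> \<in> test_functions UNIV"
  shows "(\<lambda>z. \<phi> (z + h)) \<in> test_functions UNIV"
proof -
  obtain K where K: "compact K" "\<And>z. z \<notin> K \<Longrightarrow> \<phi> z = 0" "smooth_on UNIV \<phi>"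
    using assms by (auto simp: test_functions_def)
  have "compact ((\<lambda>x. - h + x) ` K)" by (intro compact_translation K)
  moreover have "\<phi> (z + h) = 0" if "z \<notin> (\<lambda>x. - h + x) ` K" for z
    using that by (intro K(2)) (auto simp: image_iff)
  ultimately show ?thesis using smooth_shift[OF K(3)] by (auto simp: test_functions_def)
qed

lemma test_functions_measurable: "\<phi> \<in> test_functions \<Omega> \<Longrightarrow> \<phi> \<in> borel_measurable borel"
  by (intro borel_measurable_continuous_onI smooth_continuous test_functions_smooth)

lemma test_functions_bounded:
  assumes "\<phi> \<in> test_functions \<Omega>"
  obtains B where "B \<ge> 0" "\<And>z. \<bar>\<phi> z\<bar> \<le> B"
proof -
  obtain K where K: "compact K" "\<And>z. z \<notin> K \<Longrightarrow> \<phi> z = 0"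
    using assms by (auto simp: test_functions_def)
  have "compact (\<phi> ` K)"
    using K(1) smooth_continuous[OF test_functions_smooth[OF assms]]
    by (intro compact_continuous_image) (auto intro: continuous_on_subset)
  then have "bounded (\<phi> ` K)" by (rule compact_imp_bounded)
  then obtain B where "\<forall>x\<in>\<phi> ` K. norm x \<le> B" by (auto simp only: bounded_iff)
  then have B: "\<And>z. z \<in> K \<Longrightarrow> \<bar>\<phi> z\<bar> \<le> B" by simp
  then have "\<bar>\<phi> z\<bar> \<le> max B 0" for z by (cases "z \<in> K") (auto simp: K B le_max_iff_disj)
  then show ?thesis using that[of "max B 0"] by simp
qed

lemma test_functions_integrable:
  assumes "\<phi> \<in> test_functions \<Omega>"
  shows "integrable lebesgue \<phi>"
proof -
  obtain K where K: "compact K" "\<And>z. z \<notin> K \<Longrightarrow> \<phi> z = 0"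
    using assms by (auto simp: test_functions_def)
  have "integrable lborel (\<lambda>z. indicator K z *\<^sub>R \<phi> z)"
    using smooth_continuous[OF test_functions_smooth[OF assms]]
    by (intro borel_integrable_compact K) (auto intro: continuous_on_subset)
  moreover have "(\<lambda>z. indicator K z *\<^sub>R \<phi> z) = \<phi>" using K(2) by (auto simp: fun_eq_iff indicator_def)
  ultimately show ?thesis
    using test_functions_measurable[OF assms] by (simp add: integrable_completion)
qed

lemma sqint_test_functions: 
  assumes "\<phi> \<in> test_functions \<Omega>"
  shows "sqint \<phi>"
  using test_functions_integrable[OF assms]
    test_functions_integrable[OF test_functions_smooth_mult[OF test_functions_smooth[OF assms] assms]]
  by (auto simp: sqint_def power2_eq_square)

lemma continuous_AE_eq_0:
  fixes f :: "'a::euclidean_space \<Rightarrow> real"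
  assumes "continuous_on UNIV f" "AE x in lebesgue. f x = 0"
  shows "f = (\<lambda>x. 0)"
proof (rule ccontr)
  assume "f \<noteq> (\<lambda>x. 0)"
  then obtain z where "f z \<noteq> 0" by auto
  have "open {x. f x \<noteq> 0}" 
    by (rule open_Collect_neq) (use assms in auto)
  moreover have "negligible {x. f x \<noteq> 0}"
    using assms(2) by (auto simp: eventually_ae_filter negligible_iff_null_sets intro: null_sets_completion_subset)
  ultimately show False using \<open>f z \<noteq> 0\<close> open_not_negligible by blast
qed

text \<open>Allows pointwise identities between test functions to be proved by inner products in the
  Hilbert space.\<close>

lemma test_functions_eqI:
  assumes "\<phi> \<in> test_functions \<Omega>" "\<psi> \<in> test_functions \<Omega>'" "cls \<phi> = cls \<psi>"
  shows "\<phi> = \<psi>"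
proof -
  have "AE x in lebesgue. \<phi> x - \<psi> x = 0"
    using assms by (subst (asm) cls_eq_iff) (auto intro: sqint_test_functions elim: AE_mp)
  then have "(\<lambda>x. \<phi> x - \<psi> x) = (\<lambda>x. 0)"
    using assms by (intro continuous_AE_eq_0 continuous_intros smooth_continuous test_functions_smooth)
  then show ?thesis by (auto simp: fun_eq_iff)
qed

section \<open>Translates of test functions and their derivatives in the mean\<close>

lemma mvt_from_0:
  fixes f :: "real \<Rightarrow> real"
  assumes "\<And>s. (f has_real_derivative f' s) (at s)"
  obtains t where "\<bar>t\<bar> \<le> \<bar>s\<bar>" "f s - f 0 = s * f' t"
proof -
  consider "s > 0" | "s < 0" | "s = 0" by linarith
  then have "\<exists>t. \<bar>t\<bar> \<le> \<bar>s\<bar> \<and> f s - f 0 = s * f' t"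
  proof cases
    case 1
    with MVT2[of 0 s f f'] assms obtain t where "0 < t" "t < s" "f s - f 0 = (s - 0) * f' t" by blast
    then show ?thesis by (intro exI[of _ t]) auto
  next
    case 2
    with MVT2[of s 0 f f'] assms obtain t where "s < t" "t < 0" "f 0 - f s = (0 - s) * f' t" by blast
    then show ?thesis by (intro exI[of _ t]) auto
  next
    case 3 then show ?thesis by (intro exI[of _ 0]) auto
  qed
  then show ?thesis using that by blast
qed

text \<open>The mean value theorem is used twice, for the function and for its derivative. This
  gives \<open>B\<close> instead of \<open>B / 2\<close>; only the order in \<open>e\<close> matters
  later.\<close>

lemma taylor_along_line:
  fixes \<phi> :: "'a::euclidean_space \<Rightarrow> real"
  assumes "smooth_on UNIV \<phi>" and B: "\<And>z. \<bar>vf_deriv (\<lambda>_. b) (vf_deriv (\<lambda>_. b) \<phi>) z\<bar> \<le> B"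
  shows "\<bar>\<phi> (z + e *\<^sub>R b) - \<phi> z - e * vf_deriv (\<lambda>_. b) \<phi> z\<bar> \<le> B * e\<^sup>2"
proof -
  have line: "((\<lambda>s. f (z + s *\<^sub>R b)) has_real_derivative vf_deriv (\<lambda>_. b) f (z + s *\<^sub>R b)) (at s)"
    if "smooth_on UNIV f" for f s
  proof -
    have 1: "((\<lambda>s. z + s *\<^sub>R b) has_derivative (\<lambda>s. s *\<^sub>R b)) (at s)"
      by (auto intro!: derivative_eq_intros)
    from has_derivative_compose[OF 1 smooth_has_derivative[OF that]]
    have "((\<lambda>s. f (z + s *\<^sub>R b)) has_derivative (\<lambda>t. vf_deriv (\<lambda>_. t *\<^sub>R b) f (z + s *\<^sub>R b))) (at s)" .
    moreover have "vf_deriv (\<lambda>_. t *\<^sub>R b) f w = t * vf_deriv (\<lambda>_. b) f w" for t w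
      using linear_scale[OF linear_frechet_derivative[OF smooth_differentiable[OF that]]]
      by (simp add: vf_deriv_def)
    ultimately show ?thesis by (simp add: has_field_derivative_def mult.commute[of _ "vf_deriv _ _ _"])
  qed
  have sm: "smooth_on UNIV (vf_deriv (\<lambda>_. b) \<phi>)" by (rule smooth_vf_deriv) (auto simp: assms smooth_const)
  have "B \<ge> 0" using B[of undefined] by linarith
  have *: "\<bar>vf_deriv (\<lambda>_. b) \<phi> (z + s *\<^sub>R b) - vf_deriv (\<lambda>_. b) \<phi> z\<bar> \<le> B * \<bar>s\<bar>" for s
  proof -
    obtain t where "vf_deriv (\<lambda>_. b) \<phi> (z + s *\<^sub>R b) - vf_deriv (\<lambda>_. b) \<phi> (z + 0 *\<^sub>R b)
        = s * vf_deriv (\<lambda>_. b) (vf_deriv (\<lambda>_. b) \<phi>) (z + t *\<^sub>R b)"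
      using mvt_from_0[OF line[OF sm]] by metis
    then show ?thesis using B by (auto simp: abs_mult mult.commute[of B] intro!: mult_left_mono)
  qed
  obtain t where "\<bar>t\<bar> \<le> \<bar>e\<bar>"
      "\<phi> (z + e *\<^sub>R b) - \<phi> (z + 0 *\<^sub>R b) = e * vf_deriv (\<lambda>_. b) \<phi> (z + t *\<^sub>R b)"
    using mvt_from_0[OF line[OF assms(1)]] by metis
  then have t: "\<bar>t\<bar> \<le> \<bar>e\<bar>" "\<phi> (z + e *\<^sub>R b) - \<phi> z = e * vf_deriv (\<lambda>_. b) \<phi> (z + t *\<^sub>R b)"
    by auto
  have "\<phi> (z + e *\<^sub>R b) - \<phi> z - e * vf_deriv (\<lambda>_. b) \<phi> z
      = e * (vf_deriv (\<lambda>_. b) \<phi> (z + t *\<^sub>R b) - vf_deriv (\<lambda>_. b) \<phi> z)"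
    using t by (simp add: algebra_simps)
  also have "\<bar>\<dots>\<bar> \<le> \<bar>e\<bar> * (B * \<bar>e\<bar>)"
    unfolding abs_mult using *[of t] t(1) \<open>B \<ge> 0\<close>
    by (intro mult_left_mono order_trans[OF *]) auto
  finally show ?thesis by (simp add: power2_eq_square mult_ac)
qed

lemma norm_cls_le_bounded_support:
  assumes "sqint g" "compact K" "\<And>z. z \<notin> K \<Longrightarrow> g z = 0" "\<And>z. \<bar>g z\<bar> \<le> B"
  shows "norm (cls g) \<le> B * sqrt (measure lebesgue K)"
proof -
  have "B \<ge> 0" using assms(4)[of undefined] by linarith
  have K: "K \<in> lmeasurable" by (simp add: assms lmeasurable_compact)
  have "(norm (cls g))\<^sup>2 = (\<integral>z. (g z)\<^sup>2 \<partial>lebesgue)" by (rule norm_cls[OF assms(1)])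
  also have "\<dots> \<le> (\<integral>z. B\<^sup>2 * indicator K z \<partial>lebesgue)"
  proof (rule integral_mono)
    show "integrable lebesgue (\<lambda>z. (g z)\<^sup>2)" using assms(1) by (simp add: sqint_def)
    show "integrable lebesgue (\<lambda>z. B\<^sup>2 * indicator K z)" using K by (auto simp: fmeasurable_def)
    show "(g z)\<^sup>2 \<le> B\<^sup>2 * indicator K z" for z
    proof (cases "z \<in> K")
      case True
      have "\<bar>g z\<bar>\<^sup>2 \<le> B\<^sup>2" using assms(4) by (intro power_mono) auto
      then show ?thesis using True by simp
    qed (simp add: assms)
  qed
  also have "\<dots> = B\<^sup>2 * measure lebesgue K" by simp
  also have "\<dots> = (B * sqrt (measure lebesgue K))\<^sup>2" by (simp add: power_mult_distrib)
  finally show ?thesis by (rule power2_le_imp_le) (simp add: \<open>B \<ge> 0\<close>)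
qed

text \<open>The pointwise remainder is of order \<open>e^2\<close>, and for steps of length at most
  1 it vanishes off one compact set, the support swept along \<open>b\<close>. Hence the same order
  holds in the mean.\<close>

lemma shift_taylor:
  assumes \<phi>: "\<phi> \<in> test_functions UNIV"
  obtains C where "\<And>e. \<bar>e\<bar> \<le> 1 \<Longrightarrow>
    norm (shift (e *\<^sub>R b) (cls \<phi>) - cls \<phi> - e *\<^sub>R cls (vf_deriv (\<lambda>_. b) \<phi>)) \<le> C * e\<^sup>2"
proof -
  obtain K where K: "compact K" "\<And>z. z \<notin> K \<Longrightarrow> \<phi> z = 0"
    using \<phi> by (auto simp: test_functions_def)
  have d: "vf_deriv (\<lambda>_. b) \<phi> \<in> test_functions UNIV" by (rule test_functions_dir_deriv[OF \<phi>])
  have d0: "vf_deriv (\<lambda>_. b) \<phi> z = 0" if "z \<notin> K" for z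
  proof -
    have "\<phi> \<in> test_functions K" using \<phi> K by (auto simp: test_functions_def)
    from test_functions_eq_0[OF test_functions_dir_deriv[OF this] that] show ?thesis .
  qed
  obtain B where B: "B \<ge> 0" "\<And>z. \<bar>vf_deriv (\<lambda>_. b) (vf_deriv (\<lambda>_. b) \<phi>) z\<bar> \<le> B"
    using test_functions_bounded[OF test_functions_dir_deriv[OF d]] by metis
  define K' where "K' = {x + y | x y. x \<in> K \<and> y \<in> (\<lambda>s. s *\<^sub>R b) ` {-1..1::real}}"
  have K': "compact K'" unfolding K'_def
    by (intro compact_sums K(1) compact_continuous_image continuous_intros compact_Icc)
  have "norm (shift (e *\<^sub>R b) (cls \<phi>) - cls \<phi> - e *\<^sub>R cls (vf_deriv (\<lambda>_. b) \<phi>))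
      \<le> (B * e\<^sup>2) * sqrt (measure lebesgue K')" if e: "\<bar>e\<bar> \<le> 1" for e
  proof -
    let ?g = "\<lambda>z. \<phi> (z + e *\<^sub>R b) - \<phi> z - e * vf_deriv (\<lambda>_. b) \<phi> z"
    have sq: "sqint ?g"
      by (intro sqint_diff sqint_cmult sqint_shift sqint_test_functions[OF \<phi>] sqint_test_functions[OF d])
    have "cls ?g = shift (e *\<^sub>R b) (cls \<phi>) - cls \<phi> - e *\<^sub>R cls (vf_deriv (\<lambda>_. b) \<phi>)"
      using sqint_test_functions[OF \<phi>] sqint_test_functions[OF d]
      by (simp add: cls_diff cls_cmult cls_shift sqint_diff sqint_cmult sqint_shift)
    moreover have "norm (cls ?g) \<le> (B * e\<^sup>2) * sqrt (measure lebesgue K')"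
    proof (rule norm_cls_le_bounded_support[OF sq K'])
      show "\<bar>?g z\<bar> \<le> B * e\<^sup>2" for z
        by (rule taylor_along_line[OF test_functions_smooth[OF \<phi>] B(2)])
      show "?g z = 0" if "z \<notin> K'" for z
      proof -
        have "z \<notin> K" using that unfolding K'_def by (force intro: image_eqI[of _ _ 0])
        moreover have "z + e *\<^sub>R b \<notin> K"
        proof
          assume *: "z + e *\<^sub>R b \<in> K"
          have "z = (z + e *\<^sub>R b) + (- e) *\<^sub>R b" by simp
          moreover have "- e \<in> {-1..1}" using e by auto
          ultimately show False using that * unfolding K'_def by blast
        qed
        ultimately show ?thesis using K(2) d0 by simp
      qed
    qed
    ultimately show ?thesis by simp
  qed
  then show ?thesis using that[of "B * sqrt (measure lebesgue K')"] by (simp add: mult_ac)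
qed

lemma shift_has_vector_derivative_0:
  assumes \<phi>: "\<phi> \<in> test_functions UNIV"
  shows "((\<lambda>r. shift (r *\<^sub>R b) (cls \<phi>)) has_vector_derivative cls (vf_deriv (\<lambda>_. b) \<phi>)) (at 0)"
proof -
  obtain C where C: "\<And>e. \<bar>e\<bar> \<le> 1 \<Longrightarrow>
    norm (shift (e *\<^sub>R b) (cls \<phi>) - cls \<phi> - e *\<^sub>R cls (vf_deriv (\<lambda>_. b) \<phi>)) \<le> C * e\<^sup>2"
    using shift_taylor[OF \<phi>] by metis
  show ?thesis unfolding has_vector_derivative_def
  proof (rule has_derivativeI_sandwich[where e=1 and H="\<lambda>y. C * \<bar>y\<bar>"])
    show "bounded_linear (\<lambda>x. x *\<^sub>R cls (vf_deriv (\<lambda>_. b) \<phi>))" by (rule bounded_linear_scaleR_left)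
    show "((\<lambda>y. C * \<bar>y\<bar>) \<longlongrightarrow> 0) (at 0)" by (auto intro!: tendsto_eq_intros)
    fix y :: real assume "y \<noteq> 0" "dist y 0 < 1"
    then show "norm (shift (y *\<^sub>R b) (cls \<phi>) - shift (0 *\<^sub>R b) (cls \<phi>) - (y - 0) *\<^sub>R cls (vf_deriv (\<lambda>_. b) \<phi>))
        / norm (y - 0) \<le> C * \<bar>y\<bar>"
      using C[of y] by (simp add: shift_zero divide_le_eq power2_eq_square mult.assoc)
  qed simp
qed

lemma shift_has_vector_derivative:
  assumes \<phi>: "\<phi> \<in> test_functions UNIV"
  shows "((\<lambda>r. shift (r *\<^sub>R b) (cls \<phi>)) has_vector_derivative
    shift (s *\<^sub>R b) (cls (vf_deriv (\<lambda>_. b) \<phi>))) (at s)"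
proof -
  let ?\<phi> = "\<lambda>x. \<phi> (x + s *\<^sub>R b)"
  have "((\<lambda>r. shift (r *\<^sub>R b) (cls ?\<phi>)) has_vector_derivative cls (vf_deriv (\<lambda>_. b) ?\<phi>)) (at (s - s))"
    using shift_has_vector_derivative_0[OF test_functions_shift[OF \<phi>]] by simp
  moreover have "((\<lambda>r. r - s) has_vector_derivative 1) (at s)"
    by (auto intro!: derivative_eq_intros)
  ultimately have "(((\<lambda>r. shift (r *\<^sub>R b) (cls ?\<phi>)) \<circ> (\<lambda>r. r - s)) has_vector_derivative
      1 *\<^sub>R cls (vf_deriv (\<lambda>_. b) ?\<phi>)) (at s)"
    by (intro vector_diff_chain_at) auto
  moreover have "shift ((r - s) *\<^sub>R b) (shift (s *\<^sub>R b) f) = shift (r *\<^sub>R b) f" for r f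
    by (simp add: scaleR_diff_left flip: shift_add)
  moreover have "cls ?\<phi> = shift (s *\<^sub>R b) (cls \<phi>)" by (rule cls_shift[OF sqint_test_functions[OF \<phi>]])
  moreover have "cls (vf_deriv (\<lambda>_. b) ?\<phi>) = shift (s *\<^sub>R b) (cls (vf_deriv (\<lambda>_. b) \<phi>))"
    unfolding vf_deriv_shift[OF test_functions_smooth[OF \<phi>]]
    by (rule cls_shift[OF sqint_test_functions[OF test_functions_dir_deriv[OF \<phi>]]])
  ultimately show ?thesis by (simp add: o_def)
qed

text \<open>Integration by parts: simultaneous translation of both factors leaves the inner product
  constant, and a constant has derivative 0.\<close>

lemma dir_deriv_skew:
  assumes \<phi>: "\<phi> \<in> test_functions UNIV" and \<psi>: "\<psi> \<in> test_functions UNIV"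
  shows "cls (vf_deriv (\<lambda>_. b) \<phi>) \<bullet> cls \<psi> = - (cls \<phi> \<bullet> cls (vf_deriv (\<lambda>_. b) \<psi>))"
proof -
  have "((\<lambda>r. shift (r *\<^sub>R b) (cls \<phi>) \<bullet> shift (r *\<^sub>R b) (cls \<psi>)) has_vector_derivative
     (shift (0 *\<^sub>R b) (cls \<phi>) \<bullet> cls (vf_deriv (\<lambda>_. b) \<psi>) + cls (vf_deriv (\<lambda>_. b) \<phi>) \<bullet> shift (0 *\<^sub>R b) (cls \<psi>))) (at 0)"
    by (rule bounded_bilinear.has_vector_derivative[OF bounded_bilinear_inner
          shift_has_vector_derivative_0[OF \<phi>] shift_has_vector_derivative_0[OF \<psi>]])
  moreover have "((\<lambda>r. shift (r *\<^sub>R b) (cls \<phi>) \<bullet> shift (r *\<^sub>R b) (cls \<psi>)) has_vector_derivative 0) (at 0)"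
    by (simp add: inner_shift)
  ultimately show ?thesis
    using vector_derivative_unique_at by (fastforce simp: shift_zero)
qed

text \<open>Symmetry of second derivatives by duality: a translation along \<open>a\<close> commutes
  with the derivative along \<open>b\<close>, skewness moves the latter to \<open>\<psi>\<close>,
  and differentiation in the translation parameter gives an expression that can be read in either
  order.\<close>

lemma dir_deriv_commute:
  assumes \<phi>: "\<phi> \<in> test_functions UNIV"
  shows "vf_deriv (\<lambda>_. a) (vf_deriv (\<lambda>_. b) \<phi>) = vf_deriv (\<lambda>_. b) (vf_deriv (\<lambda>_. a) \<phi>)"
proof -
  note d = test_functions_dir_deriv
  have eq: "cls (vf_deriv (\<lambda>_. a) (vf_deriv (\<lambda>_. b) \<phi>)) \<bullet> cls \<psi> = cls (vf_deriv (\<lambda>_. b) (vf_deriv (\<lambda>_. a) \<phi>)) \<bullet> cls \<psi>"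
    if \<psi>: "\<psi> \<in> test_functions UNIV" for \<psi>
  proof -
    have "((\<lambda>r. shift (r *\<^sub>R a) (cls (vf_deriv (\<lambda>_. b) \<phi>)) \<bullet> cls \<psi>) has_vector_derivative
       cls (vf_deriv (\<lambda>_. a) (vf_deriv (\<lambda>_. b) \<phi>)) \<bullet> cls \<psi>) (at 0)"
      by (rule bounded_linear.has_vector_derivative[OF bounded_linear_inner_left
            shift_has_vector_derivative_0[OF d[OF \<phi>]]])
    moreover have "shift (r *\<^sub>R a) (cls (vf_deriv (\<lambda>_. b) \<phi>)) \<bullet> cls \<psi>
        = - (shift (r *\<^sub>R a) (cls \<phi>) \<bullet> cls (vf_deriv (\<lambda>_. b) \<psi>))" for r
    proof -
      have "shift (r *\<^sub>R a) (cls (vf_deriv (\<lambda>_. b) \<phi>)) = cls (vf_deriv (\<lambda>_. b) (\<lambda>x. \<phi> (x + r *\<^sub>R a)))"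
        by (simp add: vf_deriv_shift test_functions_smooth[OF \<phi>] cls_shift sqint_test_functions[OF d[OF \<phi>]])
      also have "\<dots> \<bullet> cls \<psi> = - (cls (\<lambda>x. \<phi> (x + r *\<^sub>R a)) \<bullet> cls (vf_deriv (\<lambda>_. b) \<psi>))"
        by (rule dir_deriv_skew[OF test_functions_shift[OF \<phi>] \<psi>])
      finally show ?thesis by (simp add: cls_shift sqint_test_functions[OF \<phi>])
    qed
    moreover have "((\<lambda>r. - (shift (r *\<^sub>R a) (cls \<phi>) \<bullet> cls (vf_deriv (\<lambda>_. b) \<psi>))) has_vector_derivative
       - (cls (vf_deriv (\<lambda>_. a) \<phi>) \<bullet> cls (vf_deriv (\<lambda>_. b) \<psi>))) (at 0)"
      by (intro has_vector_derivative_minus bounded_linear.has_vector_derivative[OF bounded_linear_inner_left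
            shift_has_vector_derivative_0[OF \<phi>]])
    ultimately have "cls (vf_deriv (\<lambda>_. a) (vf_deriv (\<lambda>_. b) \<phi>)) \<bullet> cls \<psi>
        = - (cls (vf_deriv (\<lambda>_. a) \<phi>) \<bullet> cls (vf_deriv (\<lambda>_. b) \<psi>))"
      by (simp add: vector_derivative_unique_at)
    also have "\<dots> = cls (vf_deriv (\<lambda>_. b) (vf_deriv (\<lambda>_. a) \<phi>)) \<bullet> cls \<psi>"
      by (simp add: dir_deriv_skew[OF d[OF \<phi>] \<psi>])
    finally show ?thesis .
  qed
  let ?f = "vf_deriv (\<lambda>_. a) (vf_deriv (\<lambda>_. b) \<phi>)" and ?g = "vf_deriv (\<lambda>_. b) (vf_deriv (\<lambda>_. a) \<phi>)"
  have f: "?f \<in> test_functions UNIV" and g: "?g \<in> test_functions UNIV" by (intro d \<phi>)+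
  have "(cls ?f - cls ?g) \<bullet> cls (\<lambda>z. ?f z - ?g z) = 0"
    unfolding inner_diff_left eq[OF test_functions_diff[OF f g]] by simp
  then have "cls ?f = cls ?g"
    by (simp add: cls_diff sqint_test_functions[OF f] sqint_test_functions[OF g])
  then show ?thesis by (rule test_functions_eqI[OF f g])
qed

lemma inner_cls_mult_commute:
  assumes "sqint f" "sqint g" "sqint (\<lambda>z. h z * f z)" "sqint (\<lambda>z. h z * g z)"
  shows "cls (\<lambda>z. h z * f z) \<bullet> cls g = cls f \<bullet> cls (\<lambda>z. h z * g z)"
  unfolding inner_cls[OF assms(3,2)] inner_cls[OF assms(1,4)] by (simp add: mult_ac)

subsection \<open>Subelliptic estimates\<close>

text \<open>The fields \<open>E i + (z \<bullet> C i) \<tau>\<close> bracket-generate the central direction \<open>\<tau>\<close>: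
  \<open>[D i, D j] = (E i \<bullet> C j - E j \<bullet> C i) T\<close>.\<close>

locale step_two_frame =
  fixes \<tau> :: "'a::euclidean_space" and I :: "'i set" and E C :: "'i \<Rightarrow> 'a"
  assumes finite_I: "finite I"
    and C_orth: "i \<in> I \<Longrightarrow> C i \<bullet> \<tau> = 0"
    and bracket_le: "i \<in> I \<Longrightarrow> j \<in> I \<Longrightarrow> \<bar>E i \<bullet> C j - E j \<bullet> C i\<bar> \<le> 1"
    and bracket_ex: "\<exists>i\<in>I. \<exists>j\<in>I. \<bar>E i \<bullet> C j - E j \<bullet> C i\<bar> = 1"
begin

definition D :: "'i \<Rightarrow> ('a \<Rightarrow> real) \<Rightarrow> 'a \<Rightarrow> real" where
  "D i = vf_deriv (\<lambda>z. E i + (z \<bullet> C i) *\<^sub>R \<tau>)"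

definition T :: "('a \<Rightarrow> real) \<Rightarrow> 'a \<Rightarrow> real" where
  "T = vf_deriv (\<lambda>_. \<tau>)"

definition lap :: "('a \<Rightarrow> real) \<Rightarrow> 'a \<Rightarrow> real" where
  "lap f = (\<lambda>z. \<Sum>i\<in>I. D i (D i f) z)"

definition \<kappa> :: "'i \<Rightarrow> 'i \<Rightarrow> real" where
  "\<kappa> i j = E i \<bullet> C j - E j \<bullet> C i"

definition energy :: "('a \<Rightarrow> real) \<Rightarrow> real" where
  "energy \<phi> = (\<Sum>i\<in>I. (norm (cls (D i \<phi>)))\<^sup>2)"

lemma smooth_field: "smooth_on UNIV (\<lambda>z. (E i + (z \<bullet> C i) *\<^sub>R \<tau>) \<bullet> b)"
  by (auto simp: inner_simps intro!: smooth_add smooth_mult smooth_inner smooth_const)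

lemma D_smooth: "smooth_on UNIV f \<Longrightarrow> smooth_on UNIV (D i f)"
  unfolding D_def by (intro smooth_vf_deriv smooth_field)

lemma D_test: "\<phi> \<in> test_functions \<Omega> \<Longrightarrow> D i \<phi> \<in> test_functions \<Omega>"
  unfolding D_def by (intro test_functions_vf_deriv smooth_field)

lemma T_test: "\<phi> \<in> test_functions \<Omega> \<Longrightarrow> T \<phi> \<in> test_functions \<Omega>"
  unfolding T_def by (rule test_functions_dir_deriv)

lemma lap_test: "\<phi> \<in> test_functions \<Omega> \<Longrightarrow> lap \<phi> \<in> test_functions \<Omega>"
  unfolding lap_def by (intro test_functions_sum D_test)

lemmas test_sqint = sqint_test_functions sqint_test_functions[OF D_test]
  sqint_test_functions[OF T_test] sqint_test_functions[OF lap_test]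

lemma D_expand:
  assumes "smooth_on UNIV f"
  shows "D i f = (\<lambda>z. vf_deriv (\<lambda>_. E i) f z + (z \<bullet> C i) * T f z)"
proof
  fix z
  have "linear (frechet_derivative f (at z))"
    by (intro linear_frechet_derivative smooth_differentiable assms)
  then show "D i f z = vf_deriv (\<lambda>_. E i) f z + (z \<bullet> C i) * T f z"
    by (simp add: D_def T_def vf_deriv_def linear_add linear_scale)
qed

lemma D_add: "smooth_on UNIV f \<Longrightarrow> smooth_on UNIV g \<Longrightarrow> D i (\<lambda>z. f z + g z) = (\<lambda>z. D i f z + D i g z)"
  unfolding D_def by (rule vf_deriv_add)

lemma D_mult: "smooth_on UNIV f \<Longrightarrow> smooth_on UNIV g
    \<Longrightarrow> D i (\<lambda>z. f z * g z) = (\<lambda>z. f z * D i g z + D i f z * g z)"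
  unfolding D_def by (rule vf_deriv_mult)

lemma D_diff:
  assumes "smooth_on UNIV f" "smooth_on UNIV g"
  shows "D i (\<lambda>z. f z - g z) = (\<lambda>z. D i f z - D i g z)"
  using D_add[OF assms(1) smooth_mult[OF smooth_const assms(2), of "-1"]]
    vf_deriv_cmult[OF assms(2), of _ "-1"] by (simp add: D_def)

lemma lap_diff:
  assumes "smooth_on UNIV f" "smooth_on UNIV g"
  shows "lap (\<lambda>z. f z - g z) = (\<lambda>z. lap f z - lap g z)"
  by (simp add: lap_def D_diff D_smooth assms sum_subtractf)

text \<open>The field is divergence free: \<open>C i\<close> is orthogonal to \<open>\<tau>\<close>,
  so the coefficient \<open>z \<bullet> C i\<close> is constant along \<open>\<tau>\<close> and
  passes through \<open>T\<close>.\<close>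

lemma D_skew:
  assumes i: "i \<in> I" and \<phi>: "\<phi> \<in> test_functions UNIV" and \<psi>: "\<psi> \<in> test_functions UNIV"
  shows "cls (D i \<phi>) \<bullet> cls \<psi> = - (cls \<phi> \<bullet> cls (D i \<psi>))"
proof -
  let ?m = "\<lambda>f z. (z \<bullet> C i) * f z"
  note m = test_functions_smooth_mult[OF smooth_inner[of "C i"]] and d = test_functions_dir_deriv
  note sq = sqint_test_functions[where \<Omega>=UNIV]
  have "cls (D i \<phi>) \<bullet> cls \<psi> = cls (vf_deriv (\<lambda>_. E i) \<phi>) \<bullet> cls \<psi> + cls (?m (T \<phi>)) \<bullet> cls \<psi>"
    unfolding D_expand[OF test_functions_smooth[OF \<phi>]]
    by (subst cls_add) (auto simp: inner_add_left intro!: sq d \<phi> m T_test)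
  also have "cls (?m (T \<phi>)) \<bullet> cls \<psi> = cls (T \<phi>) \<bullet> cls (?m \<psi>)"
    by (rule inner_cls_mult_commute; intro sq m T_test \<phi> \<psi>)
  also have "\<dots> = - (cls \<phi> \<bullet> cls (T (?m \<psi>)))"
    unfolding T_def by (rule dir_deriv_skew[OF \<phi> m[OF \<psi>]])
  also have "T (?m \<psi>) = ?m (T \<psi>)"
    unfolding T_def using C_orth[OF i]
    by (subst vf_deriv_mult[OF smooth_inner test_functions_smooth[OF \<psi>]])
      (simp add: vf_deriv_inner inner_commute)
  also have "cls (vf_deriv (\<lambda>_. E i) \<phi>) \<bullet> cls \<psi> = - (cls \<phi> \<bullet> cls (vf_deriv (\<lambda>_. E i) \<psi>))"
    by (rule dir_deriv_skew[OF \<phi> \<psi>])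
  finally show ?thesis
    unfolding D_expand[OF test_functions_smooth[OF \<psi>]]
    by (subst cls_add) (auto simp: inner_add_right intro!: sq d \<psi> m T_test)
qed

lemma T_D_commute:
  assumes i: "i \<in> I" and \<phi>: "\<phi> \<in> test_functions UNIV"
  shows "T (D i \<phi>) = D i (T \<phi>)"
proof -
  note s = test_functions_smooth and d = test_functions_dir_deriv
  have "T (D i \<phi>) = (\<lambda>z. T (vf_deriv (\<lambda>_. E i) \<phi>) z + (z \<bullet> C i) * T (T \<phi>) z)"
    unfolding D_expand[OF s[OF \<phi>]] T_def using C_orth[OF i]
    by (subst vf_deriv_add) 
      (auto intro!: smooth_mult smooth_inner s[OF \<phi>] s[OF d[OF \<phi>]] s[OF d[OF d[OF \<phi>]]]
        simp: vf_deriv_mult[OF smooth_inner s[OF d[OF \<phi>]]] vf_deriv_inner inner_commute)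
  also have "T (vf_deriv (\<lambda>_. E i) \<phi>) = vf_deriv (\<lambda>_. E i) (T \<phi>)"
    unfolding T_def by (rule dir_deriv_commute[OF \<phi>])
  finally show ?thesis by (simp add: D_expand[OF s[OF T_test[OF \<phi>]]])
qed

text \<open>In the expansion of \<open>D i (D j \<phi>)\<close> only the term where one field
  differentiates the coefficient of the other fails to be symmetric in \<open>i\<close> and
  \<open>j\<close>.\<close>

lemma D_commutator:
  assumes i: "i \<in> I" and j: "j \<in> I" and \<phi>: "\<phi> \<in> test_functions UNIV"
  shows "D i (D j \<phi>) = (\<lambda>z. D j (D i \<phi>) z + \<kappa> i j * T \<phi> z)"
proof -
  note s = test_functions_smooth and d = test_functions_dir_deriv
  have DD: "D i (D j \<phi>) = (\<lambda>z. vf_deriv (\<lambda>_. E i) (vf_deriv (\<lambda>_. E j) \<phi>) z + (E i \<bullet> C j) * T \<phi> z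
      + (z \<bullet> C j) * vf_deriv (\<lambda>_. E i) (T \<phi>) z + (z \<bullet> C i) * vf_deriv (\<lambda>_. E j) (T \<phi>) z
      + (z \<bullet> C i) * (z \<bullet> C j) * T (T \<phi>) z)" if "i \<in> I" "j \<in> I" for i j
  proof -
    have "vf_deriv (\<lambda>_. E i) (D j \<phi>) = (\<lambda>z. vf_deriv (\<lambda>_. E i) (vf_deriv (\<lambda>_. E j) \<phi>) z
        + ((z \<bullet> C j) * vf_deriv (\<lambda>_. E i) (T \<phi>) z + (E i \<bullet> C j) * T \<phi> z))"
      unfolding D_expand[OF s[OF \<phi>]]
      by (subst vf_deriv_add)
        (auto intro!: smooth_mult smooth_inner s[OF d[OF \<phi>]] s[OF T_test[OF \<phi>]]
          simp: vf_deriv_mult[OF smooth_inner s[OF T_test[OF \<phi>]]] vf_deriv_inner)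
    moreover have "T (D j \<phi>) = (\<lambda>z. vf_deriv (\<lambda>_. E j) (T \<phi>) z + (z \<bullet> C j) * T (T \<phi>) z)"
      using T_D_commute[OF that(2) \<phi>] D_expand[OF s[OF T_test[OF \<phi>]]] by simp
    ultimately show ?thesis
      unfolding D_expand[OF s[OF D_test[OF \<phi>]]] by (simp add: algebra_simps)
  qed
  show ?thesis
    unfolding DD[OF i j] DD[OF j i] dir_deriv_commute[OF \<phi>, of "E i" "E j"] \<kappa>_def
    by (simp add: algebra_simps)
qed

lemma cls_lap:
  assumes \<phi>: "\<phi> \<in> test_functions UNIV"
  shows "cls (lap \<phi>) = (\<Sum>i\<in>I. cls (D i (D i \<phi>)))"
  unfolding lap_def using finite_I
proof (induction I)
  case (insert i J)
  then show ?case
    by (simp add: cls_add sqint_test_functions[OF D_test[OF D_test[OF \<phi>]]]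
        sqint_test_functions[OF test_functions_sum[OF D_test[OF D_test[OF \<phi>]]]])
qed (simp add: cls_zero)

lemma lap_inner:
  assumes \<phi>: "\<phi> \<in> test_functions UNIV" and \<psi>: "\<psi> \<in> test_functions UNIV"
  shows "cls (lap \<phi>) \<bullet> cls \<psi> = - (\<Sum>i\<in>I. cls (D i \<phi>) \<bullet> cls (D i \<psi>))"
  unfolding cls_lap[OF \<phi>]
    by (simp add: inner_sum_left D_skew[OF _ D_test[OF \<phi>] \<psi>] sum_negf)

lemma lap_self_adjoint:
  "\<phi> \<in> test_functions UNIV \<Longrightarrow> \<psi> \<in> test_functions UNIV \<Longrightarrow> cls (lap \<phi>) \<bullet> cls \<psi> = cls \<phi> \<bullet> cls (lap \<psi>)"
  using lap_inner[of \<phi> \<psi>] lap_inner[of \<psi> \<phi>] by (simp add: inner_commute)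

lemma energy_eq: "\<phi> \<in> test_functions UNIV \<Longrightarrow> energy \<phi> = - (cls (lap \<phi>) \<bullet> cls \<phi>)"
  by (simp add: lap_inner energy_def power2_norm_eq_inner)

lemma energy_nonneg: "energy \<phi> \<ge> 0"
  by (simp add: energy_def sum_nonneg)

lemma energy_le: "\<phi> \<in> test_functions UNIV \<Longrightarrow> energy \<phi> \<le> norm (cls (lap \<phi>)) * norm (cls \<phi>)"
  using norm_cauchy_schwarz[of "- cls (lap \<phi>)" "cls \<phi>"] by (simp add: energy_eq)

lemma norm_D_le_energy: "i \<in> I \<Longrightarrow> (norm (cls (D i \<phi>)))\<^sup>2 \<le> energy \<phi>"
  unfolding energy_def by (rule member_le_sum) (auto simp: finite_I)

lemma D_bound:
  assumes "i \<in> I" "\<phi> \<in> test_functions UNIV"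
  shows "(norm (cls (D i \<phi>)))\<^sup>2 \<le> norm (cls (lap \<phi>)) * norm (cls \<phi>)"
  using norm_D_le_energy[OF assms(1)] energy_le[OF assms(2)] by (rule order_trans)

section \<open>The central derivative: from a form bound to a norm bound\<close>

text \<open>The form inequality \<open>|T| \<le> -\<Delta>\<close>. Up to sign \<open>T\<close> is
  the bracket of two fields, and skewness moves one field of each product to the other factor. A
  single Cauchy-Schwarz inequality in the plane for both products keeps the constant at 1.\<close>

lemma T_form_bound:
  assumes \<phi>: "\<phi> \<in> test_functions UNIV" and \<psi>: "\<psi> \<in> test_functions UNIV"
  shows "\<bar>cls (T \<phi>) \<bullet> cls \<psi>\<bar> \<le> sqrt (energy \<phi>) * sqrt (energy \<psi>)"
proof -
  obtain i j where ij: "i \<in> I" "j \<in> I" "\<bar>\<kappa> i j\<bar> = 1" using bracket_ex by (auto simp: \<kappa>_def)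
  then have "i \<noteq> j" by (auto simp: \<kappa>_def)
  have pair: "(norm (cls (D i f)))\<^sup>2 + (norm (cls (D j f)))\<^sup>2 \<le> energy f" for f
    unfolding energy_def using sum_mono2[OF finite_I, of "{i, j}" "\<lambda>i. (norm (cls (D i f)))\<^sup>2"] ij \<open>i \<noteq> j\<close>
    by simp
  have "cls (D i (D j \<phi>)) = cls (D j (D i \<phi>)) + \<kappa> i j *\<^sub>R cls (T \<phi>)"
    unfolding D_commutator[OF ij(1,2) \<phi>]
    by (simp add: cls_add cls_cmult test_sqint[OF \<phi>] test_sqint[OF D_test[OF \<phi>]] sqint_cmult)
  then have "\<kappa> i j *\<^sub>R cls (T \<phi>) \<bullet> cls \<psi> = cls (D i (D j \<phi>)) \<bullet> cls \<psi> - cls (D j (D i \<phi>)) \<bullet> cls \<psi>"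
    by (simp add: inner_add_left)
  also have "\<dots> = cls (D i \<phi>) \<bullet> cls (D j \<psi>) - cls (D j \<phi>) \<bullet> cls (D i \<psi>)"
    by (simp add: D_skew ij D_test \<phi> \<psi>)
  finally have "\<bar>cls (T \<phi>) \<bullet> cls \<psi>\<bar> = \<bar>cls (D i \<phi>) \<bullet> cls (D j \<psi>) - cls (D j \<phi>) \<bullet> cls (D i \<psi>)\<bar>"
    using ij(3) by (metis abs_mult inner_scaleR_left mult_1)
  also have "\<dots> \<le> \<bar>cls (D i \<phi>) \<bullet> cls (D j \<psi>)\<bar> + \<bar>cls (D j \<phi>) \<bullet> cls (D i \<psi>)\<bar>" by (rule abs_triangle_ineq4)
  also have "\<dots> \<le> norm (cls (D i \<phi>)) * norm (cls (D j \<psi>)) + norm (cls (D j \<phi>)) * norm (cls (D i \<psi>))"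
    by (intro add_mono Cauchy_Schwarz_ineq2)
  also have "\<dots> = (norm (cls (D i \<phi>)), norm (cls (D j \<phi>))) \<bullet> (norm (cls (D j \<psi>)), norm (cls (D i \<psi>)))"
    by simp
  also have "\<dots> \<le> norm (norm (cls (D i \<phi>)), norm (cls (D j \<phi>))) * norm (norm (cls (D j \<psi>)), norm (cls (D i \<psi>)))"
    by (rule norm_cauchy_schwarz)
  also have "\<dots> \<le> sqrt (energy \<phi>) * sqrt (energy \<psi>)"
    using pair[of \<phi>] pair[of \<psi>] by (intro mult_mono) (auto simp: norm_Pair energy_nonneg add.commute)
  finally show ?thesis .
qed

lemma D_shift:
  assumes i: "i \<in> I" and f: "smooth_on UNIV f"
  shows "D i (\<lambda>x. f (x + r *\<^sub>R \<tau>)) = (\<lambda>x. D i f (x + r *\<^sub>R \<tau>))"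
  unfolding D_expand[OF f] D_expand[OF smooth_shift[OF f]] T_def vf_deriv_shift[OF f]
  using C_orth[OF i] by (simp add: inner_add_left inner_commute[of \<tau>])

lemma lap_shift:
  "smooth_on UNIV f \<Longrightarrow> lap (\<lambda>x. f (x + r *\<^sub>R \<tau>)) = (\<lambda>x. lap f (x + r *\<^sub>R \<tau>))"
  unfolding lap_def by (intro ext sum.cong refl) (simp add: D_shift D_smooth)

lemma energy_shift:
  assumes \<phi>: "\<phi> \<in> test_functions UNIV"
  shows "energy (\<lambda>x. \<phi> (x + r *\<^sub>R \<tau>)) = energy \<phi>"
  unfolding energy_def
proof (intro sum.cong refl)
  fix i assume "i \<in> I"
  then have "cls (D i (\<lambda>x. \<phi> (x + r *\<^sub>R \<tau>))) = shift (r *\<^sub>R \<tau>) (cls (D i \<phi>))"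
    by (simp add: D_shift test_functions_smooth[OF \<phi>] cls_shift test_sqint[OF \<phi>])
  then show "(norm (cls (D i (\<lambda>x. \<phi> (x + r *\<^sub>R \<tau>)))))\<^sup>2 = (norm (cls (D i \<phi>)))\<^sup>2"
    by (simp add: power2_norm_eq_inner inner_shift)
qed

lemma energy_increment:
  assumes \<phi>: "\<phi> \<in> test_functions UNIV"
  shows "energy (\<lambda>x. \<phi> (x + r *\<^sub>R \<tau>) - \<phi> x) \<le> 4 * energy \<phi>"
  unfolding energy_def sum_distrib_left
proof (rule sum_mono)
  fix i assume i: "i \<in> I"
  note s = test_functions_smooth[OF \<phi>]
  have "cls (D i (\<lambda>x. \<phi> (x + r *\<^sub>R \<tau>) - \<phi> x)) = shift (r *\<^sub>R \<tau>) (cls (D i \<phi>)) - cls (D i \<phi>)"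
    by (simp add: D_diff[OF smooth_shift[OF s] s] D_shift[OF i s] cls_diff cls_shift test_sqint[OF \<phi>] sqint_shift)
  then have "norm (cls (D i (\<lambda>x. \<phi> (x + r *\<^sub>R \<tau>) - \<phi> x))) \<le> 2 * norm (cls (D i \<phi>))"
    using norm_triangle_ineq4[of "shift (r *\<^sub>R \<tau>) (cls (D i \<phi>))" "cls (D i \<phi>)"]
    by (simp add: norm_eq_sqrt_inner inner_shift)
  then have "(norm (cls (D i (\<lambda>x. \<phi> (x + r *\<^sub>R \<tau>) - \<phi> x))))\<^sup>2 \<le> (2 * norm (cls (D i \<phi>)))\<^sup>2"
    by (rule power_mono) simp
  then show "(norm (cls (D i (\<lambda>x. \<phi> (x + r *\<^sub>R \<tau>) - \<phi> x))))\<^sup>2 \<le> 4 * (norm (cls (D i \<phi>)))\<^sup>2"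
    by (simp add: power_mult_distrib)
qed

text \<open>The energy controls half a derivative along \<open>\<tau>\<close>. The mean value
  theorem is applied to the inner product of the translates of \<open>\<phi>\<close> with the
  increment; the form bound estimates the derivative, and \<open>sqrt 4\<close> from the energy of
  the increment is the factor 2.\<close>

lemma shift_increment_energy:
  assumes \<phi>: "\<phi> \<in> test_functions UNIV" and r: "r > 0"
  shows "(norm (shift (r *\<^sub>R \<tau>) (cls \<phi>) - cls \<phi>))\<^sup>2 \<le> 2 * r * energy \<phi>"
proof -
  define \<psi> where "\<psi> = (\<lambda>x. \<phi> (x + r *\<^sub>R \<tau>) - \<phi> x)"
  have \<psi>: "\<psi> \<in> test_functions UNIV" unfolding \<psi>_def by (intro test_functions_diff test_functions_shift \<phi>)
  have c\<psi>: "cls \<psi> = shift (r *\<^sub>R \<tau>) (cls \<phi>) - cls \<phi>"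
    unfolding \<psi>_def by (simp add: cls_diff cls_shift sqint_shift test_sqint[OF \<phi>])
  have "((\<lambda>s. shift (s *\<^sub>R \<tau>) (cls \<phi>) \<bullet> cls \<psi>) has_real_derivative shift (s *\<^sub>R \<tau>) (cls (T \<phi>)) \<bullet> cls \<psi>) (at s)" for s
    unfolding has_real_derivative_iff_has_vector_derivative T_def
    by (rule bounded_linear.has_vector_derivative[OF bounded_linear_inner_left
            shift_has_vector_derivative[OF \<phi>]])
  from mvt_from_0[OF this] obtain s where
    s: "shift (r *\<^sub>R \<tau>) (cls \<phi>) \<bullet> cls \<psi> - shift (0 *\<^sub>R \<tau>) (cls \<phi>) \<bullet> cls \<psi> = r * (shift (s *\<^sub>R \<tau>) (cls (T \<phi>)) \<bullet> cls \<psi>)"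
    by metis
  have "shift (s *\<^sub>R \<tau>) (cls (T \<phi>)) = cls (T (\<lambda>x. \<phi> (x + s *\<^sub>R \<tau>)))"
    unfolding T_def by (simp add: vf_deriv_shift test_functions_smooth[OF \<phi>] cls_shift test_sqint[OF \<phi>, unfolded T_def])
  then have "shift (s *\<^sub>R \<tau>) (cls (T \<phi>)) \<bullet> cls \<psi> \<le> sqrt (energy \<phi>) * sqrt (energy \<psi>)"
    using T_form_bound[OF test_functions_shift[OF \<phi>] \<psi>, of "s *\<^sub>R \<tau>"] energy_shift[OF \<phi>, of s] by simp
  also have "\<dots> \<le> sqrt (energy \<phi>) * sqrt (4 * energy \<phi>)"
    unfolding \<psi>_def by (intro mult_left_mono real_sqrt_le_mono energy_increment \<phi>) (simp add: energy_nonneg)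
  also have "\<dots> = 2 * energy \<phi>" by (simp add: real_sqrt_mult energy_nonneg)
  finally have "r * (shift (s *\<^sub>R \<tau>) (cls (T \<phi>)) \<bullet> cls \<psi>) \<le> r * (2 * energy \<phi>)"
    using r by (intro mult_left_mono) auto
  moreover have "(norm (cls \<psi>))\<^sup>2 = shift (r *\<^sub>R \<tau>) (cls \<phi>) \<bullet> cls \<psi> - shift (0 *\<^sub>R \<tau>) (cls \<phi>) \<bullet> cls \<psi>"
    unfolding power2_norm_eq_inner by (subst (1) c\<psi>) (simp add: inner_diff_left shift_zero)
  ultimately show ?thesis using s c\<psi> by simp
qed

text \<open>For the increment \<open>\<psi>\<close> itself, \<open>shift_increment_energy\<close>
  becomes the hypothesis of \<open>flow_increment_bound\<close> with \<open>C = 2\<close> and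
  \<open>a = - \<Delta> \<phi>\<close>: as \<open>\<Delta>\<close> commutes with the translations,
  the energy of \<open>\<psi>\<close> is the inner product of the increment of \<open>a\<close> with
  \<open>\<psi>\<close>.\<close>

lemma shift_increment_lap:
  assumes \<phi>: "\<phi> \<in> test_functions UNIV" and h: "h > 0"
  shows "norm (shift (h *\<^sub>R \<tau>) (cls \<phi>) - cls \<phi>) \<le> 5 * h * norm (cls (lap \<phi>))"
proof -
  interpret unitary_flow "\<lambda>r. shift (r *\<^sub>R \<tau>)" by (rule unitary_flow_shift)
  note s = test_functions_smooth[OF \<phi>]
  have "norm (shift (h *\<^sub>R \<tau>) (cls \<phi>) - cls \<phi>) \<le> 5 * 2 / 2 * h * norm (- cls (lap \<phi>))"
  proof (rule flow_increment_bound)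
    fix r :: real assume r: "r > 0"
    define \<psi> where "\<psi> = (\<lambda>x. \<phi> (x + r *\<^sub>R \<tau>) - \<phi> x)"
    have \<psi>: "\<psi> \<in> test_functions UNIV" unfolding \<psi>_def by (intro test_functions_diff test_functions_shift \<phi>)
    have c\<psi>: "cls \<psi> = shift (r *\<^sub>R \<tau>) (cls \<phi>) - cls \<phi>"
      unfolding \<psi>_def by (simp add: cls_diff cls_shift sqint_shift test_sqint[OF \<phi>])
    have "cls (lap \<psi>) = shift (r *\<^sub>R \<tau>) (cls (lap \<phi>)) - cls (lap \<phi>)"
      unfolding \<psi>_def lap_diff[OF smooth_shift[OF s] s] lap_shift[OF s]
      by (simp add: cls_diff cls_shift sqint_shift test_sqint[OF \<phi>])
    then have "energy \<psi> = (shift (r *\<^sub>R \<tau>) (- cls (lap \<phi>)) - (- cls (lap \<phi>))) \<bullet> cls \<psi>"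
      by (simp add: energy_eq[OF \<psi>] linear_neg[OF linear_shift] inner_simps)
    then show "(norm (shift (r *\<^sub>R \<tau>) (shift (r *\<^sub>R \<tau>) (cls \<phi>) - cls \<phi>) - (shift (r *\<^sub>R \<tau>) (cls \<phi>) - cls \<phi>)))\<^sup>2
      \<le> 2 * r * ((shift (r *\<^sub>R \<tau>) (- cls (lap \<phi>)) - (- cls (lap \<phi>))) \<bullet> (shift (r *\<^sub>R \<tau>) (cls \<phi>) - cls \<phi>))"
      using shift_increment_energy[OF \<psi> r] unfolding c\<psi> by simp
  qed (use h in auto)
  then show ?thesis by simp
qed

text \<open>Limit of the preceding bound for difference quotients, which \<open>shift_taylor\<close>
  compares with \<open>T \<phi>\<close>.\<close>

lemma T_bound:
  assumes \<phi>: "\<phi> \<in> test_functions UNIV"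
  shows "norm (cls (T \<phi>)) \<le> 5 * norm (cls (lap \<phi>))"
proof -
  obtain B where B: "\<And>e. \<bar>e\<bar> \<le> 1 \<Longrightarrow>
    norm (shift (e *\<^sub>R \<tau>) (cls \<phi>) - cls \<phi> - e *\<^sub>R cls (T \<phi>)) \<le> B * e\<^sup>2"
    unfolding T_def using shift_taylor[OF \<phi>] by metis
  have *: "norm (cls (T \<phi>)) \<le> 5 * norm (cls (lap \<phi>)) + B * e" if e: "0 < e" "e \<le> 1" for e
  proof -
    have "e * norm (cls (T \<phi>)) = norm (e *\<^sub>R cls (T \<phi>))" using e by simp
    also have "\<dots> \<le> norm (shift (e *\<^sub>R \<tau>) (cls \<phi>) - cls \<phi>)
        + norm (shift (e *\<^sub>R \<tau>) (cls \<phi>) - cls \<phi> - e *\<^sub>R cls (T \<phi>))"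
      using norm_triangle_ineq4[of "shift (e *\<^sub>R \<tau>) (cls \<phi>) - cls \<phi>"
          "shift (e *\<^sub>R \<tau>) (cls \<phi>) - cls \<phi> - e *\<^sub>R cls (T \<phi>)"] by simp
    also have "\<dots> \<le> 5 * e * norm (cls (lap \<phi>)) + B * e\<^sup>2"
      using B[of e] e by (intro add_mono shift_increment_lap \<phi>) auto
    also have "\<dots> = e * (5 * norm (cls (lap \<phi>)) + B * e)" by (simp add: power2_eq_square algebra_simps)
    finally show ?thesis using e by simp
  qed
  have "(\<lambda>n. 5 * norm (cls (lap \<phi>)) + B * (1 / real (Suc n))) \<longlonglongrightarrow> 5 * norm (cls (lap \<phi>)) + B * 0"
    by (intro tendsto_intros LIMSEQ_Suc[OF lim_1_over_n])
  then have "norm (cls (T \<phi>)) \<le> 5 * norm (cls (lap \<phi>)) + B * 0"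
    by (rule LIMSEQ_le_const) (intro exI[of _ 0] allI impI *, auto)
  then show ?thesis by simp
qed

text \<open>Two integrations by parts and the commutators give the exact value: the squared norm of
  \<open>D j (D i \<phi>) + \<kappa> i j * T \<phi>\<close> minus \<open>(\<kappa> i j)^2\<close>
  times that of \<open>T \<phi>\<close>, where \<open>\<kappa>\<close> is at most 1 in absolute
  value.\<close>

lemma inner_D2_ge:
  assumes i: "i \<in> I" and j: "j \<in> I" and \<phi>: "\<phi> \<in> test_functions UNIV"
  shows "cls (D i (D i \<phi>)) \<bullet> cls (D j (D j \<phi>)) \<ge> - (norm (cls (T \<phi>)))\<^sup>2"
proof -
  define a where "a = cls (D j (D i \<phi>))"
  define t where "t = cls (T \<phi>)"
  have comm: "cls (D i (D j f)) = cls (D j (D i f)) + \<kappa> i j *\<^sub>R cls (T f)" if "f \<in> test_functions UNIV" for f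
    unfolding D_commutator[OF i j that]
    by (simp add: cls_add cls_cmult test_sqint[OF that] test_sqint[OF D_test[OF that]] sqint_cmult)
  have "cls (D i (D i \<phi>)) \<bullet> cls (D j (D j \<phi>)) = - (cls (D i \<phi>) \<bullet> cls (D i (D j (D j \<phi>))))"
    by (rule D_skew; intro i D_test \<phi>)
  also have "\<dots> = - (cls (D i \<phi>) \<bullet> cls (D j (D i (D j \<phi>)))) - \<kappa> i j * (cls (D i \<phi>) \<bullet> cls (D j (T \<phi>)))"
    unfolding comm[OF D_test[OF \<phi>]] T_D_commute[OF j \<phi>] by (simp add: inner_simps)
  also have "- (cls (D i \<phi>) \<bullet> cls (D j (D i (D j \<phi>)))) = a \<bullet> cls (D i (D j \<phi>))"
    unfolding a_def by (rule D_skew[symmetric]; intro j D_test \<phi>)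
  also have "cls (D i \<phi>) \<bullet> cls (D j (T \<phi>)) = - (a \<bullet> t)"
    using D_skew[OF j D_test[OF \<phi>] T_test[OF \<phi>], of i] by (simp add: a_def t_def)
  also have "a \<bullet> cls (D i (D j \<phi>)) - \<kappa> i j * - (a \<bullet> t) = (norm (a + \<kappa> i j *\<^sub>R t))\<^sup>2 - (\<kappa> i j)\<^sup>2 * (norm t)\<^sup>2"
    unfolding comm[OF \<phi>] power2_norm_eq_inner a_def[symmetric] t_def[symmetric]
    by (simp add: inner_simps inner_commute[of t a] power2_eq_square algebra_simps)
  also have "\<dots> \<ge> - (norm t)\<^sup>2"
  proof -
    have "(\<kappa> i j)\<^sup>2 \<le> 1" using bracket_le[OF i j] by (simp add: \<kappa>_def abs_square_le_1)
    then have "(\<kappa> i j)\<^sup>2 * (norm t)\<^sup>2 \<le> 1 * (norm t)\<^sup>2" by (rule mult_right_mono) simp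
    then show ?thesis using zero_le_power2[of "norm (a + \<kappa> i j *\<^sub>R t)"] by linarith
  qed
  finally show ?thesis by (simp add: t_def)
qed

text \<open>Raising all inner products of second derivatives by the squared norm of
  \<open>T \<phi>\<close> makes them nonnegative, so a diagonal entry is at most the double sum.
  That sum is the squared norm of the Laplacian plus \<open>(card I)^2\<close> times the raise, and
  \<open>25 = 5^2\<close> comes from \<open>T_bound\<close>.\<close>

lemma D2_bound:
  assumes i: "i \<in> I" and \<phi>: "\<phi> \<in> test_functions UNIV"
  shows "(norm (cls (D i (D i \<phi>))))\<^sup>2 \<le> (1 + 25 * (real (card I))\<^sup>2) * (norm (cls (lap \<phi>)))\<^sup>2"
proof -
  define t where "t = (norm (cls (T \<phi>)))\<^sup>2"
  define f where "f = (\<lambda>i j. cls (D i (D i \<phi>)) \<bullet> cls (D j (D j \<phi>)) + t)"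
  have f0: "f j k \<ge> 0" if "j \<in> I" "k \<in> I" for j k
    using inner_D2_ge[OF that \<phi>] by (simp add: f_def t_def)
  have "(norm (cls (D i (D i \<phi>))))\<^sup>2 \<le> f i i" by (simp add: f_def t_def power2_norm_eq_inner)
  also have "\<dots> \<le> (\<Sum>j\<in>I. f i j)" by (rule member_le_sum) (auto simp: finite_I i f0)
  also have "\<dots> \<le> (\<Sum>k\<in>I. \<Sum>j\<in>I. f k j)"
    by (rule member_le_sum[of i I "\<lambda>k. \<Sum>j\<in>I. f k j"]) (auto simp: finite_I i intro!: sum_nonneg f0)
  also have "\<dots> = (norm (cls (lap \<phi>)))\<^sup>2 + (real (card I))\<^sup>2 * t"
  proof -
    have "(norm (cls (lap \<phi>)))\<^sup>2 = (\<Sum>k\<in>I. \<Sum>j\<in>I. cls (D k (D k \<phi>)) \<bullet> cls (D j (D j \<phi>)))"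
      unfolding power2_norm_eq_inner cls_lap[OF \<phi>] inner_sum_left by (simp only: inner_sum_right)
    then show ?thesis by (simp add: f_def sum.distrib power2_eq_square)
  qed
  finally have le: "(norm (cls (D i (D i \<phi>))))\<^sup>2 \<le> (norm (cls (lap \<phi>)))\<^sup>2 + (real (card I))\<^sup>2 * t" .
  have "t \<le> 25 * (norm (cls (lap \<phi>)))\<^sup>2"
    using power_mono[OF T_bound[OF \<phi>], of 2] by (simp add: t_def power_mult_distrib)
  then have "(real (card I))\<^sup>2 * t \<le> (real (card I))\<^sup>2 * (25 * (norm (cls (lap \<phi>)))\<^sup>2)"
    by (rule mult_left_mono) simp
  then show ?thesis using le by (simp add: algebra_simps)
qed

end

subsection \<open>Density of the test functions\<close>

text \<open>The flat function \<open>exp (-1/t)\<close> together with a polynomial in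
  \<open>1/t\<close>, so that the family is closed under differentiation.\<close>

definition bump :: "real poly \<Rightarrow> real \<Rightarrow> real" where
  "bump q t = (if t > 0 then poly q (1 / t) * exp (- (1 / t)) else 0)"

lemma poly_over_exp_tendsto_0: "((\<lambda>x. poly q x / exp x) \<longlongrightarrow> (0::real)) at_top"
proof -
  have "((\<lambda>x. \<Sum>i\<le>degree q. coeff q i * (x ^ i / exp x)) \<longlongrightarrow> (\<Sum>i\<le>degree q. coeff q i * 0)) at_top"
    by (intro tendsto_intros tendsto_power_div_exp_0)
  then show ?thesis by (simp add: poly_altdef sum_divide_distrib)
qed

text \<open>For \<open>t > 0\<close> put \<open>s = 1/t\<close>: the derivative is
  \<open>s^2 (q s - q' s) exp (-s)\<close>, and \<open>[:0, 0, 1:]\<close> is \<open>s^2\<close>. At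
  0 the exponential beats every polynomial.\<close>

lemma bump_has_derivative:
  "(bump q has_real_derivative bump ([:0, 0, 1:] * (q - pderiv q)) t) (at t)"
proof -
  consider "t > 0" | "t < 0" | "t = 0" by linarith
  then show ?thesis
  proof cases
    case 1
    have "((\<lambda>t. poly q (1 / t) * exp (- (1 / t))) has_real_derivative bump ([:0, 0, 1:] * (q - pderiv q)) t) (at t)"
      using 1 by (auto intro!: derivative_eq_intros simp: bump_def field_simps power2_eq_square)
    then show ?thesis
      by (rule has_field_derivative_transform_within_open[where S="{0<..}"]) (use 1 in \<open>auto simp: bump_def\<close>)
  next
    case 2
    have "((\<lambda>t. 0) has_real_derivative bump ([:0, 0, 1:] * (q - pderiv q)) t) (at t)"
      using 2 by (auto simp: bump_def)
    then show ?thesis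
      by (rule has_field_derivative_transform_within_open[where S="{..<0}"]) (use 2 in \<open>auto simp: bump_def\<close>)
  next
    case 3
    have "((\<lambda>h. bump q h / h) \<longlongrightarrow> 0) (at_right 0)"
    proof (rule filterlim_at_right_to_top[THEN iffD2])
      have "((\<lambda>x. poly ([:0, 1:] * q) x / exp x) \<longlongrightarrow> 0) at_top" by (rule poly_over_exp_tendsto_0)
      then show "((\<lambda>x. bump q (inverse x) / inverse x) \<longlongrightarrow> 0) at_top"
        by (rule Lim_transform_eventually)
          (auto intro!: eventually_mono[OF eventually_gt_at_top[of 0]] simp: bump_def exp_minus field_simps)
    qed
    moreover have "((\<lambda>h. bump q h / h) \<longlongrightarrow> 0) (at_left 0)"
      by (rule Lim_transform_eventually[OF tendsto_const])
        (auto simp: eventually_at_filter bump_def)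
    ultimately have "((\<lambda>h. bump q h / h) \<longlongrightarrow> 0) (at 0)" by (rule filterlim_split_at_real[rotated])
    then show ?thesis using 3 by (simp add: DERIV_def bump_def)
  qed
qed

lemma smooth_bump: "smooth_on UNIV (\<lambda>z. bump q (\<alpha> + \<beta> * (z \<bullet> b)))"
proof -
  \<comment> \<open>The constant \<open>c\<close> is part of the induction because each partial
    derivative produces a factor \<open>\<beta> * (v \<bullet> b)\<close>.\<close>
  have "Ck_on k UNIV (\<lambda>z. c * bump q (\<alpha> + \<beta> * (z \<bullet> b)))" for k c
  proof (induction k arbitrary: q c)
    case 0
    have "continuous_on UNIV (bump q)"
      using bump_has_derivative by (meson DERIV_isCont continuous_at_imp_continuous_on)
    then show ?case by (auto intro!: continuous_intros continuous_on_compose2[of UNIV "bump q"])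
  next
    case (Suc k)
    have d: "((\<lambda>z. c * bump q (\<alpha> + \<beta> * (z \<bullet> b))) has_derivative
        (\<lambda>v. (c * (\<beta> * (v \<bullet> b))) * bump ([:0, 0, 1:] * (q - pderiv q)) (\<alpha> + \<beta> * (z \<bullet> b)))) (at z)" for z
    proof -
      have "((\<lambda>z. bump q (\<alpha> + \<beta> * (z \<bullet> b))) has_derivative
        (\<lambda>v. bump ([:0, 0, 1:] * (q - pderiv q)) (\<alpha> + \<beta> * (z \<bullet> b)) * (\<beta> * (v \<bullet> b)))) (at z)"
        by (rule has_derivative_compose[OF _ bump_has_derivative[unfolded has_field_derivative_def]])
          (auto intro!: derivative_eq_intros)
      from has_derivative_mult_right[OF this, of c] show ?thesis by (simp add: mult_ac)
    qed
    have "(\<lambda>z. c * bump q (\<alpha> + \<beta> * (z \<bullet> b))) differentiable (at z)" for z using d differentiableI by blast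
    then show ?case by (simp only: Ck_on.simps frechet_derivative_at[OF d, symmetric]) (auto intro: Suc)
  qed
  from this[where c=1] show ?thesis by (simp add: smooth_on_def)
qed

definition box_bump :: "'a::euclidean_space \<Rightarrow> 'a \<Rightarrow> nat \<Rightarrow> 'a \<Rightarrow> real" where
  "box_bump l u m z = (\<Prod>b\<in>Basis. bump 1 (real m * (z \<bullet> b - l \<bullet> b)) * bump 1 (real m * (u \<bullet> b - z \<bullet> b)))"

lemma bump_1_bounds: "0 \<le> bump 1 t" "bump 1 t \<le> 1"
  by (auto simp: bump_def)

lemma box_bump_bounds: "0 \<le> box_bump l u m z" "box_bump l u m z \<le> 1"
  unfolding box_bump_def by (auto intro!: prod_nonneg prod_le_1 mult_nonneg_nonneg mult_le_one bump_1_bounds)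

lemma box_bump_outside:
  assumes "z \<notin> box l u"
  shows "box_bump l u m z = 0"
proof -
  from assms obtain b where b: "b \<in> Basis" "z \<bullet> b - l \<bullet> b \<le> 0 \<or> u \<bullet> b - z \<bullet> b \<le> 0"
    by (auto simp: mem_box not_less)
  then have "bump 1 (real m * (z \<bullet> b - l \<bullet> b)) * bump 1 (real m * (u \<bullet> b - z \<bullet> b)) = 0"
    by (auto simp: bump_def zero_less_mult_iff not_less)
  then show ?thesis unfolding box_bump_def using b(1) by (intro prod_zero) auto
qed

lemma box_bump_test: "cbox l u \<subseteq> \<Omega> \<Longrightarrow> box_bump l u m \<in> test_functions \<Omega>"
proof -
  assume sub: "cbox l u \<subseteq> \<Omega>"
  have "smooth_on UNIV (box_bump l u m)" unfolding box_bump_def[abs_def]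
  proof (intro smooth_prod smooth_mult)
    fix b
    show "smooth_on UNIV (\<lambda>z. bump 1 (real m * (z \<bullet> b - l \<bullet> b)))"
      using smooth_bump[of 1 "- real m * (l \<bullet> b)" "real m" b] by (simp add: algebra_simps)
    show "smooth_on UNIV (\<lambda>z. bump 1 (real m * (u \<bullet> b - z \<bullet> b)))"
      using smooth_bump[of 1 "real m * (u \<bullet> b)" "- real m" b] by (simp add: algebra_simps)
  qed
  moreover have "box_bump l u m z = 0" if "z \<notin> cbox l u" for z
    using that box_subset_cbox by (intro box_bump_outside) blast
  ultimately show ?thesis using sub by (auto simp: test_functions_def intro!: exI[of _ "cbox l u"])
qed

lemma bump_1_limit: "t > 0 \<Longrightarrow> (\<lambda>m. bump 1 (real m * t)) \<longlonglongrightarrow> 1"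
proof -
  assume t: "t > 0"
  have "filterlim (\<lambda>m. t * real m) at_top sequentially"
    by (rule filterlim_tendsto_pos_mult_at_top[OF tendsto_const t filterlim_real_sequentially])
  then have "(\<lambda>m. exp (- inverse (t * real m))) \<longlonglongrightarrow> exp (- 0)"
    by (intro tendsto_intros tendsto_inverse_0_at_top)
  then have "(\<lambda>m. exp (- inverse (t * real m))) \<longlonglongrightarrow> 1" by simp
  then show ?thesis
    by (rule Lim_transform_eventually)
      (use t in \<open>auto intro!: eventually_mono[OF eventually_gt_at_top[of 0]] simp: bump_def field_simps\<close>)
qed

lemma box_bump_limit: "(\<lambda>m. box_bump l u m z) \<longlonglongrightarrow> indicator (box l u) z"
proof (cases "z \<in> box l u")
  case True
  have "(\<lambda>m. box_bump l u m z) \<longlonglongrightarrow> (\<Prod>b\<in>(Basis::'a set). 1 * 1)"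
    unfolding box_bump_def
    by (intro tendsto_intros bump_1_limit) (use True in \<open>auto simp: mem_box\<close>)
  then show ?thesis using True by simp
qed (simp add: box_bump_outside)

section \<open>The fundamental lemma of the calculus of variations\<close>

text \<open>The positive and the negative part of \<open>g\<close> are densities of two measures
  that agree on the boxes, an intersection-stable generator of the Borel sets, so the measures and
  hence the densities coincide.\<close>

lemma AE_eq_0_if_box_integrals_eq_0:
  fixes g :: "'a::euclidean_space \<Rightarrow> real"
  assumes g: "integrable lborel g" and 0: "\<And>l u. (\<integral>x. indicator (box l u) x * g x \<partial>lborel) = 0"
  shows "AE x in lborel. g x = 0"
proof -
  have [measurable]: "g \<in> borel_measurable borel" using g by auto
  let ?p = "\<lambda>x. ennreal (max 0 (g x))" and ?n = "\<lambda>x. ennreal (max 0 (- g x))"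
  have int: "integrable lborel (\<lambda>x. indicator (box l u) x * max 0 (c * g x))" for l u and c :: real
    by (rule Bochner_Integration.integrable_bound[OF integrable_mult_right[OF g, of c]])
      (auto simp: indicator_def)
  have em: "emeasure (density lborel (\<lambda>x. ennreal (max 0 (c * g x)))) (box l u)
      = ennreal (\<integral>x. indicator (box l u) x * max 0 (c * g x) \<partial>lborel)" for l u c
  proof -
    have "emeasure (density lborel (\<lambda>x. ennreal (max 0 (c * g x)))) (box l u)
        = (\<integral>\<^sup>+x. ennreal (indicator (box l u) x * max 0 (c * g x)) \<partial>lborel)"
      by (subst emeasure_density) (auto intro!: nn_integral_cong simp: indicator_def)
    also have "\<dots> = ennreal (\<integral>x. indicator (box l u) x * max 0 (c * g x) \<partial>lborel)"
      by (rule nn_integral_eq_integral[OF int]) auto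
    finally show ?thesis .
  qed
  have eq: "emeasure (density lborel ?p) (box l u) = emeasure (density lborel ?n) (box l u)" for l u
  proof -
    have "(\<integral>x. indicator (box l u) x * max 0 (1 * g x) \<partial>lborel) - (\<integral>x. indicator (box l u) x * max 0 (-1 * g x) \<partial>lborel)
      = (\<integral>x. indicator (box l u) x * max 0 (1 * g x) - indicator (box l u) x * max 0 (-1 * g x) \<partial>lborel)"
      by (rule Bochner_Integration.integral_diff[OF int int, symmetric])
    also have "\<dots> = (\<integral>x. indicator (box l u) x * g x \<partial>lborel)"
      by (rule Bochner_Integration.integral_cong) (auto simp: max_def indicator_def)
    finally show ?thesis using em[of 1 l u] em[of "-1" l u] 0 by simp
  qed
  have "density lborel ?p = density lborel ?n"
  proof (rule measure_eqI_generator_eq)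
    let ?E = "range (\<lambda>(a, b). box a b::'a set)"
    show "Int_stable ?E" by (auto simp: Int_stable_def box_Int_box)
    show "?E \<subseteq> Pow UNIV" "sets (density lborel ?p) = sigma_sets UNIV ?E" "sets (density lborel ?n) = sigma_sets UNIV ?E"
      by (simp_all add: borel_eq_box)
    let ?A = "\<lambda>n::nat. box (- (real n *\<^sub>R One)) (real n *\<^sub>R One) :: 'a set"
    show "range ?A \<subseteq> ?E" "(\<Union>i. ?A i) = UNIV" unfolding UN_box_eq_UNIV by auto
    show "emeasure (density lborel ?p) (?A i) \<noteq> \<infinity>" for i using em[of 1] by simp
    show "emeasure (density lborel ?p) X = emeasure (density lborel ?n) X" if "X \<in> ?E" for X
      using that eq by auto
  qed
  then have "AE x in lborel. ?p x = ?n x" 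
    by (intro sigma_finite_measure.density_unique[OF sigma_finite_lborel]) auto
  then show ?thesis
    by (rule AE_mp) (auto intro!: AE_I2 simp: max_def split: if_splits)
qed

text \<open>Smooth bumps converge to the indicator of a box and are dominated, which reduces the
  claim to integrals over boxes. It will make weak derivatives unique, so that the choice in
  \<open>weak_deriv\<close> is harmless.\<close>

lemma AE_eq_0_if_orthogonal_to_test_functions:
  assumes \<Omega>: "open \<Omega>" and w: "sqint w"
    and orth: "\<And>\<eta>. \<eta> \<in> test_functions \<Omega> \<Longrightarrow> (\<integral>x. w x * \<eta> x \<partial>lebesgue) = 0"
  shows "AE x in lebesgue. x \<in> \<Omega> \<longrightarrow> w x = 0"
proof -
  have [measurable]: "w \<in> borel_measurable lebesgue" using w by (simp add: sqint_def)
  have ind: "sqint (indicator (box l u) :: 'a \<Rightarrow> real)" for l u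
  proof -
    have "(\<lambda>x. (indicator (box l u) x)\<^sup>2) = (indicator (box l u) :: 'a \<Rightarrow> real)" by (auto simp: indicator_def)
    then show ?thesis
      using lmeasurable_box[of l u] by (auto simp: sqint_def fmeasurable_def intro!: borel_measurable_indicator)
  qed
  have box0: "(\<integral>x. indicator (box l u) x * w x \<partial>lebesgue) = 0" if sub: "cbox l u \<subseteq> \<Omega>" for l u
  proof -
    have "(\<lambda>m. \<integral>x. w x * box_bump l u m x \<partial>lebesgue) \<longlonglongrightarrow> (\<integral>x. w x * indicator (box l u) x \<partial>lebesgue)"
    proof (rule integral_dominated_convergence[where w="\<lambda>x. \<bar>w x * indicator (box l u) x\<bar>"])
      show "(\<lambda>x. w x * box_bump l u m x) \<in> borel_measurable lebesgue" for m
        using sqint_measurable[OF sqint_test_functions[OF box_bump_test[OF sub]]] by measurable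
      show "integrable lebesgue (\<lambda>x. \<bar>w x * indicator (box l u) x\<bar>)"
        by (intro integrable_abs sqint_integrable_mult w ind)
      show "AE x in lebesgue. (\<lambda>m. w x * box_bump l u m x) \<longlonglongrightarrow> w x * indicator (box l u) x"
        by (intro AE_I2 tendsto_intros box_bump_limit)
      have "norm (w x * box_bump l u m x) \<le> \<bar>w x * indicator (box l u) x\<bar>" for x m
        using box_bump_bounds[of l u m x]
        by (cases "x \<in> box l u") (auto simp: abs_mult box_bump_outside intro: mult_left_le)
      then show "AE x in lebesgue. norm (w x * box_bump l u m x) \<le> \<bar>w x * indicator (box l u) x\<bar>" for m
        by simp
    qed (intro borel_measurable_times sqint_measurable w ind)
    then show ?thesis
      by (simp add: orth[OF box_bump_test[OF sub]] LIMSEQ_const_iff mult.commute)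
  qed
  obtain w' where w': "w' \<in> borel_measurable lborel" "AE x in lborel. w x = w' x"
    using completion_ex_borel_measurable_real[of w lborel] by auto
  have [measurable]: "w' \<in> borel_measurable borel" using w'(1) by simp
  have w'l: "w' \<in> borel_measurable lebesgue" using w'(1) by (rule measurable_completion)
  have indl: "(indicator (box l u) :: 'a \<Rightarrow> real) \<in> borel_measurable lebesgue" for l u
    by (rule sqint_measurable[OF ind])
  have ae: "AE x in lebesgue. w x = w' x" by (rule AE_completion[OF w'(2)])
  have cb: "AE x in lebesgue. x \<in> cbox l u \<longrightarrow> w x = 0" if sub: "cbox l u \<subseteq> \<Omega>" for l u
  proof -
    define g where "g = (\<lambda>x. indicator (box l u) x * w' x)"
    have [measurable]: "g \<in> borel_measurable borel" unfolding g_def by measurable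
    have "integrable lebesgue (\<lambda>x. indicator (box l u) x * w x)"
      by (rule sqint_integrable_mult[OF ind w])
    then have "integrable lebesgue g"
      unfolding g_def
      by (rule integrable_cong_AE_imp[OF _ borel_measurable_times[OF indl w'l]]) (use ae in eventually_elim, simp)
    then have "integrable lborel g" by (simp add: integrable_completion)
    moreover have "(\<integral>x. indicator (box p q) x * g x \<partial>lborel) = 0" for p q
    proof -
      \<comment> \<open>The empty case is separate because the closed box with the corners of an
        empty open box may leave \<open>\<Omega>\<close>.\<close>
      obtain l' u' where lu: "box p q \<inter> box l u = box l' u'" "box l' u' = {} \<or> cbox l' u' \<subseteq> \<Omega>"
      proof -
        have "\<exists>l' u'. box p q \<inter> box l u = box l' u'" unfolding box_Int_box by blast
        then obtain l' u' where *: "box p q \<inter> box l u = box l' u'" by blast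
        have "cbox l' u' \<subseteq> cbox l u" if "box l' u' \<noteq> {}"
        proof -
          have "closure (box l' u') \<subseteq> closure (box l u)" using * by (intro closure_mono) auto
          also have "\<dots> \<subseteq> cbox l u" by (rule closure_minimal) (auto simp: box_subset_cbox)
          finally show ?thesis using that by (simp add: closure_box)
        qed
        then show thesis using that[of l' u'] * sub by blast
      qed
      have "(\<integral>x. indicator (box p q) x * g x \<partial>lborel) = (\<integral>x. indicator (box l' u') x * w' x \<partial>lborel)"
        by (rule Bochner_Integration.integral_cong) (auto simp: g_def simp flip: lu(1) split: split_indicator)
      also have "\<dots> = (\<integral>x. indicator (box l' u') x * w' x \<partial>lebesgue)"
        by (rule integral_completion[symmetric]) measurable
      also have "\<dots> = (\<integral>x. indicator (box l' u') x * w x \<partial>lebesgue)"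
        by (rule integral_cong_AE) (intro borel_measurable_times indl w'l sqint_measurable[OF w], intro borel_measurable_times indl w'l sqint_measurable[OF w], use ae in eventually_elim, simp)
      also have "\<dots> = 0" using lu(2) box0 by auto
      finally show ?thesis .
    qed
    ultimately have "AE x in lborel. g x = 0" by (rule AE_eq_0_if_box_integrals_eq_0)
    then have "AE x in lebesgue. g x = 0" by (rule AE_completion)
    moreover have "AE x in lebesgue. x \<notin> cbox l u - box l u"
      by (rule AE_not_in) (use negligible_frontier_interval[of l u] in \<open>simp add: negligible_iff_null_sets\<close>)
    ultimately show ?thesis using ae by eventually_elim (auto simp: g_def)
  qed
  obtain \<D> where \<D>: "countable \<D>" "\<D> \<subseteq> Pow \<Omega>" "\<And>X. X \<in> \<D> \<Longrightarrow> \<exists>a b. X = cbox a b" "\<Union>\<D> = \<Omega>"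
    using open_countable_Union_open_cbox[OF \<Omega>] by metis
  have "AE x in lebesgue. \<forall>X\<in>\<D>. x \<in> X \<longrightarrow> w x = 0"
  proof (rule AE_ball_countable[OF \<D>(1), THEN iffD2], rule ballI)
    fix X assume X: "X \<in> \<D>"
    then obtain a b where "X = cbox a b" using \<D>(3) by blast
    then show "AE x in lebesgue. x \<in> X \<longrightarrow> w x = 0" using cb \<D>(2) X by auto
  qed
  then show ?thesis by eventually_elim (use \<D>(4) in auto)
qed

subsection \<open>Compactness\<close>

lemma shift_increment_dir:
  assumes \<phi>: "\<phi> \<in> test_functions UNIV"
  shows "norm (shift h (cls \<phi>) - cls \<phi>) \<le> norm (cls (vf_deriv (\<lambda>_. h) \<phi>))"
proof -
  define \<psi> where "\<psi> = shift h (cls \<phi>) - cls \<phi>"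
  have "((\<lambda>s. shift (s *\<^sub>R h) (cls \<phi>) \<bullet> \<psi>) has_real_derivative
      shift (s *\<^sub>R h) (cls (vf_deriv (\<lambda>_. h) \<phi>)) \<bullet> \<psi>) (at s)" for s
    unfolding has_real_derivative_iff_has_vector_derivative
    by (rule bounded_linear.has_vector_derivative[OF bounded_linear_inner_left
            shift_has_vector_derivative[OF \<phi>]])
  from mvt_from_0[OF this] obtain s where
    s: "shift (1 *\<^sub>R h) (cls \<phi>) \<bullet> \<psi> - shift (0 *\<^sub>R h) (cls \<phi>) \<bullet> \<psi>
      = 1 * (shift (s *\<^sub>R h) (cls (vf_deriv (\<lambda>_. h) \<phi>)) \<bullet> \<psi>)"
    by metis
  then have "\<psi> \<bullet> \<psi> = shift (s *\<^sub>R h) (cls (vf_deriv (\<lambda>_. h) \<phi>)) \<bullet> \<psi>"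
    unfolding \<psi>_def by (simp add: inner_diff_left shift_zero)
  also have "\<dots> \<le> norm (shift (s *\<^sub>R h) (cls (vf_deriv (\<lambda>_. h) \<phi>))) * norm \<psi>" by (rule norm_cauchy_schwarz)
  also have "norm (shift (s *\<^sub>R h) (cls (vf_deriv (\<lambda>_. h) \<phi>))) = norm (cls (vf_deriv (\<lambda>_. h) \<phi>))"
    by (simp add: norm_eq_sqrt_inner inner_shift)
  finally have "norm \<psi> * norm \<psi> \<le> norm (cls (vf_deriv (\<lambda>_. h) \<phi>)) * norm \<psi>"
    by (simp add: power2_norm_eq_inner flip: power2_eq_square)
  then show ?thesis unfolding \<psi>_def[symmetric]
    by (metis mult_right_le_imp_le norm_ge_zero order_le_less)
qed

lemma shift_increment_square:
  fixes \<phi> :: "'a::euclidean_space \<Rightarrow> real"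
  assumes \<phi>: "\<phi> \<in> test_functions UNIV" and h: "\<And>b. b \<in> Basis \<Longrightarrow> \<bar>h \<bullet> b\<bar> \<le> s"
  shows "(norm (shift h (cls \<phi>) - cls \<phi>))\<^sup>2
    \<le> s\<^sup>2 * real DIM('a) * (\<Sum>b\<in>Basis. (norm (cls (vf_deriv (\<lambda>_. b) \<phi>)))\<^sup>2)"
proof -
  note d = sqint_test_functions[OF test_functions_dir_deriv[OF \<phi>]]
  have "s \<ge> 0" using h nonempty_Basis by (metis abs_ge_zero all_not_in_conv order_trans)
  have "cls (\<lambda>z. \<Sum>b\<in>B. (h \<bullet> b) * vf_deriv (\<lambda>_. b) \<phi> z) = (\<Sum>b\<in>B. (h \<bullet> b) *\<^sub>R cls (vf_deriv (\<lambda>_. b) \<phi>))"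
    if "finite B" for B
    using that
  proof (induction B)
    case (insert b B)
    have "sqint (\<lambda>z. \<Sum>b\<in>B. (h \<bullet> b) * vf_deriv (\<lambda>_. b) \<phi> z)"
      by (rule sqint_test_functions[where \<Omega>=UNIV])
        (intro test_functions_sum test_functions_cmult test_functions_dir_deriv \<phi>)
    then show ?case using insert by (simp add: cls_add cls_cmult sqint_cmult d)
  qed (simp add: cls_zero)
  then have eq: "cls (vf_deriv (\<lambda>_. h) \<phi>) = (\<Sum>b\<in>Basis. (h \<bullet> b) *\<^sub>R cls (vf_deriv (\<lambda>_. b) \<phi>))"
    unfolding vf_deriv_expand[OF test_functions_smooth[OF \<phi>], of "\<lambda>_. h", abs_def] by simp
  have "norm (cls (vf_deriv (\<lambda>_. h) \<phi>)) \<le> (\<Sum>b\<in>Basis. norm ((h \<bullet> b) *\<^sub>R cls (vf_deriv (\<lambda>_. b) \<phi>)))"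
    unfolding eq by (rule norm_sum)
  also have "\<dots> \<le> (\<Sum>b\<in>Basis. s * norm (cls (vf_deriv (\<lambda>_. b) \<phi>)))"
    using h by (auto intro!: sum_mono mult_right_mono)
  finally have "norm (shift h (cls \<phi>) - cls \<phi>) \<le> s * (\<Sum>b\<in>Basis. norm (cls (vf_deriv (\<lambda>_. b) \<phi>)))"
    using shift_increment_dir[OF \<phi>, of h] by (simp add: sum_distrib_left)
  then have "(norm (shift h (cls \<phi>) - cls \<phi>))\<^sup>2 \<le> (s * (\<Sum>b\<in>Basis. norm (cls (vf_deriv (\<lambda>_. b) \<phi>))))\<^sup>2"
    by (rule power_mono) simp
  also have "\<dots> = s\<^sup>2 * (\<Sum>b\<in>Basis. norm (cls (vf_deriv (\<lambda>_. b) \<phi>)))\<^sup>2" by (simp add: power_mult_distrib)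
  also have "\<dots> \<le> s\<^sup>2 * ((\<Sum>b\<in>Basis. (norm (cls (vf_deriv (\<lambda>_. b) \<phi>)))\<^sup>2) * real DIM('a))"
    by (intro mult_left_mono sum_squared_le_sum_of_squares) auto
  finally show ?thesis by (simp add: mult_ac)
qed

section \<open>Cubical grids and Rellich's theorem\<close>

text \<open>A label for the half-open cube of side \<open>s\<close> that contains \<open>z\<close>:
  its lower corner in units of \<open>s\<close>.\<close>

definition grid :: "real \<Rightarrow> 'a::euclidean_space \<Rightarrow> 'a" where
  "grid s z = (\<Sum>b\<in>Basis. of_int \<lfloor>(z \<bullet> b) / s\<rfloor> *\<^sub>R b)"

lemma grid_inner: "b \<in> Basis \<Longrightarrow> grid s z \<bullet> b = of_int \<lfloor>(z \<bullet> b) / s\<rfloor>"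
  by (simp add: grid_def inner_sum_left inner_Basis if_distrib cong: if_cong)

lemma grid_measurable [measurable]: "grid s \<in> borel_measurable borel"
  unfolding grid_def[abs_def] by measurable

lemma grid_close:
  assumes "s > 0" "grid s z = grid s w" "b \<in> Basis"
  shows "\<bar>(w - z) \<bullet> b\<bar> \<le> s"
proof -
  have "\<lfloor>(z \<bullet> b) / s\<rfloor> = \<lfloor>(w \<bullet> b) / s\<rfloor>" using assms(2,3) grid_inner[of b s] by (metis of_int_eq_iff)
  then have "\<bar>(w \<bullet> b) / s - (z \<bullet> b) / s\<bar> < 1" by linarith
  then have "\<bar>(w - z) \<bullet> b / s\<bar> < 1" by (simp add: inner_diff_left diff_divide_distrib)
  then show ?thesis using assms(1) by (simp add: abs_divide field_simps)
qed

lemma finite_grid_image: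
  assumes "bounded \<Omega>" "s > 0"
  shows "finite (grid s ` \<Omega>)"
proof -
  obtain B where B: "\<And>z. z \<in> \<Omega> \<Longrightarrow> norm z \<le> B" using assms(1) by (auto simp: bounded_iff)
  let ?N = "\<lceil>B / s\<rceil> + 1"
  let ?F = "(\<lambda>f. \<Sum>b\<in>Basis. of_int (f b) *\<^sub>R b) ` (Basis \<rightarrow>\<^sub>E {- ?N..?N})"
  have "grid s z \<in> ?F" if "z \<in> \<Omega>" for z
  proof (rule image_eqI[of _ _ "\<lambda>b\<in>Basis. \<lfloor>(z \<bullet> b) / s\<rfloor>"])
    show "grid s z = (\<Sum>b\<in>Basis. of_int ((\<lambda>b\<in>Basis. \<lfloor>(z \<bullet> b) / s\<rfloor>) b) *\<^sub>R b)" by (simp add: grid_def)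
    have "\<lfloor>(z \<bullet> b) / s\<rfloor> \<in> {- ?N..?N}" if "b \<in> Basis" for b
    proof -
      have "\<bar>z \<bullet> b\<bar> \<le> B" using Basis_le_norm[OF that, of z] B[OF \<open>z \<in> \<Omega>\<close>] by linarith
      then have "\<bar>(z \<bullet> b) / s\<bar> \<le> B / s" using assms(2) by (simp add: abs_divide divide_right_mono)
      then show ?thesis unfolding atLeastAtMost_iff by linarith
    qed
    then show "(\<lambda>b\<in>Basis. \<lfloor>(z \<bullet> b) / s\<rfloor>) \<in> Basis \<rightarrow>\<^sub>E {- ?N..?N}" by auto
  qed
  then have "grid s ` \<Omega> \<subseteq> ?F" by blast
  then show ?thesis by (rule finite_subset) (intro finite_imageI finite_PiE; simp)
qed

lemma emeasure_grid_cell: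
  fixes k :: "'a::euclidean_space"
  assumes s: "s > 0" and k: "k \<in> range (grid s)"
  shows "emeasure lborel {z. grid s z = k} = ennreal (s ^ DIM('a))"
proof -
  obtain z0 where z0: "k = grid s z0" using k by auto
  have cell: "grid s z = k \<longleftrightarrow> (\<forall>b\<in>Basis. k \<bullet> b * s \<le> z \<bullet> b \<and> z \<bullet> b < (k \<bullet> b + 1) * s)" for z
  proof -
    have "grid s z = k \<longleftrightarrow> (\<forall>b\<in>Basis. \<lfloor>(z \<bullet> b) / s\<rfloor> = \<lfloor>(z0 \<bullet> b) / s\<rfloor>)"
      unfolding z0 euclidean_eq_iff[where 'a='a] by (auto simp: grid_inner)
    also have "\<dots> \<longleftrightarrow> (\<forall>b\<in>Basis. k \<bullet> b * s \<le> z \<bullet> b \<and> z \<bullet> b < (k \<bullet> b + 1) * s)"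
      using s unfolding z0 by (intro ball_cong refl) (simp add: grid_inner floor_eq_iff field_simps)
    finally show ?thesis .
  qed
  let ?l = "s *\<^sub>R k" and ?u = "s *\<^sub>R k + s *\<^sub>R One"
  have sub: "box ?l ?u \<subseteq> {z. grid s z = k}" "{z. grid s z = k} \<subseteq> cbox ?l ?u"
    unfolding cell by (auto simp: mem_box inner_simps algebra_simps less_imp_le)
  have "emeasure lborel (box ?l ?u) = ennreal (s ^ DIM('a))" "emeasure lborel (cbox ?l ?u) = ennreal (s ^ DIM('a))"
    using s by (simp_all add: emeasure_lborel_box emeasure_lborel_cbox inner_simps)
  moreover have "{z. grid s z = k} \<in> sets borel" by measurable
  ultimately show ?thesis
    using emeasure_mono[OF sub(1), of lborel] emeasure_mono[OF sub(2), of lborel] by (intro antisym) auto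
qed

text \<open>The oscillation of \<open>\<phi>\<close> inside a cell only involves translates by at most one cell width.\<close>

lemma grid_poincare:
  fixes \<phi> :: "'a::euclidean_space \<Rightarrow> real"
  assumes s: "s > 0" and bd: "bounded \<Omega>" and \<phi>: "\<phi> \<in> test_functions \<Omega>"
  shows "(norm (cls \<phi>))\<^sup>2 \<le> (\<Sum>k\<in>grid s ` \<Omega>. (cls \<phi> \<bullet> cls (indicator {z. grid s z = k}))\<^sup>2) / s ^ DIM('a)
    + 2 ^ DIM('a) * (s\<^sup>2 * real DIM('a) * (\<Sum>b\<in>Basis. (norm (cls (vf_deriv (\<lambda>_. b) \<phi>)))\<^sup>2))"
proof -
  define m where "m = s ^ DIM('a)"
  define K where "K = grid s ` \<Omega>"
  define Q where "Q = (\<lambda>k. {z. grid s z = k} :: 'a set)"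
  define G where "G = s\<^sup>2 * real DIM('a) * (\<Sum>b\<in>Basis. (norm (cls (vf_deriv (\<lambda>_. b) \<phi>)))\<^sup>2)"
  have m: "m > 0" using s by (simp add: m_def)
  have finK: "finite K" unfolding K_def by (rule finite_grid_image[OF bd s])
  have [measurable]: "\<phi> \<in> borel_measurable borel" by (rule test_functions_measurable[OF \<phi>])
  have [measurable]: "Q k \<in> sets borel" for k unfolding Q_def by measurable
  have Qm: "emeasure lborel (Q k) = ennreal m" if "k \<in> K" for k
    unfolding Q_def m_def by (rule emeasure_grid_cell[OF s]) (use that in \<open>auto simp: K_def\<close>)
  have sq: "sqint \<phi>" by (rule sqint_test_functions[OF \<phi>])
  have indm: "(indicator (Q k) :: 'a \<Rightarrow> real) \<in> borel_measurable lebesgue" for k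
    by (rule measurable_completion) simp
  have ind: "sqint (indicator (Q k) :: 'a \<Rightarrow> real)" if "k \<in> K" for k
  proof -
    have "(\<lambda>x. (indicator (Q k) x)\<^sup>2) = (indicator (Q k) :: 'a \<Rightarrow> real)" by (auto simp: indicator_def)
    moreover have "integrable lborel (indicator (Q k) :: 'a \<Rightarrow> real)"
      using Qm[OF that] by (simp add: integrable_indicator_iff)
    ultimately show ?thesis using indm by (simp add: sqint_def integrable_completion)
  qed
  have int0: "integrable lborel (\<lambda>z. indicator (Q k) z * 1 :: real)" if "k \<in> K" for k
    using Qm[OF that] by (simp add: integrable_indicator_iff)
  have int2: "integrable lborel (\<lambda>z. indicator (Q k) z * (\<phi> z)\<^sup>2)" for k
  proof -
    have "integrable lborel (\<lambda>z. (\<phi> z)\<^sup>2)" using sq by (simp add: sqint_def integrable_completion)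
    then show ?thesis by (rule Bochner_Integration.integrable_bound) (auto simp: indicator_def)
  qed
  have int1: "integrable lborel (\<lambda>z. indicator (Q k) z * \<phi> z)" for k
  proof -
    have "integrable lborel \<phi>" using test_functions_integrable[OF \<phi>] by (simp add: integrable_completion)
    then show ?thesis by (rule Bochner_Integration.integrable_bound) (auto simp: indicator_def)
  qed
  define I1 I2 where "I1 = (\<lambda>k. \<integral>z. indicator (Q k) z * \<phi> z \<partial>lborel)"
    and "I2 = (\<lambda>k. \<integral>z. indicator (Q k) z * (\<phi> z)\<^sup>2 \<partial>lborel)"
  have I1': "(\<integral>z. indicator (Q k) z * \<phi> z \<partial>lborel) = I1 k"
    and I2': "(\<integral>z. indicator (Q k) z * (\<phi> z)\<^sup>2 \<partial>lborel) = I2 k" for k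
    by (simp_all add: I1_def I2_def)
  have I0: "(\<integral>z. indicator (Q k) z * 1 \<partial>lborel) = m" if "k \<in> K" for k
    using Qm[OF that] m by (simp add: measure_def)
  have I1_eq: "I1 k = cls \<phi> \<bullet> cls (indicator (Q k))" if "k \<in> K" for k
    unfolding I1_def inner_cls[OF sq ind[OF that]] by (subst integral_completion) (simp_all add: mult.commute)
  \<comment> \<open>A general quadratic polynomial in \<open>\<phi>\<close> on one cell; with
    suitable coefficients it serves for the inner integral, the outer integral and the positivity of
    both.\<close>
  let ?q = "\<lambda>k c d e z. c * (indicator (Q k) z * (\<phi> z)\<^sup>2) - d * (indicator (Q k) z * \<phi> z) + e * (indicator (Q k) z * 1)"
  have q_int: "integrable lborel (?q k c d e)" if k: "k \<in> K" for k c d e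
    by (intro Bochner_Integration.integrable_add Bochner_Integration.integrable_diff integrable_mult_right int0[OF k] int1 int2)
  have q_eq: "(\<integral>z. ?q k c d e z \<partial>lborel) = c * I2 k - d * I1 k + e * m" if k: "k \<in> K" for k c d e
    by (subst Bochner_Integration.integral_add Bochner_Integration.integral_diff;
        (intro Bochner_Integration.integrable_diff integrable_mult_right int0[OF k] int1 int2)?)+
      (simp only: integral_mult_right_zero I0[OF k] I1' I2')
  have var: "0 \<le> 1 * I2 k - (2 * t) * I1 k + t\<^sup>2 * m" if k: "k \<in> K" for k t
  proof -
    have "?q k 1 (2 * t) (t\<^sup>2) z = indicator (Q k) z * (\<phi> z - t)\<^sup>2" for z by (simp add: power2_diff algebra_simps)
    then have "0 \<le> (\<integral>z. ?q k 1 (2 * t) (t\<^sup>2) z \<partial>lborel)" by (intro integral_nonneg_AE AE_I2) simp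
    then show ?thesis unfolding q_eq[OF k] .
  qed
  \<comment> \<open>The variance of \<open>\<phi>\<close> on a cell, written as a double integral of
    squared differences; \<open>I1\<close> and \<open>I2\<close> are the first two moments.\<close>
  have cell: "(\<integral>\<^sup>+z. \<integral>\<^sup>+w. ennreal (indicator (Q k) z * (indicator (Q k) w * (\<phi> w - \<phi> z)\<^sup>2)) \<partial>lborel \<partial>lborel)
      = ennreal (2 * m * I2 k - 2 * (I1 k)\<^sup>2)" if k: "k \<in> K" for k
  proof -
    have inner: "(\<integral>\<^sup>+w. ennreal (indicator (Q k) z * (indicator (Q k) w * (\<phi> w - \<phi> z)\<^sup>2)) \<partial>lborel)
       = ennreal (?q k m (2 * I1 k) (I2 k) z)" for z
    proof -
      let ?r = "?q k (indicator (Q k) z) (2 * indicator (Q k) z * \<phi> z) (indicator (Q k) z * (\<phi> z)\<^sup>2)"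
      have eq: "indicator (Q k) z * (indicator (Q k) w * (\<phi> w - \<phi> z)\<^sup>2) = ?r w" for w
        by (simp add: power2_diff algebra_simps)
      have "0 \<le> ?r w" for w by (subst eq[symmetric]) simp
      then have "(\<integral>\<^sup>+w. ennreal (?r w) \<partial>lborel) = ennreal (\<integral>w. ?r w \<partial>lborel)"
        by (intro nn_integral_eq_integral q_int k AE_I2)
      then have "(\<integral>\<^sup>+w. ennreal (indicator (Q k) z * (indicator (Q k) w * (\<phi> w - \<phi> z)\<^sup>2)) \<partial>lborel)
        = ennreal (\<integral>w. ?r w \<partial>lborel)"
        by (simp only: eq)
      then show ?thesis unfolding q_eq[OF k] by (simp add: algebra_simps)
    qed
    have "0 \<le> ?q k m (2 * I1 k) (I2 k) z" for z
      using var[OF k, of "\<phi> z"] by (cases "z \<in> Q k") (auto simp: algebra_simps)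
    then have "(\<integral>\<^sup>+z. ennreal (?q k m (2 * I1 k) (I2 k) z) \<partial>lborel) = ennreal (\<integral>z. ?q k m (2 * I1 k) (I2 k) z \<partial>lborel)"
      by (intro nn_integral_eq_integral q_int k AE_I2)
    then show ?thesis unfolding inner q_eq[OF k] by (simp add: power2_eq_square algebra_simps)
  qed
  have var': "0 \<le> 2 * m * I2 k - 2 * (I1 k)\<^sup>2" if k: "k \<in> K" for k
    using var[OF k, of "I1 k / m"] m by (simp add: field_simps power2_eq_square)
  \<comment> \<open>The cube of all differences of two points in a common cell. Its volume is the
    origin of the factor \<open>2 ^ DIM('a)\<close>.\<close>
  define B where "B = cbox (- (s *\<^sub>R One)) (s *\<^sub>R One :: 'a)"
  have B_iff: "h \<in> B \<longleftrightarrow> (\<forall>b\<in>Basis. \<bar>h \<bullet> b\<bar> \<le> s)" for h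
    unfolding B_def mem_box by (intro ball_cong refl) (auto simp: abs_le_iff)
  have [measurable]: "B \<in> sets borel" by (simp add: B_def)
  have Bm: "emeasure lborel B = ennreal (2 ^ DIM('a) * m)"
  proof -
    have "(s *\<^sub>R One - - (s *\<^sub>R One)) \<bullet> b = 2 * s" if "b \<in> Basis" for b :: 'a
      using that by (simp add: inner_add_left)
    then have "emeasure lborel B = ennreal (\<Prod>b\<in>(Basis :: 'a set). 2 * s)"
      unfolding B_def using s by (subst emeasure_lborel_cbox) (auto simp: inner_diff_left)
    then show ?thesis by (simp add: m_def power_mult_distrib)
  qed
  have "ennreal (\<Sum>k\<in>K. 2 * m * I2 k - 2 * (I1 k)\<^sup>2) = (\<Sum>k\<in>K. ennreal (2 * m * I2 k - 2 * (I1 k)\<^sup>2))"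
    by (rule sum_ennreal[symmetric]) (rule var')
  also have "\<dots> = (\<Sum>k\<in>K. \<integral>\<^sup>+z. \<integral>\<^sup>+w. ennreal (indicator (Q k) z * (indicator (Q k) w * (\<phi> w - \<phi> z)\<^sup>2)) \<partial>lborel \<partial>lborel)"
    by (intro sum.cong refl) (simp add: cell)
  also have "\<dots> = (\<integral>\<^sup>+z. \<integral>\<^sup>+w. (\<Sum>k\<in>K. ennreal (indicator (Q k) z * (indicator (Q k) w * (\<phi> w - \<phi> z)\<^sup>2))) \<partial>lborel \<partial>lborel)"
  proof -
    let ?f = "\<lambda>k z w. ennreal (indicator (Q k) z * (indicator (Q k) w * (\<phi> w - \<phi> z)\<^sup>2))"
    have "(\<Sum>k\<in>K. \<integral>\<^sup>+z. \<integral>\<^sup>+w. ?f k z w \<partial>lborel \<partial>lborel) = (\<integral>\<^sup>+z. (\<Sum>k\<in>K. \<integral>\<^sup>+w. ?f k z w \<partial>lborel) \<partial>lborel)"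
      by (rule nn_integral_sum[symmetric]) measurable
    also have "\<dots> = (\<integral>\<^sup>+z. \<integral>\<^sup>+w. (\<Sum>k\<in>K. ?f k z w) \<partial>lborel \<partial>lborel)"
      by (rule nn_integral_cong, rule nn_integral_sum[symmetric]) measurable
    finally show ?thesis .
  qed
  also have "\<dots> \<le> (\<integral>\<^sup>+z. \<integral>\<^sup>+w. indicator B (w - z) * ennreal ((\<phi> w - \<phi> z)\<^sup>2) \<partial>lborel \<partial>lborel)"
  proof (intro nn_integral_mono)
    fix z w :: 'a
    show "(\<Sum>k\<in>K. ennreal (indicator (Q k) z * (indicator (Q k) w * (\<phi> w - \<phi> z)\<^sup>2))) \<le> indicator B (w - z) * ennreal ((\<phi> w - \<phi> z)\<^sup>2)"
    proof (cases "grid s z = grid s w")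
      case True
      have "w - z \<in> B" unfolding B_iff using grid_close[OF s True] by blast
      moreover have "(\<Sum>k\<in>K. ennreal (indicator (Q k) z * (indicator (Q k) w * (\<phi> w - \<phi> z)\<^sup>2)))
          = (\<Sum>k\<in>K. if k = grid s z then ennreal ((\<phi> w - \<phi> z)\<^sup>2) else 0)"
        by (intro sum.cong refl) (auto simp: Q_def True)
      ultimately show ?thesis using finK by simp
    next
      case False
      then have "(\<Sum>k\<in>K. ennreal (indicator (Q k) z * (indicator (Q k) w * (\<phi> w - \<phi> z)\<^sup>2))) = 0"
        by (intro sum.neutral ballI) (auto simp: Q_def indicator_def)
      then show ?thesis by simp
    qed
  qed
  also have "\<dots> = (\<integral>\<^sup>+z. \<integral>\<^sup>+h. indicator B h * ennreal ((\<phi> (z + h) - \<phi> z)\<^sup>2) \<partial>lborel \<partial>lborel)"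
  proof (rule nn_integral_cong)
    fix z
    have "(\<integral>\<^sup>+w. indicator B (w - z) * ennreal ((\<phi> w - \<phi> z)\<^sup>2) \<partial>lborel)
      = (\<integral>\<^sup>+w. indicator B (w - z) * ennreal ((\<phi> w - \<phi> z)\<^sup>2) \<partial>distr lborel borel ((+) z))"
      by (simp only: lborel_distr_plus)
    also have "\<dots> = (\<integral>\<^sup>+h. indicator B h * ennreal ((\<phi> (z + h) - \<phi> z)\<^sup>2) \<partial>lborel)"
      by (subst nn_integral_distr) auto
    finally show "(\<integral>\<^sup>+w. indicator B (w - z) * ennreal ((\<phi> w - \<phi> z)\<^sup>2) \<partial>lborel)
      = (\<integral>\<^sup>+h. indicator B h * ennreal ((\<phi> (z + h) - \<phi> z)\<^sup>2) \<partial>lborel)" .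
  qed
  also have "\<dots> = (\<integral>\<^sup>+h. \<integral>\<^sup>+z. indicator B h * ennreal ((\<phi> (z + h) - \<phi> z)\<^sup>2) \<partial>lborel \<partial>lborel)"
    by (rule lborel_pair.Fubini') measurable
  \<comment> \<open>After the substitution \<open>w = z + h\<close> and Fubini, the inner integral
    is the squared norm of the increment of \<open>\<phi>\<close> under translation by
    \<open>h\<close>.\<close>
  also have "\<dots> \<le> (\<integral>\<^sup>+h. indicator B h * ennreal G \<partial>lborel)"
  proof (rule nn_integral_mono)
    fix h :: 'a
    have "(\<integral>\<^sup>+z. ennreal ((\<phi> (z + h) - \<phi> z)\<^sup>2) \<partial>lborel) = ennreal ((norm (shift h (cls \<phi>) - cls \<phi>))\<^sup>2)"
      using nn_integral_cls[OF sqint_diff[OF sqint_shift[OF sq, of h] sq]]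
      by (simp add: cls_diff cls_shift sqint_shift sq nn_integral_completion)
    moreover have "(norm (shift h (cls \<phi>) - cls \<phi>))\<^sup>2 \<le> G" if "h \<in> B"
      unfolding G_def
      by (rule shift_increment_square[OF test_functions_UNIV[OF \<phi>]])
        (use that B_iff in blast)
    ultimately show "(\<integral>\<^sup>+z. indicator B h * ennreal ((\<phi> (z + h) - \<phi> z)\<^sup>2) \<partial>lborel) \<le> indicator B h * ennreal G"
      by (cases "h \<in> B") (auto intro: ennreal_leI)
  qed
  also have "\<dots> = ennreal (2 ^ DIM('a) * m) * ennreal G"
    by (simp add: nn_integral_multc Bm)
  also have "\<dots> = ennreal (2 ^ DIM('a) * m * G)"
    using m by (simp add: ennreal_mult' G_def sum_nonneg)
  finally have "(\<Sum>k\<in>K. 2 * m * I2 k - 2 * (I1 k)\<^sup>2) \<le> 2 ^ DIM('a) * m * G"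
    using m by (subst (asm) ennreal_le_iff) (auto simp: G_def intro!: mult_nonneg_nonneg sum_nonneg)
  moreover have "0 \<le> 2 ^ DIM('a) * m * G"
    using m unfolding G_def by (intro mult_nonneg_nonneg sum_nonneg) auto
  moreover have "(\<Sum>k\<in>K. 2 * m * I2 k - 2 * (I1 k)\<^sup>2) = 2 * (m * (\<Sum>k\<in>K. I2 k)) - 2 * (\<Sum>k\<in>K. (I1 k)\<^sup>2)"
    by (simp add: sum_subtractf sum_distrib_left mult.assoc)
  \<comment> \<open>Halving would even give \<open>G\<close> the factor 1/2, which is given away
    here.\<close>
  ultimately have le: "m * (\<Sum>k\<in>K. I2 k) \<le> (\<Sum>k\<in>K. (I1 k)\<^sup>2) + 2 ^ DIM('a) * m * G"
    by linarith
  have tot: "(norm (cls \<phi>))\<^sup>2 = (\<Sum>k\<in>K. I2 k)"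
  proof -
    have "(norm (cls \<phi>))\<^sup>2 = (\<integral>z. (\<phi> z)\<^sup>2 \<partial>lborel)"
      unfolding norm_cls[OF sq] by (rule integral_completion) measurable
    also have "\<dots> = (\<integral>z. (\<Sum>k\<in>K. indicator (Q k) z * (\<phi> z)\<^sup>2) \<partial>lborel)"
    proof (rule Bochner_Integration.integral_cong)
      fix z :: 'a
      have "(\<Sum>k\<in>K. indicator (Q k) z * (\<phi> z)\<^sup>2) = (\<Sum>k\<in>K. if k = grid s z then (\<phi> z)\<^sup>2 else 0)"
        by (intro sum.cong refl) (auto simp: Q_def)
      also have "\<dots> = (\<phi> z)\<^sup>2"
        using finK test_functions_eq_0[OF \<phi>, of z] by (auto simp: K_def)
      finally show "(\<phi> z)\<^sup>2 = (\<Sum>k\<in>K. indicator (Q k) z * (\<phi> z)\<^sup>2)" by simp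
    qed simp
    also have "\<dots> = (\<Sum>k\<in>K. I2 k)" unfolding I2_def by (rule Bochner_Integration.integral_sum) (rule int2)
    finally show ?thesis .
  qed
  have "(norm (cls \<phi>))\<^sup>2 \<le> (\<Sum>k\<in>K. (I1 k)\<^sup>2) / m + 2 ^ DIM('a) * G"
    using le m unfolding tot by (simp add: field_simps)
  also have "(\<Sum>k\<in>K. (I1 k)\<^sup>2) = (\<Sum>k\<in>K. (cls \<phi> \<bullet> cls (indicator (Q k)))\<^sup>2)"
    by (intro sum.cong refl) (simp add: I1_eq)
  finally show ?thesis unfolding m_def G_def K_def Q_def .
qed

text \<open>Rellich's theorem in quantitative form: up to a small multiple of the Dirichlet
  integral, finitely many averages control the norm. The mesh \<open>s\<close> makes the constant
  \<open>2^d d s^2\<close> of \<open>grid_poincare\<close> (with \<open>d\<close> the dimension)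
  equal to \<open>\<epsilon>\<close>, and \<open>F\<close> consists of normalised indicators of
  cells.\<close>

lemma rellich:
  fixes \<Omega> :: "'a::euclidean_space set"
  assumes "bounded \<Omega>" "\<epsilon> > 0"
  obtains K :: "'a set" and F where "finite K" "\<And>\<phi>. \<phi> \<in> test_functions \<Omega> \<Longrightarrow>
    (norm (cls \<phi>))\<^sup>2 \<le> \<epsilon> * (\<Sum>b\<in>Basis. (norm (cls (vf_deriv (\<lambda>_. b) \<phi>)))\<^sup>2) + (\<Sum>k\<in>K. (cls \<phi> \<bullet> F k)\<^sup>2)"
proof -
  define A where "A = (2 ^ DIM('a) * real DIM('a) :: real)"
  have A: "A > 0" by (simp add: A_def)
  define s where "s = sqrt (\<epsilon> / A)"
  have s: "s > 0" "A * s\<^sup>2 = \<epsilon>" using assms(2) A by (simp_all add: s_def)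
  define F where "F = (\<lambda>k. (1 / sqrt (s ^ DIM('a))) *\<^sub>R cls (indicator {z :: 'a. grid s z = k}))"
  show thesis
  proof (rule that[of "grid s ` \<Omega>" F])
    show "finite (grid s ` \<Omega>)" by (rule finite_grid_image[OF assms(1) s(1)])
    fix \<phi> :: "'a \<Rightarrow> real" assume \<phi>: "\<phi> \<in> test_functions \<Omega>"
    have F: "(\<Sum>k\<in>grid s ` \<Omega>. (cls \<phi> \<bullet> F k)\<^sup>2)
        = (\<Sum>k\<in>grid s ` \<Omega>. (cls \<phi> \<bullet> cls (indicator {z. grid s z = k}))\<^sup>2) / s ^ DIM('a)"
      using s(1) by (simp add: F_def power_divide sum_divide_distrib)
    have \<epsilon>: "2 ^ DIM('a) * (s\<^sup>2 * real DIM('a) * S) = \<epsilon> * S" for S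
      unfolding s(2)[symmetric] A_def by simp
    show "(norm (cls \<phi>))\<^sup>2 \<le> \<epsilon> * (\<Sum>b\<in>Basis. (norm (cls (vf_deriv (\<lambda>_. b) \<phi>)))\<^sup>2)
        + (\<Sum>k\<in>grid s ` \<Omega>. (cls \<phi> \<bullet> F k)\<^sup>2)"
      using grid_poincare[OF s(1) assms(1) \<phi>] unfolding F \<epsilon> by linarith
  qed
qed

subsection \<open>The closed graph of the sub-Laplacian\<close>

lemma norm_cls_mult_le:
  assumes f: "sqint f" and gf: "sqint (\<lambda>z. g z * f z)" and R: "\<And>z. f z \<noteq> 0 \<Longrightarrow> \<bar>g z\<bar> \<le> R" "R \<ge> 0"
  shows "norm (cls (\<lambda>z. g z * f z)) \<le> R * norm (cls f)"
proof -
  have "(norm (cls (\<lambda>z. g z * f z)))\<^sup>2 = (\<integral>z. (g z * f z)\<^sup>2 \<partial>lebesgue)" by (rule norm_cls[OF gf])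
  also have "\<dots> \<le> (\<integral>z. R\<^sup>2 * (f z)\<^sup>2 \<partial>lebesgue)"
  proof (rule integral_mono)
    show "integrable lebesgue (\<lambda>z. (g z * f z)\<^sup>2)" "integrable lebesgue (\<lambda>z. R\<^sup>2 * (f z)\<^sup>2)"
      using f gf by (auto simp: sqint_def)
    show "(g z * f z)\<^sup>2 \<le> R\<^sup>2 * (f z)\<^sup>2" for z
    proof (cases "f z = 0")
      case False
      have "\<bar>g z\<bar>\<^sup>2 \<le> R\<^sup>2" using R(1)[OF False] by (intro power_mono) auto
      then show ?thesis by (simp add: power_mult_distrib mult_right_mono)
    qed simp
  qed
  also have "\<dots> = (R * norm (cls f))\<^sup>2" by (simp add: norm_cls[OF f] power_mult_distrib)
  finally show ?thesis by (rule power2_le_imp_le) (simp add: R(2))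
qed

lemma Cauchy_if_norm_square_le_product:
  fixes x y z :: "nat \<Rightarrow> 'h::real_normed_vector"
  assumes "Cauchy y" "Cauchy z" "c \<ge> 0"
    and le: "\<And>m l. (norm (x m - x l))\<^sup>2 \<le> c * (norm (y m - y l) * norm (z m - z l))"
  shows "Cauchy x"
proof (rule CauchyI)
  fix e :: real assume e: "e > 0"
  define d where "d = e / sqrt (c + 1)"
  have d: "d > 0" "(c + 1) * (d * d) = e\<^sup>2" using e assms(3) by (simp_all add: d_def power2_eq_square)
  obtain M where M: "\<And>m l. m \<ge> M \<Longrightarrow> l \<ge> M \<Longrightarrow> norm (y m - y l) < d" using CauchyD[OF assms(1) d(1)] by blast
  obtain N where N: "\<And>m l. m \<ge> N \<Longrightarrow> l \<ge> N \<Longrightarrow> norm (z m - z l) < d" using CauchyD[OF assms(2) d(1)] by blast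
  have "norm (x m - x l) < e" if "m \<ge> max M N" "l \<ge> max M N" for m l
  proof -
    have "norm (y m - y l) * norm (z m - z l) \<le> d * d"
      using M[of m l] N[of m l] that d by (intro mult_mono) auto
    then have "(norm (x m - x l))\<^sup>2 \<le> c * (d * d)"
      using le[of m l] mult_left_mono[OF _ assms(3)] by fastforce
    also have "\<dots> < (c + 1) * (d * d)" using d(1) by simp
    finally have "(norm (x m - x l))\<^sup>2 < e\<^sup>2" using d(2) by simp
    then show ?thesis by (rule power2_less_imp_less) (use e in simp)
  qed
  then show "\<exists>M. \<forall>m\<ge>M. \<forall>n\<ge>M. norm (x m - x n) < e" by blast
qed

text \<open>Orthonormality makes \<open>z \<bullet> E i\<close> a coordinate with derivative 1 along
  \<open>D i\<close> and 0 along the other fields; \<open>Basis_frame\<close> recovers all Euclidean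
  partial derivatives from \<open>T\<close> and the \<open>D i\<close>.\<close>

locale orthonormal_frame = step_two_frame \<tau> I E C
  for \<tau> :: "'a::euclidean_space" and I :: "'i set" and E C +
  fixes \<Omega> :: "'a set"
  assumes open_\<Omega>: "open \<Omega>" and bounded_\<Omega>: "bounded \<Omega>"
    and E_inner: "i \<in> I \<Longrightarrow> j \<in> I \<Longrightarrow> E i \<bullet> E j = (if i = j then 1 else 0)"
    and \<tau>_E: "i \<in> I \<Longrightarrow> \<tau> \<bullet> E i = 0"
    and Basis_frame: "b \<in> Basis \<Longrightarrow> b = \<tau> \<or> b \<in> E ` I"
begin

abbreviation TF :: "('a \<Rightarrow> real) set" where "TF \<equiv> test_functions \<Omega>"

lemmas TF_sqint = sqint_test_functions[where \<Omega>=\<Omega>]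
lemmas TF_U = test_functions_UNIV[where \<Omega>=\<Omega>]

definition lap_core :: "('a l2 \<times> 'a l2) set" where
  "lap_core = (\<lambda>\<phi>. (cls \<phi>, cls (lap \<phi>))) ` TF"

text \<open>The minimal closed extension of the Laplacian on test functions, kept as a set of pairs
  so that it can serve as \<open>G\<close> in \<open>eigenvector_below_level\<close>.\<close>

definition lap_graph :: "('a l2 \<times> 'a l2) set" where
  "lap_graph = closure lap_core"

lemma closed_lap_graph: "closed lap_graph"
  by (simp add: lap_graph_def)

lemma lap_graph_test: "\<phi> \<in> TF \<Longrightarrow> (cls \<phi>, cls (lap \<phi>)) \<in> lap_graph"
  using closure_subset[of lap_core] by (auto simp: lap_graph_def lap_core_def)

lemma lap_graph_subset_closed:
  assumes "closed S" "\<And>\<phi>. \<phi> \<in> TF \<Longrightarrow> (cls \<phi>, cls (lap \<phi>)) \<in> S"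
  shows "lap_graph \<subseteq> S"
  unfolding lap_graph_def by (rule closure_minimal) (use assms in \<open>auto simp: lap_core_def\<close>)

lemma lap_graph_iff:
  "(v, g) \<in> lap_graph \<longleftrightarrow> (\<exists>\<phi>. (\<forall>m. \<phi> m \<in> TF) \<and> (\<lambda>m. cls (\<phi> m)) \<longlonglongrightarrow> v \<and> (\<lambda>m. cls (lap (\<phi> m))) \<longlonglongrightarrow> g)"
proof
  assume "(v, g) \<in> lap_graph"
  then obtain x where x: "\<And>n. x n \<in> lap_core" "x \<longlonglongrightarrow> (v, g)"
    unfolding lap_graph_def closure_sequential by blast
  from x(1) have "\<exists>\<phi>. \<phi> \<in> TF \<and> x n = (cls \<phi>, cls (lap \<phi>))" for n by (auto simp: lap_core_def)
  then obtain \<phi> where \<phi>: "\<And>n. \<phi> n \<in> TF" "\<And>n. x n = (cls (\<phi> n), cls (lap (\<phi> n)))" by metis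
  show "\<exists>\<phi>. (\<forall>m. \<phi> m \<in> TF) \<and> (\<lambda>m. cls (\<phi> m)) \<longlonglongrightarrow> v \<and> (\<lambda>m. cls (lap (\<phi> m))) \<longlonglongrightarrow> g"
    using tendsto_fst[OF x(2)] tendsto_snd[OF x(2)] \<phi> by (intro exI[of _ \<phi>]) simp
next
  assume "\<exists>\<phi>. (\<forall>m. \<phi> m \<in> TF) \<and> (\<lambda>m. cls (\<phi> m)) \<longlonglongrightarrow> v \<and> (\<lambda>m. cls (lap (\<phi> m))) \<longlonglongrightarrow> g"
  then obtain \<phi> where \<phi>: "\<And>m. \<phi> m \<in> TF" "(\<lambda>m. cls (\<phi> m)) \<longlonglongrightarrow> v" "(\<lambda>m. cls (lap (\<phi> m))) \<longlonglongrightarrow> g" by blast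
  show "(v, g) \<in> lap_graph" unfolding lap_graph_def closure_sequential
    by (rule exI[of _ "\<lambda>m. (cls (\<phi> m), cls (lap (\<phi> m)))"])
      (use \<phi> in \<open>auto simp: lap_core_def intro!: tendsto_Pair\<close>)
qed

lemma lap_add:
  "smooth_on UNIV f \<Longrightarrow> smooth_on UNIV g \<Longrightarrow> lap (\<lambda>z. f z + g z) = (\<lambda>z. lap f z + lap g z)"
  by (simp add: lap_def D_add D_smooth sum.distrib)

lemma D_cmult: "smooth_on UNIV f \<Longrightarrow> D i (\<lambda>z. c * f z) = (\<lambda>z. c * D i f z)"
  unfolding D_def by (rule vf_deriv_cmult)

lemma lap_cmult: "smooth_on UNIV f \<Longrightarrow> lap (\<lambda>z. c * f z) = (\<lambda>z. c * lap f z)"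
  by (simp add: lap_def D_cmult D_smooth sum_distrib_left)

lemma subspace_lap_graph: "subspace lap_graph"
  unfolding subspace_def
proof (intro conjI ballI allI)
  have "lap (\<lambda>z. 0) = (\<lambda>z. 0)" using lap_cmult[OF smooth_const[of 0], of 0] by simp
  then show "0 \<in> lap_graph"
    using lap_graph_test[OF test_functions_zero] by (simp add: cls_zero zero_prod_def)
next
  fix x y assume "x \<in> lap_graph" "y \<in> lap_graph"
  then obtain v g v' g' where xy: "x = (v, g)" "y = (v', g')" "(v, g) \<in> lap_graph" "(v', g') \<in> lap_graph"
    by (metis surj_pair)
  then obtain \<phi> \<psi> where \<phi>: "\<And>m. \<phi> m \<in> TF" "(\<lambda>m. cls (\<phi> m)) \<longlonglongrightarrow> v" "(\<lambda>m. cls (lap (\<phi> m))) \<longlonglongrightarrow> g"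
    and \<psi>: "\<And>m. \<psi> m \<in> TF" "(\<lambda>m. cls (\<psi> m)) \<longlonglongrightarrow> v'" "(\<lambda>m. cls (lap (\<psi> m))) \<longlonglongrightarrow> g'"
    unfolding lap_graph_iff by blast
  have "(v + v', g + g') \<in> lap_graph" unfolding lap_graph_iff
  proof (intro exI[of _ "\<lambda>m z. \<phi> m z + \<psi> m z"] conjI allI)
    show "(\<lambda>z. \<phi> m z + \<psi> m z) \<in> TF" for m by (intro test_functions_add \<phi> \<psi>)
    show "(\<lambda>m. cls (\<lambda>z. \<phi> m z + \<psi> m z)) \<longlonglongrightarrow> v + v'"
      using tendsto_add[OF \<phi>(2) \<psi>(2)] by (simp add: cls_add TF_sqint[OF \<phi>(1)] TF_sqint[OF \<psi>(1)])
    show "(\<lambda>m. cls (lap (\<lambda>z. \<phi> m z + \<psi> m z))) \<longlonglongrightarrow> g + g'"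
      using tendsto_add[OF \<phi>(3) \<psi>(3)]
      by (simp add: lap_add test_functions_smooth[OF \<phi>(1)] test_functions_smooth[OF \<psi>(1)]
          cls_add TF_sqint[OF lap_test[OF \<phi>(1)]] TF_sqint[OF lap_test[OF \<psi>(1)]])
  qed
  then show "x + y \<in> lap_graph" by (simp add: xy)
next
  fix c :: real and x assume "x \<in> lap_graph"
  then obtain v g where x: "x = (v, g)" "(v, g) \<in> lap_graph" by (metis surj_pair)
  then obtain \<phi> where \<phi>: "\<And>m. \<phi> m \<in> TF" "(\<lambda>m. cls (\<phi> m)) \<longlonglongrightarrow> v" "(\<lambda>m. cls (lap (\<phi> m))) \<longlonglongrightarrow> g"
    unfolding lap_graph_iff by blast
  have "(c *\<^sub>R v, c *\<^sub>R g) \<in> lap_graph" unfolding lap_graph_iff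
  proof (intro exI[of _ "\<lambda>m z. c * \<phi> m z"] conjI allI)
    show "(\<lambda>z. c * \<phi> m z) \<in> TF" for m by (intro test_functions_cmult \<phi>)
    show "(\<lambda>m. cls (\<lambda>z. c * \<phi> m z)) \<longlonglongrightarrow> c *\<^sub>R v"
      using tendsto_scaleR[OF tendsto_const \<phi>(2)] by (simp add: cls_cmult TF_sqint[OF \<phi>(1)])
    show "(\<lambda>m. cls (lap (\<lambda>z. c * \<phi> m z))) \<longlonglongrightarrow> c *\<^sub>R g"
      using tendsto_scaleR[OF tendsto_const \<phi>(3)]
      by (simp add: lap_cmult test_functions_smooth[OF \<phi>(1)] cls_cmult TF_sqint[OF lap_test[OF \<phi>(1)]])
  qed
  then show "c *\<^sub>R x \<in> lap_graph" by (simp add: x)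
qed

lemma \<Omega>_bound:
  obtains R where "R \<ge> 0" "\<And>z. z \<in> \<Omega> \<Longrightarrow> norm z \<le> R"
proof -
  obtain B where "\<And>z. z \<in> \<Omega> \<Longrightarrow> norm z \<le> B" using bounded_\<Omega> by (auto simp: bounded_iff)
  then show ?thesis using that[of "max B 0"] by (simp add: le_max_iff_disj)
qed

lemma norm_coordinate_mult_le:
  assumes R: "R \<ge> 0" "\<And>z. z \<in> \<Omega> \<Longrightarrow> norm z \<le> R" and \<phi>: "\<phi> \<in> TF"
  shows "norm (cls (\<lambda>z. (z \<bullet> c) * \<phi> z)) \<le> R * norm c * norm (cls \<phi>)"
proof (rule norm_cls_mult_le[OF TF_sqint[OF \<phi>] TF_sqint[OF test_functions_smooth_mult[OF smooth_inner \<phi>]]])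
  fix z assume "\<phi> z \<noteq> 0"
  then have "z \<in> \<Omega>" using test_functions_eq_0[OF \<phi>] by blast
  have "\<bar>z \<bullet> c\<bar> \<le> norm z * norm c" by (rule Cauchy_Schwarz_ineq2)
  also have "\<dots> \<le> R * norm c" using R(2)[OF \<open>z \<in> \<Omega>\<close>] by (rule mult_right_mono) simp
  finally show "\<bar>z \<bullet> c\<bar> \<le> R * norm c" .
qed (use R in auto)

text \<open>The derivative along \<open>E i\<close> is \<open>D i \<phi>\<close> minus a linear
  function times \<open>T \<phi>\<close>, and linear functions are bounded on
  \<open>\<Omega>\<close>. The product in \<open>D_bound\<close> is split into squares, which
  produces the term with the norm of \<open>\<phi>\<close>.\<close>

lemma dir_deriv_bound:
  obtains M where "M \<ge> 0" "\<And>\<phi> b. \<phi> \<in> TF \<Longrightarrow> b \<in> Basis \<Longrightarrow>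
    (norm (cls (vf_deriv (\<lambda>_. b) \<phi>)))\<^sup>2 \<le> (norm (cls \<phi>))\<^sup>2 + M * (norm (cls (lap \<phi>)))\<^sup>2"
proof -
  obtain R where R: "R \<ge> 0" "\<And>z. z \<in> \<Omega> \<Longrightarrow> norm z \<le> R" using \<Omega>_bound by metis
  define Cm where "Cm = (\<Sum>i\<in>I. norm (C i))"
  have Cm: "Cm \<ge> 0" "\<And>i. i \<in> I \<Longrightarrow> norm (C i) \<le> Cm"
    unfolding Cm_def by (auto intro!: sum_nonneg member_le_sum simp: finite_I)
  define M where "M = 25 + 1 + 50 * (R * Cm)\<^sup>2"
  show thesis
  proof (rule that[of M])
    show "M \<ge> 0" by (simp add: M_def)
    fix \<phi> b assume \<phi>: "\<phi> \<in> TF" and b: "b \<in> (Basis :: 'a set)"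
    have T: "(norm (cls (T \<phi>)))\<^sup>2 \<le> 25 * (norm (cls (lap \<phi>)))\<^sup>2"
      using power_mono[OF T_bound[OF TF_U[OF \<phi>]], of 2] by (simp add: power_mult_distrib)
    consider "b = \<tau>" | i where "i \<in> I" "b = E i" using Basis_frame[OF b] by blast
    then show "(norm (cls (vf_deriv (\<lambda>_. b) \<phi>)))\<^sup>2 \<le> (norm (cls \<phi>))\<^sup>2 + M * (norm (cls (lap \<phi>)))\<^sup>2"
    proof cases
      case 1
      have "0 \<le> (1 + 50 * (R * Cm)\<^sup>2) * (norm (cls (lap \<phi>)))\<^sup>2" by simp
      moreover have "M * (norm (cls (lap \<phi>)))\<^sup>2
          = 25 * (norm (cls (lap \<phi>)))\<^sup>2 + (1 + 50 * (R * Cm)\<^sup>2) * (norm (cls (lap \<phi>)))\<^sup>2"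
        by (simp add: M_def algebra_simps)
      ultimately show ?thesis using T zero_le_power2[of "norm (cls \<phi>)"] unfolding 1 T_def[symmetric]
        by linarith
    next
      case 2
      let ?m = "\<lambda>z. (z \<bullet> C i) * T \<phi> z"
      have m: "?m \<in> TF" by (intro test_functions_smooth_mult smooth_inner T_test \<phi>)
      have "vf_deriv (\<lambda>_. b) \<phi> = (\<lambda>z. D i \<phi> z - ?m z)"
        unfolding 2 D_expand[OF test_functions_smooth[OF \<phi>]] by simp
      then have "cls (vf_deriv (\<lambda>_. b) \<phi>) = cls (D i \<phi>) - cls ?m"
        by (simp add: cls_diff TF_sqint[OF D_test[OF \<phi>]] TF_sqint[OF m])
      then have "norm (cls (vf_deriv (\<lambda>_. b) \<phi>)) \<le> norm (cls (D i \<phi>)) + norm (cls ?m)"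
        by (simp add: norm_triangle_ineq4)
      then have "(norm (cls (vf_deriv (\<lambda>_. b) \<phi>)))\<^sup>2 \<le> (norm (cls (D i \<phi>)) + norm (cls ?m))\<^sup>2"
        by (rule power_mono) simp
      also have "\<dots> \<le> 2 * (norm (cls (D i \<phi>)))\<^sup>2 + 2 * (norm (cls ?m))\<^sup>2"
        using sum_squares_bound[of "norm (cls (D i \<phi>))" "norm (cls ?m)"] by (simp add: power2_sum)
      also have "2 * (norm (cls (D i \<phi>)))\<^sup>2 \<le> (norm (cls \<phi>))\<^sup>2 + (norm (cls (lap \<phi>)))\<^sup>2"
        using D_bound[OF 2(1) TF_U[OF \<phi>]] sum_squares_bound[of "norm (cls (lap \<phi>))" "norm (cls \<phi>)"]
        by simp
      also have "2 * (norm (cls ?m))\<^sup>2 \<le> 50 * (R * Cm)\<^sup>2 * (norm (cls (lap \<phi>)))\<^sup>2"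
      proof -
        have "norm (cls ?m) \<le> (R * norm (C i)) * norm (cls (T \<phi>))"
          by (rule norm_coordinate_mult_le[OF R T_test[OF \<phi>]])
        also have "\<dots> \<le> (R * Cm) * norm (cls (T \<phi>))"
          using Cm(2)[OF 2(1)] R(1) by (intro mult_right_mono mult_left_mono) auto
        finally have "(norm (cls ?m))\<^sup>2 \<le> ((R * Cm) * norm (cls (T \<phi>)))\<^sup>2" by (rule power_mono) simp
        also have "\<dots> = (R * Cm)\<^sup>2 * (norm (cls (T \<phi>)))\<^sup>2" by (simp add: power_mult_distrib)
        also have "\<dots> \<le> (R * Cm)\<^sup>2 * (25 * (norm (cls (lap \<phi>)))\<^sup>2)" by (rule mult_left_mono[OF T]) simp
        finally show ?thesis by simp
      qed
      finally show ?thesis unfolding M_def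
        using zero_le_power2[of "norm (cls (lap \<phi>))"] unfolding distrib_right by linarith
    qed
  qed
qed

text \<open>Rellich's inequality with the Laplacian in place of the gradient. It is a closed
  condition on pairs, so it passes from test functions to the closure.\<close>

lemma lap_graph_compact:
  assumes "\<epsilon> > 0"
  obtains K :: "'a set" and F where "finite K" "\<And>v g. (v, g) \<in> lap_graph \<Longrightarrow>
    (norm v)\<^sup>2 \<le> \<epsilon> * (norm g)\<^sup>2 + (\<Sum>k\<in>K. (v \<bullet> F k)\<^sup>2)"
proof -
  obtain M where M: "M \<ge> 0" "\<And>\<phi> b. \<phi> \<in> TF \<Longrightarrow> b \<in> Basis \<Longrightarrow>
    (norm (cls (vf_deriv (\<lambda>_. b) \<phi>)))\<^sup>2 \<le> (norm (cls \<phi>))\<^sup>2 + M * (norm (cls (lap \<phi>)))\<^sup>2"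
    using dir_deriv_bound by metis
  define N where "N = real DIM('a)"
  have N: "N > 0" by (simp add: N_def)
  \<comment> \<open>The first bound lets the norm of \<open>\<phi>\<close> that reappears on the
    right be absorbed by half of the left-hand side; the second leaves the Laplacian with
    coefficient at most \<open>\<epsilon>\<close> after the doubling this causes.\<close>
  define \<epsilon>' where "\<epsilon>' = min (1 / (2 * N)) (\<epsilon> / (2 * N * (M + 1)))"
  have \<epsilon>': "\<epsilon>' > 0" "\<epsilon>' * N \<le> 1/2" "2 * \<epsilon>' * N * M \<le> \<epsilon>"
  proof -
    show "\<epsilon>' > 0" using N M(1) assms by (simp add: \<epsilon>'_def)
    have "\<epsilon>' * N \<le> 1 / (2 * N) * N" unfolding \<epsilon>'_def using N by (intro mult_right_mono) auto
    then show "\<epsilon>' * N \<le> 1/2" using N by simp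
    have "2 * \<epsilon>' * N * M \<le> 2 * \<epsilon>' * N * (M + 1)" using \<open>\<epsilon>' > 0\<close> N by (intro mult_left_mono) auto
    also have "\<dots> = \<epsilon>' * (2 * N * (M + 1))" by simp
    also have "\<dots> \<le> \<epsilon> / (2 * N * (M + 1)) * (2 * N * (M + 1))"
      unfolding \<epsilon>'_def using N M(1) by (intro mult_right_mono) auto
    also have "\<dots> = \<epsilon>" using N M(1) by simp
    finally show "2 * \<epsilon>' * N * M \<le> \<epsilon>" .
  qed
  obtain K :: "'a set" and F where K: "finite K" "\<And>\<phi>. \<phi> \<in> TF \<Longrightarrow>
    (norm (cls \<phi>))\<^sup>2 \<le> \<epsilon>' * (\<Sum>b\<in>Basis. (norm (cls (vf_deriv (\<lambda>_. b) \<phi>)))\<^sup>2) + (\<Sum>k\<in>K. (cls \<phi> \<bullet> F k)\<^sup>2)"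
    using rellich[OF bounded_\<Omega> \<epsilon>'(1)] by metis
  \<comment> \<open>Takes up the factor 2 from that doubling.\<close>
  define F' where "F' = (\<lambda>k. sqrt 2 *\<^sub>R F k)"
  let ?S = "{p :: 'a l2 \<times> 'a l2. (norm (fst p))\<^sup>2 \<le> \<epsilon> * (norm (snd p))\<^sup>2 + (\<Sum>k\<in>K. (fst p \<bullet> F' k)\<^sup>2)}"
  have "lap_graph \<subseteq> ?S"
  proof (rule lap_graph_subset_closed)
    show "closed ?S" by (intro closed_Collect_le continuous_intros)
    fix \<phi> assume \<phi>: "\<phi> \<in> TF"
    have "(\<Sum>b\<in>(Basis :: 'a set). (norm (cls (vf_deriv (\<lambda>_. b) \<phi>)))\<^sup>2)
        \<le> (\<Sum>b\<in>(Basis :: 'a set). (norm (cls \<phi>))\<^sup>2 + M * (norm (cls (lap \<phi>)))\<^sup>2)"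
      by (intro sum_mono M(2) \<phi>)
    also have "\<dots> = N * ((norm (cls \<phi>))\<^sup>2 + M * (norm (cls (lap \<phi>)))\<^sup>2)" by (simp add: N_def)
    finally have "\<epsilon>' * (\<Sum>b\<in>(Basis :: 'a set). (norm (cls (vf_deriv (\<lambda>_. b) \<phi>)))\<^sup>2)
        \<le> \<epsilon>' * (N * ((norm (cls \<phi>))\<^sup>2 + M * (norm (cls (lap \<phi>)))\<^sup>2))"
      using \<epsilon>'(1) by (intro mult_left_mono) auto
    also have "\<dots> = (\<epsilon>' * N) * (norm (cls \<phi>))\<^sup>2 + (\<epsilon>' * N * M) * (norm (cls (lap \<phi>)))\<^sup>2"
      by (simp add: algebra_simps)
    also have "\<dots> \<le> 1/2 * (norm (cls \<phi>))\<^sup>2 + (\<epsilon> / 2) * (norm (cls (lap \<phi>)))\<^sup>2"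
      using \<epsilon>'(2,3) by (intro add_mono mult_right_mono) auto
    finally have "(norm (cls \<phi>))\<^sup>2 \<le> \<epsilon> * (norm (cls (lap \<phi>)))\<^sup>2 + 2 * (\<Sum>k\<in>K. (cls \<phi> \<bullet> F k)\<^sup>2)"
      using K(2)[OF \<phi>] by simp
    then show "(cls \<phi>, cls (lap \<phi>)) \<in> ?S"
      by (simp add: F'_def power_mult_distrib sum_distrib_left)
  qed
  then show thesis by (intro that[OF K(1), of F']) auto
qed

text \<open>\<open>D_bound\<close> and \<open>D2_bound\<close>, applied to differences of the
  sequence, transfer the Cauchy property.\<close>

lemma test_sequence_convergent:
  assumes i: "i \<in> I" and \<phi>: "\<And>m. \<phi> m \<in> TF"
    and conv: "convergent (\<lambda>m. cls (\<phi> m))" "convergent (\<lambda>m. cls (lap (\<phi> m)))"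
  shows "convergent (\<lambda>m. cls (D i (\<phi> m)))" "convergent (\<lambda>m. cls (D i (D i (\<phi> m))))"
proof -
  note C = convergent_Cauchy[OF conv(1)] convergent_Cauchy[OF conv(2)]
  have diff: "(\<lambda>z. \<phi> m z - \<phi> l z) \<in> TF" for m l by (intro test_functions_diff \<phi>)
  note s = test_functions_smooth[OF \<phi>]
  have c0: "cls (\<phi> m) - cls (\<phi> l) = cls (\<lambda>z. \<phi> m z - \<phi> l z)" for m l
    by (simp add: cls_diff TF_sqint[OF \<phi>])
  have c1: "cls (lap (\<phi> m)) - cls (lap (\<phi> l)) = cls (lap (\<lambda>z. \<phi> m z - \<phi> l z))" for m l
    by (simp add: lap_diff s cls_diff TF_sqint[OF lap_test[OF \<phi>]])
  have c2: "cls (D i (\<phi> m)) - cls (D i (\<phi> l)) = cls (D i (\<lambda>z. \<phi> m z - \<phi> l z))" for m l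
    by (simp add: D_diff s cls_diff TF_sqint[OF D_test[OF \<phi>]])
  have c3: "cls (D i (D i (\<phi> m))) - cls (D i (D i (\<phi> l))) = cls (D i (D i (\<lambda>z. \<phi> m z - \<phi> l z)))" for m l
    by (simp add: D_diff s D_smooth cls_diff TF_sqint[OF D_test[OF D_test[OF \<phi>]]])
  have "Cauchy (\<lambda>m. cls (D i (\<phi> m)))"
  proof (rule Cauchy_if_norm_square_le_product[OF C(2,1), of 1])
    fix m l
    show "(norm (cls (D i (\<phi> m)) - cls (D i (\<phi> l))))\<^sup>2
        \<le> 1 * (norm (cls (lap (\<phi> m)) - cls (lap (\<phi> l))) * norm (cls (\<phi> m) - cls (\<phi> l)))"
      unfolding c0 c1 c2 using D_bound[OF i TF_U[OF diff]] by simp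
  qed simp
  then show "convergent (\<lambda>m. cls (D i (\<phi> m)))" by (simp add: Cauchy_convergent_iff)
  have "Cauchy (\<lambda>m. cls (D i (D i (\<phi> m))))"
  proof (rule Cauchy_if_norm_square_le_product[OF C(2,2), of "1 + 25 * (real (card I))\<^sup>2"])
    fix m l
    show "(norm (cls (D i (D i (\<phi> m))) - cls (D i (D i (\<phi> l)))))\<^sup>2
        \<le> (1 + 25 * (real (card I))\<^sup>2) * (norm (cls (lap (\<phi> m)) - cls (lap (\<phi> l))) * norm (cls (lap (\<phi> m)) - cls (lap (\<phi> l))))"
      unfolding c1 c3 using D2_bound[OF i TF_U[OF diff]] by (simp add: power2_eq_square)
  qed simp
  then show "convergent (\<lambda>m. cls (D i (D i (\<phi> m))))" by (simp add: Cauchy_convergent_iff)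
qed

lemma coordinate_sequence_convergent:
  assumes \<phi>: "\<And>m. \<phi> m \<in> TF" and conv: "convergent (\<lambda>m. cls (\<phi> m))"
  shows "convergent (\<lambda>m. cls (\<lambda>z. (z \<bullet> c) * \<phi> m z))"
proof -
  note C = convergent_Cauchy[OF conv]
  have diff: "(\<lambda>z. \<phi> m z - \<phi> l z) \<in> TF" for m l by (intro test_functions_diff \<phi>)
  have c0: "cls (\<phi> m) - cls (\<phi> l) = cls (\<lambda>z. \<phi> m z - \<phi> l z)" for m l
    by (simp add: cls_diff TF_sqint[OF \<phi>])
  obtain R where R: "R \<ge> 0" "\<And>z. z \<in> \<Omega> \<Longrightarrow> norm z \<le> R" using \<Omega>_bound by metis
  have "Cauchy (\<lambda>m. cls (\<lambda>z. (z \<bullet> c) * \<phi> m z))"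
  proof (rule Cauchy_if_norm_square_le_product[OF C C, of "(R * norm c)\<^sup>2"])
    fix m l
    have "cls (\<lambda>z. (z \<bullet> c) * \<phi> m z) - cls (\<lambda>z. (z \<bullet> c) * \<phi> l z) = cls (\<lambda>z. (z \<bullet> c) * (\<phi> m z - \<phi> l z))"
      by (simp add: right_diff_distrib cls_diff TF_sqint[OF test_functions_smooth_mult[OF smooth_inner \<phi>]])
    also have "norm \<dots> \<le> R * norm c * norm (cls (\<lambda>z. \<phi> m z - \<phi> l z))"
      by (rule norm_coordinate_mult_le[OF R diff])
    finally have "(norm (cls (\<lambda>z. (z \<bullet> c) * \<phi> m z) - cls (\<lambda>z. (z \<bullet> c) * \<phi> l z)))\<^sup>2
        \<le> (R * norm c * norm (cls (\<phi> m) - cls (\<phi> l)))\<^sup>2"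
      unfolding c0 by (rule power_mono) simp
    then show "(norm (cls (\<lambda>z. (z \<bullet> c) * \<phi> m z) - cls (\<lambda>z. (z \<bullet> c) * \<phi> l z)))\<^sup>2
        \<le> (R * norm c)\<^sup>2 * (norm (cls (\<phi> m) - cls (\<phi> l)) * norm (cls (\<phi> m) - cls (\<phi> l)))"
      unfolding power_mult_distrib[of "R * norm c"] power2_eq_square[of "norm (cls (\<phi> m) - cls (\<phi> l))"] .
  qed simp
  then show "convergent (\<lambda>m. cls (\<lambda>z. (z \<bullet> c) * \<phi> m z))" by (simp add: Cauchy_convergent_iff)
qed

section \<open>Multiplication by a horizontal coordinate\<close>

lemma D_coordinate_mult:
  assumes i: "i \<in> I" and j: "j \<in> I" and f: "smooth_on UNIV f"
  shows "D j (\<lambda>z. (z \<bullet> E i) * f z) = (\<lambda>z. (z \<bullet> E i) * D j f z + (if i = j then f z else 0))"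
proof -
  have "D j (\<lambda>z. z \<bullet> E i) = (\<lambda>z. if i = j then 1 else 0)"
    unfolding D_def vf_deriv_inner using E_inner[OF j i] \<tau>_E[OF i] by (auto simp: inner_add_left)
  then show ?thesis unfolding D_mult[OF smooth_inner f] by auto
qed

text \<open>The commutator \<open>[\<Delta>, x] = 2 D\<close>: it has no term of order 0 because the
  coordinate has constant derivatives along the frame.\<close>

lemma lap_coordinate_mult:
  assumes i: "i \<in> I" and f: "smooth_on UNIV f"
  shows "lap (\<lambda>z. (z \<bullet> E i) * f z) = (\<lambda>z. (z \<bullet> E i) * lap f z + 2 * D i f z)"
proof -
  have "D j (D j (\<lambda>z. (z \<bullet> E i) * f z))
      = (\<lambda>z. (z \<bullet> E i) * D j (D j f) z + (if i = j then 2 * D j f z else 0))" if j: "j \<in> I" for j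
  proof (cases "i = j")
    case True
    then show ?thesis
      using D_coordinate_mult[OF i j f] D_coordinate_mult[OF i j D_smooth[OF f]]
        D_add[OF smooth_mult[OF smooth_inner D_smooth[OF f]] f]
      by (simp add: add.commute)
  next
    case False
    then show ?thesis
      using D_coordinate_mult[OF i j f] D_coordinate_mult[OF i j D_smooth[OF f]] by simp
  qed
  then show ?thesis
    using i finite_I by (simp add: lap_def sum.distrib sum_distrib_left)
qed

lemma coordinate_mult_test: "\<phi> \<in> TF \<Longrightarrow> (\<lambda>z. (z \<bullet> c) * \<phi> z) \<in> TF"
  by (rule test_functions_smooth_mult[OF smooth_inner])

lemma coordinate_mult_symmetric:
  "\<phi> \<in> TF \<Longrightarrow> \<psi> \<in> TF \<Longrightarrow> cls (\<lambda>z. (z \<bullet> c) * \<phi> z) \<bullet> cls \<psi> = cls \<phi> \<bullet> cls (\<lambda>z. (z \<bullet> c) * \<psi> z)"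
  by (intro inner_cls_mult_commute TF_sqint coordinate_mult_test)

lemma cls_lap_coordinate_mult:
  assumes i: "i \<in> I" and \<phi>: "\<phi> \<in> TF"
  shows "cls (lap (\<lambda>z. (z \<bullet> E i) * \<phi> z)) = cls (\<lambda>z. (z \<bullet> E i) * lap \<phi> z) + 2 *\<^sub>R cls (D i \<phi>)"
  unfolding lap_coordinate_mult[OF i test_functions_smooth[OF \<phi>]]
  using TF_sqint[OF coordinate_mult_test[OF lap_test[OF \<phi>]]] TF_sqint[OF D_test[OF \<phi>]]
  by (simp add: cls_add cls_cmult sqint_cmult)

lemma cls_D_coordinate_mult:
  assumes i: "i \<in> I" and \<phi>: "\<phi> \<in> TF"
  shows "cls (D i (\<lambda>z. (z \<bullet> E i) * \<phi> z)) = cls (\<lambda>z. (z \<bullet> E i) * D i \<phi> z) + cls \<phi>"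
  unfolding D_coordinate_mult[OF i i test_functions_smooth[OF \<phi>]]
  using TF_sqint[OF coordinate_mult_test[OF D_test[OF \<phi>]]] TF_sqint[OF \<phi>]
  by (simp add: cls_add)

text \<open>By skewness and the product rule the left-hand side equals its own negative minus the
  squared norm of \<open>\<phi>\<close>; hence the factor 1/2.\<close>

lemma coordinate_mult_inner_D:
  assumes i: "i \<in> I" and \<phi>: "\<phi> \<in> TF"
  shows "cls (\<lambda>z. (z \<bullet> E i) * \<phi> z) \<bullet> cls (D i \<phi>) = - (1/2) * (norm (cls \<phi>))\<^sup>2"
proof -
  have "cls (D i \<phi>) \<bullet> cls (\<lambda>z. (z \<bullet> E i) * \<phi> z) = - (cls \<phi> \<bullet> cls (D i (\<lambda>z. (z \<bullet> E i) * \<phi> z)))"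
    by (rule D_skew[OF i TF_U[OF \<phi>] TF_U[OF coordinate_mult_test[OF \<phi>]]])
  also have "\<dots> = - (cls \<phi> \<bullet> cls (\<lambda>z. (z \<bullet> E i) * D i \<phi> z)) - (norm (cls \<phi>))\<^sup>2"
    unfolding cls_D_coordinate_mult[OF i \<phi>] by (simp add: inner_add_right power2_norm_eq_inner)
  also have "cls \<phi> \<bullet> cls (\<lambda>z. (z \<bullet> E i) * D i \<phi> z) = cls (\<lambda>z. (z \<bullet> E i) * \<phi> z) \<bullet> cls (D i \<phi>)"
    by (rule coordinate_mult_symmetric[OF \<phi> D_test[OF \<phi>], symmetric])
  finally show ?thesis by (simp add: inner_commute)
qed

text \<open>Half of the double commutator \<open>[[\<Delta>\<^sup>2, x], x] = 4 \<Delta> + 8 X\<^sup>2\<close>, as a quadratic form.\<close>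

lemma double_commutator_identity:
  assumes i: "i \<in> I" and \<phi>: "\<phi> \<in> TF"
  defines "\<psi> \<equiv> \<lambda>z. (z \<bullet> E i) * \<phi> z"
  shows "(norm (cls (lap \<psi>)))\<^sup>2 - cls (lap \<phi>) \<bullet> cls (lap (\<lambda>z. (z \<bullet> E i) * \<psi> z))
    = 4 * (norm (cls (D i \<phi>)))\<^sup>2 - 2 * (cls \<phi> \<bullet> cls (lap \<phi>))"
proof -
  have \<psi>: "\<psi> \<in> TF" unfolding \<psi>_def by (rule coordinate_mult_test[OF \<phi>])
  define aL d L where "aL = cls (\<lambda>z. (z \<bullet> E i) * lap \<phi> z)" and "d = cls (D i \<phi>)" and "L = cls (lap \<phi>)"
  have l\<psi>: "cls (lap \<psi>) = aL + 2 *\<^sub>R d"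
    unfolding \<psi>_def aL_def d_def by (rule cls_lap_coordinate_mult[OF i \<phi>])
  have "L \<bullet> cls (\<lambda>z. (z \<bullet> E i) * lap \<psi> z) = aL \<bullet> cls (lap \<psi>)"
    unfolding L_def aL_def by (rule coordinate_mult_symmetric[symmetric]; intro lap_test \<phi> \<psi>)
  moreover have "L \<bullet> cls (D i \<psi>) = aL \<bullet> d + L \<bullet> cls \<phi>"
    unfolding \<psi>_def cls_D_coordinate_mult[OF i \<phi>] inner_add_right L_def aL_def d_def
    by (subst coordinate_mult_symmetric[OF lap_test[OF \<phi>] D_test[OF \<phi>]]) simp
  ultimately have "L \<bullet> cls (lap (\<lambda>z. (z \<bullet> E i) * \<psi> z)) = aL \<bullet> (aL + 2 *\<^sub>R d) + 2 * (aL \<bullet> d + L \<bullet> cls \<phi>)"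
    unfolding cls_lap_coordinate_mult[OF i \<psi>] l\<psi> by (simp add: inner_add_right)
  then show ?thesis unfolding l\<psi> L_def[symmetric] d_def[symmetric]
    by (simp add: power2_norm_eq_inner inner_simps inner_commute[of d aL] inner_commute[of "cls \<phi>" L])
qed

section \<open>The Yang type inequality on the closed graph\<close>

text \<open>The identities for test functions pass to the limit and supply the hypotheses of
  \<open>yang_inequality_one_direction\<close>.\<close>

lemma yang_direction:
  fixes U A :: "'j \<Rightarrow> 'a l2" and \<phi> :: "'j \<Rightarrow> nat \<Rightarrow> 'a \<Rightarrow> real"
  assumes i: "i \<in> I" and J: "finite J"
    and \<phi>: "\<And>j m. j \<in> J \<Longrightarrow> \<phi> j m \<in> TF"
    and conv: "\<And>j. j \<in> J \<Longrightarrow> (\<lambda>m. cls (\<phi> j m)) \<longlonglongrightarrow> U j" "\<And>j. j \<in> J \<Longrightarrow> (\<lambda>m. cls (lap (\<phi> j m))) \<longlonglongrightarrow> A j"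
      "\<And>j. j \<in> J \<Longrightarrow> (\<lambda>m. cls (D i (\<phi> j m))) \<longlonglongrightarrow> B j"
    and UU: "\<And>j j'. j \<in> J \<Longrightarrow> j' \<in> J \<Longrightarrow> U j \<bullet> U j' = (if j = j' then 1 else 0)"
    and eig: "\<And>j v g. j \<in> J \<Longrightarrow> (v, g) \<in> lap_graph \<Longrightarrow> A j \<bullet> g = lam j * (U j \<bullet> v)"
    and low: "\<And>v g. (v, g) \<in> lap_graph \<Longrightarrow> (\<And>j. j \<in> J \<Longrightarrow> v \<bullet> U j = 0) \<Longrightarrow> L * (norm v)\<^sup>2 \<le> (norm g)\<^sup>2"
    and lamL: "\<And>j. j \<in> J \<Longrightarrow> lam j \<le> L" and \<delta>: "\<delta> > 0"
  shows "(\<Sum>j\<in>J. (L - lam j)\<^sup>2)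
    \<le> \<delta> * (\<Sum>j\<in>J. (L - lam j)\<^sup>2 * (4 * (norm (B j))\<^sup>2 - 2 * (U j \<bullet> A j)))
      + (1/\<delta>) * (\<Sum>j\<in>J. (L - lam j) * (norm (B j))\<^sup>2)"
proof -
  define \<psi> where "\<psi> = (\<lambda>j m z. (z \<bullet> E i) * \<phi> j m z)"
  \<comment> \<open>The squared coordinate appears in the double commutator identity. Its limit pair
    \<open>(P j, Q j)\<close> lies in the graph, so the eigenvalue equation evaluates
    \<open>A j \<bullet> Q j\<close>.\<close>
  define \<xi> where "\<xi> = (\<lambda>j m z. (z \<bullet> E i) * \<psi> j m z)"
  \<comment> \<open>Multiplication by the coordinate preserves convergence in the graph norm, so it
    can be applied twice.\<close>
  have step: "convergent (\<lambda>m. cls (\<lambda>z. (z \<bullet> E i) * f m z)) \<and> convergent (\<lambda>m. cls (lap (\<lambda>z. (z \<bullet> E i) * f m z)))"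
    if f: "\<And>m. f m \<in> TF" and c: "convergent (\<lambda>m. cls (f m))" "convergent (\<lambda>m. cls (lap (f m)))" for f
  proof -
    obtain l where "(\<lambda>m. cls (D i (f m))) \<longlonglongrightarrow> l"
      using test_sequence_convergent(1)[OF i f c] unfolding convergent_def by blast
    then have "convergent (\<lambda>m. 2 *\<^sub>R cls (D i (f m)))"
      by (rule convergentI[OF tendsto_scaleR[OF tendsto_const]])
    then show ?thesis
      unfolding cls_lap_coordinate_mult[OF i f]
      using coordinate_sequence_convergent[OF lap_test[OF f] c(2), of "E i"]
        coordinate_sequence_convergent[OF f c(1), of "E i"]
      by (intro conjI convergent_add)
  qed
  have \<psi>: "\<psi> j m \<in> TF" if "j \<in> J" for j m unfolding \<psi>_def by (rule coordinate_mult_test[OF \<phi>[OF that]])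
  have \<xi>: "\<xi> j m \<in> TF" if "j \<in> J" for j m unfolding \<xi>_def by (rule coordinate_mult_test[OF \<psi>[OF that]])
  have "convergent (\<lambda>m. cls (\<psi> j m)) \<and> convergent (\<lambda>m. cls (lap (\<psi> j m)))" if "j \<in> J" for j
    unfolding \<psi>_def by (rule step[OF \<phi>[OF that]]) (use conv[OF that] in \<open>auto simp: convergent_def\<close>)
  then obtain M N where MN: "\<And>j. j \<in> J \<Longrightarrow> (\<lambda>m. cls (\<psi> j m)) \<longlonglongrightarrow> M j" "\<And>j. j \<in> J \<Longrightarrow> (\<lambda>m. cls (lap (\<psi> j m))) \<longlonglongrightarrow> N j"
    unfolding convergent_def by metis
  have "convergent (\<lambda>m. cls (\<xi> j m)) \<and> convergent (\<lambda>m. cls (lap (\<xi> j m)))" if "j \<in> J" for j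
    unfolding \<xi>_def by (rule step[OF \<psi>[OF that]]) (use MN[OF that] in \<open>auto simp: convergent_def\<close>)
  then obtain P Q where PQ: "\<And>j. j \<in> J \<Longrightarrow> (\<lambda>m. cls (\<xi> j m)) \<longlonglongrightarrow> P j" "\<And>j. j \<in> J \<Longrightarrow> (\<lambda>m. cls (lap (\<xi> j m))) \<longlonglongrightarrow> Q j"
    unfolding convergent_def by metis
  have UA_graph: "(U j, A j) \<in> lap_graph" if "j \<in> J" for j
    unfolding lap_graph_iff using \<phi>[OF that] conv[OF that] by blast
  have MN_graph: "(M j, N j) \<in> lap_graph" if "j \<in> J" for j
    unfolding lap_graph_iff using \<psi>[OF that] MN[OF that] by blast
  have PQ_graph: "(P j, Q j) \<in> lap_graph" if "j \<in> J" for j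
    unfolding lap_graph_iff using \<xi>[OF that] PQ[OF that] by blast
  have UP: "U j \<bullet> P j = (norm (M j))\<^sup>2" if j: "j \<in> J" for j
  proof -
    have "(\<lambda>m. cls (\<phi> j m) \<bullet> cls (\<xi> j m)) \<longlonglongrightarrow> U j \<bullet> P j" by (intro tendsto_inner conv PQ j)
    moreover have "cls (\<phi> j m) \<bullet> cls (\<xi> j m) = (norm (cls (\<psi> j m)))\<^sup>2" for m
      using coordinate_mult_symmetric[OF \<phi>[OF j] \<psi>[OF j], of "E i" m m]
      unfolding \<xi>_def power2_norm_eq_inner by (simp add: \<psi>_def)
    moreover have "(\<lambda>m. (norm (cls (\<psi> j m)))\<^sup>2) \<longlonglongrightarrow> (norm (M j))\<^sup>2" by (intro tendsto_intros MN j)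
    ultimately show ?thesis by (simp add: LIMSEQ_unique)
  qed
  show ?thesis
  proof (rule yang_inequality_one_direction[where U=U and A=A and M=M and N=N])
    show "finite J" by (rule J)
    show "U j \<bullet> U j' = (if j = j' then 1 else 0)" if "j \<in> J" "j' \<in> J" for j j' using UU that by blast
    show "A j \<bullet> A j' = lam j * (U j \<bullet> U j')" if "j \<in> J" "j' \<in> J" for j j' using eig UA_graph that by blast
    show "A j' \<bullet> N j = lam j' * (U j' \<bullet> M j)" if "j \<in> J" "j' \<in> J" for j j' using eig MN_graph that by blast
    show "M j \<bullet> U j' = M j' \<bullet> U j" if jj: "j \<in> J" "j' \<in> J" for j j'
    proof -
      have 1: "(\<lambda>m. cls (\<psi> j m) \<bullet> cls (\<phi> j' m)) \<longlonglongrightarrow> M j \<bullet> U j'" by (intro tendsto_inner MN conv jj)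
      have 2: "(\<lambda>m. cls (\<psi> j' m) \<bullet> cls (\<phi> j m)) \<longlonglongrightarrow> M j' \<bullet> U j" by (intro tendsto_inner MN conv jj)
      have "cls (\<psi> j m) \<bullet> cls (\<phi> j' m) = cls (\<psi> j' m) \<bullet> cls (\<phi> j m)" for m
        unfolding \<psi>_def by (subst coordinate_mult_symmetric[OF \<phi>[OF jj(1)] \<phi>[OF jj(2)]]) (rule inner_commute)
      then show ?thesis using 1 2 LIMSEQ_unique by simp
    qed
    show "B j \<bullet> U j' = - (B j' \<bullet> U j)" if jj: "j \<in> J" "j' \<in> J" for j j'
    proof -
      have 1: "(\<lambda>m. cls (D i (\<phi> j m)) \<bullet> cls (\<phi> j' m)) \<longlonglongrightarrow> B j \<bullet> U j'" by (intro tendsto_inner conv jj)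
      have 2: "(\<lambda>m. - (cls (D i (\<phi> j' m)) \<bullet> cls (\<phi> j m))) \<longlonglongrightarrow> - (B j' \<bullet> U j)"
        by (intro tendsto_minus tendsto_inner conv jj)
      have "cls (D i (\<phi> j m)) \<bullet> cls (\<phi> j' m) = - (cls (D i (\<phi> j' m)) \<bullet> cls (\<phi> j m))" for m
        using D_skew[OF i TF_U[OF \<phi>[OF jj(1)]] TF_U[OF \<phi>[OF jj(2)]]] by (simp add: inner_commute)
      then show ?thesis using 1 2 LIMSEQ_unique by simp
    qed
    show "M j \<bullet> B j = - (1/2)" if j: "j \<in> J" for j
    proof -
      have 1: "(\<lambda>m. cls (\<psi> j m) \<bullet> cls (D i (\<phi> j m))) \<longlonglongrightarrow> M j \<bullet> B j" by (intro tendsto_inner MN conv j)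
      have 2: "(\<lambda>m. - (1/2) * (norm (cls (\<phi> j m)))\<^sup>2) \<longlonglongrightarrow> - (1/2) * (norm (U j))\<^sup>2"
        by (intro tendsto_intros conv j)
      have "cls (\<psi> j m) \<bullet> cls (D i (\<phi> j m)) = - (1/2) * (norm (cls (\<phi> j m)))\<^sup>2" for m
        unfolding \<psi>_def by (rule coordinate_mult_inner_D[OF i \<phi>[OF j]])
      then have "M j \<bullet> B j = - (1/2) * (norm (U j))\<^sup>2" using 1 2 LIMSEQ_unique by simp
      then show ?thesis by (simp add: power2_norm_eq_inner UU j)
    qed
    show "(norm (N j))\<^sup>2 = lam j * (norm (M j))\<^sup>2 + (4 * (norm (B j))\<^sup>2 - 2 * (U j \<bullet> A j))" if j: "j \<in> J" for j
    proof -
      have 1: "(\<lambda>m. (norm (cls (lap (\<psi> j m))))\<^sup>2 - cls (lap (\<phi> j m)) \<bullet> cls (lap (\<xi> j m))) \<longlonglongrightarrow> (norm (N j))\<^sup>2 - A j \<bullet> Q j"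
        by (intro tendsto_intros MN conv PQ j)
      have 2: "(\<lambda>m. 4 * (norm (cls (D i (\<phi> j m))))\<^sup>2 - 2 * (cls (\<phi> j m) \<bullet> cls (lap (\<phi> j m))))
          \<longlonglongrightarrow> 4 * (norm (B j))\<^sup>2 - 2 * (U j \<bullet> A j)"
        by (intro tendsto_intros conv j)
      have "(norm (cls (lap (\<psi> j m))))\<^sup>2 - cls (lap (\<phi> j m)) \<bullet> cls (lap (\<xi> j m))
          = 4 * (norm (cls (D i (\<phi> j m))))\<^sup>2 - 2 * (cls (\<phi> j m) \<bullet> cls (lap (\<phi> j m)))" for m
        unfolding \<xi>_def \<psi>_def by (rule double_commutator_identity[OF i \<phi>[OF j]])
      then have "(norm (N j))\<^sup>2 - A j \<bullet> Q j = 4 * (norm (B j))\<^sup>2 - 2 * (U j \<bullet> A j)"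
        using 1 2 LIMSEQ_unique by simp
      moreover have "A j \<bullet> Q j = lam j * (norm (M j))\<^sup>2" using eig[OF j PQ_graph[OF j]] UP[OF j] by simp
      ultimately show ?thesis by simp
    qed
    show "L * (norm (M j - (\<Sum>j'\<in>J. (M j \<bullet> U j') *\<^sub>R U j')))\<^sup>2 \<le> (norm (N j - (\<Sum>j'\<in>J. (M j \<bullet> U j') *\<^sub>R A j')))\<^sup>2"
      if j: "j \<in> J" for j
    proof (rule low)
      have "(\<Sum>j'\<in>J. (M j \<bullet> U j') *\<^sub>R (U j', A j')) \<in> lap_graph"
        by (intro subspace_sum[OF subspace_lap_graph] subspace_scale[OF subspace_lap_graph] UA_graph)
      then have "(M j, N j) - (\<Sum>j'\<in>J. (M j \<bullet> U j') *\<^sub>R (U j', A j')) \<in> lap_graph"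
        by (rule subspace_diff[OF subspace_lap_graph MN_graph[OF j]])
      moreover have "(M j, N j) - (\<Sum>j'\<in>J. (M j \<bullet> U j') *\<^sub>R (U j', A j'))
          = (M j - (\<Sum>j'\<in>J. (M j \<bullet> U j') *\<^sub>R U j'), N j - (\<Sum>j'\<in>J. (M j \<bullet> U j') *\<^sub>R A j'))"
        by (simp add: prod_eq_iff fst_sum snd_sum)
      ultimately show "(M j - (\<Sum>j'\<in>J. (M j \<bullet> U j') *\<^sub>R U j'), N j - (\<Sum>j'\<in>J. (M j \<bullet> U j') *\<^sub>R A j')) \<in> lap_graph"
        by simp
      show "(M j - (\<Sum>j'\<in>J. (M j \<bullet> U j') *\<^sub>R U j')) \<bullet> U j'' = 0" if "j'' \<in> J" for j''
        using that J by (simp add: inner_diff_left inner_sum_left UU if_distrib cong: sum.cong if_cong)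
    qed
  qed (use lamL \<delta> in auto)
qed

text \<open>Over all directions the squared norms of \<open>B i j\<close> add up to
  \<open>e j\<close>, the form \<open>-\<Delta>\<close> at \<open>U j\<close>. The terms
  \<open>4 (norm (B i j))^2 + 2 e j\<close> therefore sum to \<open>(4 + 2 card I) e j\<close>, and
  Cauchy-Schwarz bounds \<open>e j\<close> by \<open>sqrt (lam j)\<close>, since \<open>U j\<close>
  has norm 1 and \<open>A j\<close> has norm \<open>sqrt (lam j)\<close>.\<close>

lemma yang_sum:
  fixes U A :: "'j \<Rightarrow> 'a l2"
  assumes J: "finite J"
    and UA: "\<And>j. j \<in> J \<Longrightarrow> (U j, A j) \<in> lap_graph"
    and UU: "\<And>j j'. j \<in> J \<Longrightarrow> j' \<in> J \<Longrightarrow> U j \<bullet> U j' = (if j = j' then 1 else 0)"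
    and eig: "\<And>j v g. j \<in> J \<Longrightarrow> (v, g) \<in> lap_graph \<Longrightarrow> A j \<bullet> g = lam j * (U j \<bullet> v)"
    and low: "\<And>v g. (v, g) \<in> lap_graph \<Longrightarrow> (\<And>j. j \<in> J \<Longrightarrow> v \<bullet> U j = 0) \<Longrightarrow> L * (norm v)\<^sup>2 \<le> (norm g)\<^sup>2"
    and lamL: "\<And>j. j \<in> J \<Longrightarrow> lam j \<le> L" and \<delta>: "\<delta> > 0"
  shows "real (card I) * (\<Sum>j\<in>J. (L - lam j)\<^sup>2)
    \<le> \<delta> * ((4 + 2 * real (card I)) * (\<Sum>j\<in>J. (L - lam j)\<^sup>2 * sqrt (lam j)))
      + (1/\<delta>) * (\<Sum>j\<in>J. (L - lam j) * sqrt (lam j))"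
proof -
  have "\<exists>\<phi>. \<forall>j\<in>J. (\<forall>m. \<phi> j m \<in> TF) \<and> (\<lambda>m. cls (\<phi> j m)) \<longlonglongrightarrow> U j \<and> (\<lambda>m. cls (lap (\<phi> j m))) \<longlonglongrightarrow> A j"
    using UA unfolding lap_graph_iff by (intro bchoice) blast
  then obtain \<phi> where \<phi>: "\<And>j m. j \<in> J \<Longrightarrow> \<phi> j m \<in> TF"
    and conv: "\<And>j. j \<in> J \<Longrightarrow> (\<lambda>m. cls (\<phi> j m)) \<longlonglongrightarrow> U j" "\<And>j. j \<in> J \<Longrightarrow> (\<lambda>m. cls (lap (\<phi> j m))) \<longlonglongrightarrow> A j"
    by blast
  define B where "B = (\<lambda>i j. lim (\<lambda>m. cls (D i (\<phi> j m))))"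
  have B: "(\<lambda>m. cls (D i (\<phi> j m))) \<longlonglongrightarrow> B i j" if "i \<in> I" "j \<in> J" for i j
  proof -
    have "convergent (\<lambda>m. cls (D i (\<phi> j m)))"
      by (rule test_sequence_convergent(1)[OF that(1) \<phi>[OF that(2)]])
        (use conv[OF that(2)] in \<open>auto simp: convergent_def\<close>)
    then show ?thesis by (simp add: B_def convergent_LIMSEQ_iff)
  qed
  define e where "e = (\<lambda>j. - (U j \<bullet> A j))"
  have Bsum: "(\<Sum>i\<in>I. (norm (B i j))\<^sup>2) = e j" if j: "j \<in> J" for j
  proof -
    have "(\<lambda>m. energy (\<phi> j m)) \<longlonglongrightarrow> (\<Sum>i\<in>I. (norm (B i j))\<^sup>2)"
      unfolding energy_def by (intro tendsto_intros B j)
    moreover have "(\<lambda>m. - (cls (\<phi> j m) \<bullet> cls (lap (\<phi> j m)))) \<longlonglongrightarrow> e j"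
      unfolding e_def by (intro tendsto_intros conv j)
    ultimately show ?thesis
      using LIMSEQ_unique by (simp add: energy_eq[OF TF_U[OF \<phi>[OF j]]] inner_commute)
  qed
  have e: "e j \<le> sqrt (lam j)" if j: "j \<in> J" for j
  proof -
    have "(norm (A j))\<^sup>2 = lam j" using eig[OF j UA[OF j]] UU[OF j j] by (simp add: power2_norm_eq_inner)
    then have "norm (A j) = sqrt (lam j)" by (metis norm_ge_zero real_sqrt_abs abs_of_nonneg)
    moreover have "norm (U j) = 1" using UU[OF j j] by (simp add: norm_eq_sqrt_inner)
    moreover have "- (U j \<bullet> A j) \<le> norm (U j) * norm (A j)"
      using Cauchy_Schwarz_ineq2[of "U j" "A j"] by linarith
    ultimately show ?thesis by (simp add: e_def)
  qed
  have l0: "0 \<le> L - lam j" if "j \<in> J" for j using lamL[OF that] by simp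
  have "real (card I) * (\<Sum>j\<in>J. (L - lam j)\<^sup>2) = (\<Sum>i\<in>I. \<Sum>j\<in>J. (L - lam j)\<^sup>2)" by simp
  also have "\<dots> \<le> (\<Sum>i\<in>I. \<delta> * (\<Sum>j\<in>J. (L - lam j)\<^sup>2 * (4 * (norm (B i j))\<^sup>2 + 2 * e j))
      + (1/\<delta>) * (\<Sum>j\<in>J. (L - lam j) * (norm (B i j))\<^sup>2))"
  proof (rule sum_mono)
    fix i assume i: "i \<in> I"
    show "(\<Sum>j\<in>J. (L - lam j)\<^sup>2) \<le> \<delta> * (\<Sum>j\<in>J. (L - lam j)\<^sup>2 * (4 * (norm (B i j))\<^sup>2 + 2 * e j))
      + (1/\<delta>) * (\<Sum>j\<in>J. (L - lam j) * (norm (B i j))\<^sup>2)"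
      using yang_direction[OF i J \<phi> conv B[OF i] UU eig low lamL \<delta>] by (simp add: e_def)
  qed
  also have "\<dots> = \<delta> * (\<Sum>j\<in>J. (L - lam j)\<^sup>2 * (4 * (\<Sum>i\<in>I. (norm (B i j))\<^sup>2) + real (card I) * (2 * e j)))
      + (1/\<delta>) * (\<Sum>j\<in>J. (L - lam j) * (\<Sum>i\<in>I. (norm (B i j))\<^sup>2))"
  proof -
    have "(\<Sum>i\<in>I. \<Sum>j\<in>J. (L - lam j)\<^sup>2 * (4 * (norm (B i j))\<^sup>2 + 2 * e j))
        = (\<Sum>j\<in>J. \<Sum>i\<in>I. (L - lam j)\<^sup>2 * (4 * (norm (B i j))\<^sup>2 + 2 * e j))" by (rule sum.swap)
    also have "\<dots> = (\<Sum>j\<in>J. (L - lam j)\<^sup>2 * (4 * (\<Sum>i\<in>I. (norm (B i j))\<^sup>2) + real (card I) * (2 * e j)))"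
      by (simp add: sum.distrib flip: sum_distrib_left)
    finally have 1: "(\<Sum>i\<in>I. \<Sum>j\<in>J. (L - lam j)\<^sup>2 * (4 * (norm (B i j))\<^sup>2 + 2 * e j))
        = (\<Sum>j\<in>J. (L - lam j)\<^sup>2 * (4 * (\<Sum>i\<in>I. (norm (B i j))\<^sup>2) + real (card I) * (2 * e j)))" .
    have "(\<Sum>i\<in>I. \<Sum>j\<in>J. (L - lam j) * (norm (B i j))\<^sup>2) = (\<Sum>j\<in>J. \<Sum>i\<in>I. (L - lam j) * (norm (B i j))\<^sup>2)"
      by (rule sum.swap)
    then have 2: "(\<Sum>i\<in>I. \<Sum>j\<in>J. (L - lam j) * (norm (B i j))\<^sup>2) = (\<Sum>j\<in>J. (L - lam j) * (\<Sum>i\<in>I. (norm (B i j))\<^sup>2))"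
      by (simp add: sum_distrib_left)
    show ?thesis unfolding sum.distrib sum_distrib_left[symmetric] 1 2 ..
  qed
  also have "\<dots> = \<delta> * ((4 + 2 * real (card I)) * (\<Sum>j\<in>J. (L - lam j)\<^sup>2 * e j)) + (1/\<delta>) * (\<Sum>j\<in>J. (L - lam j) * e j)"
    by (simp add: Bsum sum_distrib_left algebra_simps cong: sum.cong)
  also have "\<dots> \<le> \<delta> * ((4 + 2 * real (card I)) * (\<Sum>j\<in>J. (L - lam j)\<^sup>2 * sqrt (lam j)))
      + (1/\<delta>) * (\<Sum>j\<in>J. (L - lam j) * sqrt (lam j))"
    using \<delta> by (intro add_mono mult_left_mono sum_mono e l0) auto
  finally show ?thesis .
qed

end

subsection \<open>Functions on a domain as elements of the Hilbert space\<close>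

text \<open>Extension by zero; it discards the values outside \<open>\<Omega>\<close>, which are
  irrelevant for membership in \<open>L2 \<Omega>\<close>.\<close>

definition emb :: "'a::euclidean_space set \<Rightarrow> ('a \<Rightarrow> real) \<Rightarrow> 'a l2" where
  "emb \<Omega> f = cls (\<lambda>z. indicator \<Omega> z * f z)"

lemma L2_iff_sqint:
  assumes "open \<Omega>"
  shows "f \<in> L2 \<Omega> \<longleftrightarrow> sqint (\<lambda>z. indicator \<Omega> z * f z)"
proof -
  have "\<Omega> \<inter> space lebesgue \<in> sets lebesgue" using assms by simp
  moreover have "(\<lambda>z. (indicator \<Omega> z * f z)\<^sup>2) = (\<lambda>z. indicator \<Omega> z * (f z)\<^sup>2)"
    by (auto simp: indicator_def)
  ultimately show ?thesis
    by (simp add: L2_def sqint_def borel_measurable_restrict_space_iff integrable_restrict_space)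
qed

lemma L2_sqint: "open \<Omega> \<Longrightarrow> f \<in> L2 \<Omega> \<Longrightarrow> sqint (\<lambda>z. indicator \<Omega> z * f z)"
  by (simp add: L2_iff_sqint)

lemma integral_lebesgue_on_mult:
  fixes f h :: "'a::euclidean_space \<Rightarrow> real"
  assumes "open \<Omega>"
  shows "(\<integral>z. f z * h z \<partial>lebesgue_on \<Omega>) = (\<integral>z. (indicator \<Omega> z * f z) * h z \<partial>lebesgue)"
  by (subst integral_restrict_space) (use assms in \<open>auto simp: mult.assoc\<close>)

lemma emb_inner:
  "open \<Omega> \<Longrightarrow> f \<in> L2 \<Omega> \<Longrightarrow> sqint h \<Longrightarrow> emb \<Omega> f \<bullet> cls h = (\<integral>z. f z * h z \<partial>lebesgue_on \<Omega>)"
  by (simp add: emb_def inner_cls L2_sqint integral_lebesgue_on_mult)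

lemma emb_inner_emb:
  assumes "open \<Omega>" "f \<in> L2 \<Omega>" "g \<in> L2 \<Omega>"
  shows "emb \<Omega> f \<bullet> emb \<Omega> g = (\<integral>z. f z * g z \<partial>lebesgue_on \<Omega>)"
proof -
  have "(\<lambda>z. (indicator \<Omega> z * f z) * (indicator \<Omega> z * g z)) = (\<lambda>z. (indicator \<Omega> z * f z) * g z)"
    by (auto simp: indicator_def)
  then show ?thesis using assms
    by (simp add: emb_def inner_cls L2_sqint integral_lebesgue_on_mult)
qed

lemma norm_emb: "open \<Omega> \<Longrightarrow> f \<in> L2 \<Omega> \<Longrightarrow> (norm (emb \<Omega> f))\<^sup>2 = (\<integral>z. (f z)\<^sup>2 \<partial>lebesgue_on \<Omega>)"
  unfolding power2_norm_eq_inner by (simp add: emb_inner_emb power2_eq_square)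

lemma L2_diff: "open \<Omega> \<Longrightarrow> f \<in> L2 \<Omega> \<Longrightarrow> g \<in> L2 \<Omega> \<Longrightarrow> (\<lambda>z. f z - g z) \<in> L2 \<Omega>"
  using sqint_diff[of "\<lambda>z. indicator \<Omega> z * f z" "\<lambda>z. indicator \<Omega> z * g z"]
  by (simp add: L2_iff_sqint right_diff_distrib)

lemma L2_add: "open \<Omega> \<Longrightarrow> f \<in> L2 \<Omega> \<Longrightarrow> g \<in> L2 \<Omega> \<Longrightarrow> (\<lambda>z. f z + g z) \<in> L2 \<Omega>"
  using sqint_add[of "\<lambda>z. indicator \<Omega> z * f z" "\<lambda>z. indicator \<Omega> z * g z"]
  by (simp add: L2_iff_sqint distrib_left)

lemma L2_cmult: "open \<Omega> \<Longrightarrow> f \<in> L2 \<Omega> \<Longrightarrow> (\<lambda>z. c * f z) \<in> L2 \<Omega>"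
  using sqint_cmult[of "\<lambda>z. indicator \<Omega> z * f z" c]
  by (simp add: L2_iff_sqint mult.left_commute)

lemma emb_diff:
  "open \<Omega> \<Longrightarrow> f \<in> L2 \<Omega> \<Longrightarrow> g \<in> L2 \<Omega> \<Longrightarrow> emb \<Omega> (\<lambda>z. f z - g z) = emb \<Omega> f - emb \<Omega> g"
  by (simp add: emb_def right_diff_distrib cls_diff L2_sqint)

lemma emb_add:
  "open \<Omega> \<Longrightarrow> f \<in> L2 \<Omega> \<Longrightarrow> g \<in> L2 \<Omega> \<Longrightarrow> emb \<Omega> (\<lambda>z. f z + g z) = emb \<Omega> f + emb \<Omega> g"
  by (simp add: emb_def distrib_left cls_add L2_sqint)

lemma emb_cmult: "open \<Omega> \<Longrightarrow> f \<in> L2 \<Omega> \<Longrightarrow> emb \<Omega> (\<lambda>z. c * f z) = c *\<^sub>R emb \<Omega> f"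
  by (simp add: emb_def mult.left_commute[of _ c] cls_cmult L2_sqint)

lemma emb_zero: "emb \<Omega> (\<lambda>z. 0) = 0"
  by (simp add: emb_def cls_zero)

lemma L2_zero: "open \<Omega> \<Longrightarrow> (\<lambda>z. 0) \<in> L2 \<Omega>"
  by (simp add: L2_iff_sqint sqint_zero)

lemma L2_emb_sum:
  assumes "open \<Omega>" "\<And>i. i \<in> S \<Longrightarrow> f i \<in> L2 \<Omega>"
  shows "(\<lambda>z. \<Sum>i\<in>S. c i * f i z) \<in> L2 \<Omega> \<and> emb \<Omega> (\<lambda>z. \<Sum>i\<in>S. c i * f i z) = (\<Sum>i\<in>S. c i *\<^sub>R emb \<Omega> (f i))"
  using assms(2)
proof (induction S rule: infinite_finite_induct)
  case (insert i S)
  then show ?case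
    by (simp add: L2_add L2_cmult emb_add emb_cmult assms(1))
qed (simp_all add: L2_zero emb_zero assms(1))

lemma test_functions_ext:
  assumes "\<phi> \<in> test_functions \<Omega>"
  shows "(\<lambda>z. indicator \<Omega> z * \<phi> z) = \<phi>"
  using test_functions_eq_0[OF assms] by (auto simp: indicator_def fun_eq_iff)

lemma test_functions_L2: "open \<Omega> \<Longrightarrow> \<phi> \<in> test_functions \<Omega> \<Longrightarrow> \<phi> \<in> L2 \<Omega>"
  by (simp add: L2_iff_sqint test_functions_ext sqint_test_functions)

lemma emb_test: "\<phi> \<in> test_functions \<Omega> \<Longrightarrow> emb \<Omega> \<phi> = cls \<phi>"
  by (simp add: emb_def test_functions_ext)

lemma AE_lebesgue_on_iff:
  assumes "open \<Omega>"
  shows "(AE z in lebesgue_on \<Omega>. P z) \<longleftrightarrow> (AE z in lebesgue. z \<in> \<Omega> \<longrightarrow> P z)"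
  by (rule AE_restrict_space_iff) (use assms in simp)

lemma emb_cong_AE:
  assumes "open \<Omega>" "f \<in> L2 \<Omega>" "g \<in> L2 \<Omega>" "AE z in lebesgue_on \<Omega>. f z = g z"
  shows "emb \<Omega> f = emb \<Omega> g"
proof -
  have "AE z in lebesgue. indicator \<Omega> z * f z = indicator \<Omega> z * g z"
    using assms(4) unfolding AE_lebesgue_on_iff[OF assms(1)] by eventually_elim (auto simp: indicator_def)
  then show ?thesis using assms by (simp add: emb_def cls_eq_iff L2_sqint)
qed

lemma emb_eq_0_orthogonal:
  assumes "open \<Omega>" "f \<in> L2 \<Omega>" and orth: "\<And>\<eta>. \<eta> \<in> test_functions \<Omega> \<Longrightarrow> emb \<Omega> f \<bullet> cls \<eta> = 0"
  shows "emb \<Omega> f = 0"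
proof -
  have "AE z in lebesgue. z \<in> \<Omega> \<longrightarrow> indicator \<Omega> z * f z = 0"
  proof (rule AE_eq_0_if_orthogonal_to_test_functions[OF assms(1) L2_sqint[OF assms(1,2)]])
    fix \<eta> assume \<eta>: "\<eta> \<in> test_functions \<Omega>"
    show "(\<integral>x. (indicator \<Omega> x * f x) * \<eta> x \<partial>lebesgue) = 0"
      using orth[OF \<eta>] inner_cls[OF L2_sqint[OF assms(1,2)] sqint_test_functions[OF \<eta>]] by (simp add: emb_def)
  qed
  then have "AE z in lebesgue. indicator \<Omega> z * f z = 0"
    by eventually_elim (auto simp: indicator_def)
  then have "cls (\<lambda>z. indicator \<Omega> z * f z) = cls (\<lambda>z. 0)"
    by (subst cls_eq_iff) (auto simp: L2_sqint assms sqint_zero)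
  then show ?thesis by (simp add: emb_def cls_zero)
qed

text \<open>The form in which uniqueness of weak derivatives is used.\<close>

lemma emb_eq_if_orthogonal:
  assumes \<Omega>: "open \<Omega>" and f: "f \<in> L2 \<Omega>" and g: "g \<in> L2 \<Omega>"
    and eq: "\<And>\<eta>. \<eta> \<in> test_functions \<Omega> \<Longrightarrow> emb \<Omega> f \<bullet> cls \<eta> = emb \<Omega> g \<bullet> cls \<eta>"
  shows "emb \<Omega> f = emb \<Omega> g"
  using emb_eq_0_orthogonal[OF \<Omega> L2_diff[OF \<Omega> f g]] eq
  by (simp add: emb_diff[OF \<Omega> f g] inner_diff_left)

text \<open>Cutting a representative of the limit off outside \<open>\<Omega>\<close> does not
  increase its distance to functions supported in \<open>\<Omega>\<close>, so the cut-off function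
  represents the same limit.\<close>

lemma limit_of_test_functions_emb:
  assumes \<Omega>: "open \<Omega>" and \<phi>: "\<And>m. \<phi> m \<in> test_functions \<Omega>" and lim: "(\<lambda>m. cls (\<phi> m)) \<longlonglongrightarrow> v"
  obtains f where "f \<in> L2 \<Omega>" "emb \<Omega> f = v"
proof -
  obtain f where f: "sqint f" "v = cls f" using l2_cases by blast
  have ind: "(\<lambda>z. indicator \<Omega> z * f z) \<in> borel_measurable lebesgue"
    using f(1) \<Omega> by (intro borel_measurable_times borel_measurable_indicator sqint_measurable) auto
  have sq: "sqint (\<lambda>z. indicator \<Omega> z * f z)"
  proof (rule sqint_if_nn_integral_finite[OF ind])
    have "(\<integral>\<^sup>+z. ennreal ((indicator \<Omega> z * f z)\<^sup>2) \<partial>lebesgue) \<le> (\<integral>\<^sup>+z. ennreal ((f z)\<^sup>2) \<partial>lebesgue)"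
      by (intro nn_integral_mono ennreal_leI) (auto simp: indicator_def)
    then show "(\<integral>\<^sup>+z. ennreal ((indicator \<Omega> z * f z)\<^sup>2) \<partial>lebesgue) < \<infinity>"
      using nn_integral_cls[OF f(1)] by (auto intro: le_less_trans)
  qed
  have "(\<lambda>m. cls (\<phi> m)) \<longlonglongrightarrow> emb \<Omega> f"
  proof (rule LIM_zero_cancel, rule Lim_null_comparison)
    show "(\<lambda>m. norm (cls (\<phi> m) - v)) \<longlonglongrightarrow> 0" using lim by (simp add: tendsto_norm_zero LIM_zero)
    have "norm (cls (\<phi> m) - emb \<Omega> f) \<le> norm (cls (\<phi> m) - v)" for m
    proof -
      let ?g = "\<lambda>z. \<phi> m z - f z"
      have g: "sqint ?g" by (intro sqint_diff sqint_test_functions[OF \<phi>] f)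
      have eq: "(\<lambda>z. indicator \<Omega> z * ?g z) = (\<lambda>z. \<phi> m z - indicator \<Omega> z * f z)"
        using test_functions_eq_0[OF \<phi>[of m]] by (auto simp: fun_eq_iff indicator_def)
      have g': "sqint (\<lambda>z. indicator \<Omega> z * ?g z)" unfolding eq by (intro sqint_diff sqint_test_functions[OF \<phi>] sq)
      have "norm (cls (\<lambda>z. indicator \<Omega> z * ?g z)) \<le> 1 * norm (cls ?g)"
        by (rule norm_cls_mult_le[OF g g']) (auto simp: indicator_def)
      then show ?thesis unfolding eq f(2) emb_def
        by (simp add: cls_diff sqint_test_functions[OF \<phi>] f(1) sq)
    qed
    then show "\<forall>\<^sub>F m in sequentially. norm (cls (\<phi> m) - emb \<Omega> f) \<le> norm (cls (\<phi> m) - v)" by simp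
  qed
  then have "emb \<Omega> f = v" using lim LIMSEQ_unique by blast
  moreover have "f \<in> L2 \<Omega>" using sq \<Omega> by (simp add: L2_iff_sqint)
  ultimately show ?thesis using that by blast
qed

subsection \<open>The Heisenberg frame\<close>

definition heis_\<tau> :: "'n::finite heis" where
  "heis_\<tau> = (0, 0, 1)"

definition heis_E :: "'n + 'n \<Rightarrow> 'n::finite heis" where
  "heis_E = case_sum (\<lambda>p. (axis p 1, 0, 0)) (\<lambda>p. (0, axis p 1, 0))"

text \<open>Chosen so that \<open>z \<bullet> heis_C i\<close> is the coefficient of
  \<open>\<partial>/\<partial>t\<close>: \<open>y $ p / 2\<close> for \<open>Inl p\<close> and
  \<open>- (x $ p / 2)\<close> for \<open>Inr p\<close>.\<close>

definition heis_C :: "'n + 'n \<Rightarrow> 'n::finite heis" where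
  "heis_C = case_sum (\<lambda>p. (0, axis p (1/2), 0)) (\<lambda>p. (- axis p (1/2), 0, 0))"

definition heis_field :: "'n + 'n \<Rightarrow> 'n::finite heis \<Rightarrow> 'n heis" where
  "heis_field = case_sum X_field Y_field"

lemma heis_field_eq: "(\<lambda>z. heis_E i + (z \<bullet> heis_C i) *\<^sub>R heis_\<tau>) = heis_field i"
  by (cases i) (auto simp: heis_E_def heis_C_def heis_field_def heis_\<tau>_def X_field_def Y_field_def
      inner_axis fun_eq_iff)

lemma sum_over_sum_type:
  fixes f :: "'n::finite + 'n \<Rightarrow> 'b::comm_monoid_add"
  shows "(\<Sum>i\<in>UNIV. f i) = (\<Sum>p\<in>UNIV. f (Inl p) + f (Inr p))"
  by (simp add: UNIV_Plus_UNIV[symmetric] sum.Plus sum.distrib del: UNIV_Plus_UNIV)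

locale heis_domain =
  fixes \<Omega> :: "'n::finite heis set"
  assumes open_domain: "open \<Omega>" and bounded_domain: "bounded \<Omega>"

text \<open>The bracket of \<open>X_field p\<close> with \<open>Y_field p\<close> is
  \<open>-T\<close>, and fields with different \<open>p\<close> or of the same kind commute. The
  coordinate basis consists of \<open>\<partial>/\<partial>t\<close> and the vectors
  \<open>heis_E i\<close>.\<close>

sublocale heis_domain \<subseteq> orthonormal_frame "heis_\<tau> :: 'n::finite heis" UNIV heis_E heis_C \<Omega>
proof
  fix i j :: "'n + 'n"
  show "heis_C i \<bullet> (heis_\<tau> :: 'n heis) = 0"
    by (cases i) (auto simp: heis_C_def heis_\<tau>_def)
  show "\<bar>heis_E i \<bullet> heis_C j - heis_E j \<bullet> (heis_C i :: 'n heis)\<bar> \<le> 1"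
    by (cases i; cases j) (auto simp: heis_E_def heis_C_def inner_axis_axis)
  show "heis_E i \<bullet> (heis_E j :: 'n heis) = (if i = j then 1 else 0)"
    by (cases i; cases j) (auto simp: heis_E_def inner_axis_axis)
  show "heis_\<tau> \<bullet> (heis_E i :: 'n heis) = 0"
    by (cases i) (auto simp: heis_E_def heis_\<tau>_def)
next
  have "\<bar>heis_E (Inl p) \<bullet> heis_C (Inr p) - heis_E (Inr p) \<bullet> (heis_C (Inl p) :: 'n heis)\<bar> = 1" for p :: 'n
    by (simp add: heis_E_def heis_C_def inner_axis_axis)
  then show "\<exists>i\<in>UNIV. \<exists>j\<in>UNIV. \<bar>heis_E i \<bullet> heis_C j - heis_E j \<bullet> (heis_C i :: 'n heis)\<bar> = 1" by blast
  fix b :: "'n heis" assume "b \<in> Basis"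
  then consider p where "b = (axis p 1, 0, 0)" | p where "b = (0, axis p 1, 0)" | "b = (0, 0, 1)"
    by (auto simp: Basis_prod_def Basis_vec_def zero_prod_def)
  then show "b = heis_\<tau> \<or> b \<in> range heis_E"
  proof cases
    case (1 p)
    then have "b = heis_E (Inl p)" by (simp add: heis_E_def)
    then show ?thesis by blast
  next
    case (2 p)
    then have "b = heis_E (Inr p)" by (simp add: heis_E_def)
    then show ?thesis by blast
  qed (simp add: heis_\<tau>_def)
qed (auto simp: open_domain bounded_domain)

context heis_domain
begin

lemma D_heis: "D i = vf_deriv (heis_field i)"
  by (simp add: D_def heis_field_eq)

lemma lap_heis: "lap = kohn_laplacian"
  by (simp add: fun_eq_iff lap_def kohn_laplacian_def sum_over_sum_type D_heis heis_field_def
      numeral_2_eq_2)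

lemma bilaplacian_heis:
  assumes "\<phi> \<in> TF"
  shows "((\<lambda>f w. - kohn_laplacian f w) ^^ 2) \<phi> = lap (lap \<phi>)"
  using lap_cmult[OF test_functions_smooth[OF lap_test[OF assms]], of "-1"]
  by (simp add: numeral_2_eq_2 fun_eq_iff flip: lap_heis)

section \<open>Weak derivatives and the norm of \<open>S_space\<close> in Hilbert space
  terms\<close>

lemma D_power_test: "\<phi> \<in> TF \<Longrightarrow> (D i ^^ d) \<phi> \<in> TF"
  by (induction d) (auto intro: D_test)

lemma D_power_diff:
  assumes "\<phi> \<in> TF" "\<psi> \<in> TF"
  shows "(D i ^^ d) (\<lambda>z. \<phi> z - \<psi> z) = (\<lambda>z. (D i ^^ d) \<phi> z - (D i ^^ d) \<psi> z)"
  by (induction d) (simp_all add: D_diff test_functions_smooth[OF D_power_test] assms)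

lemma D_power_skew:
  assumes "\<phi> \<in> TF" "\<psi> \<in> TF"
  shows "cls \<phi> \<bullet> cls ((D i ^^ d) \<psi>) = (-1) ^ d * (cls ((D i ^^ d) \<phi>) \<bullet> cls \<psi>)"
  using assms
proof (induction d arbitrary: \<phi>)
  case (Suc d)
  have "cls \<phi> \<bullet> cls ((D i ^^ Suc d) \<psi>) = - (cls (D i \<phi>) \<bullet> cls ((D i ^^ d) \<psi>))"
    using D_skew[of i \<phi> "(D i ^^ d) \<psi>"] TF_U[OF Suc.prems(1)] TF_U[OF D_power_test[OF Suc.prems(2)]] by simp
  also have "\<dots> = - ((-1) ^ d * (cls ((D i ^^ d) (D i \<phi>)) \<bullet> cls \<psi>))"
    by (simp add: Suc.IH[OF D_test[OF Suc.prems(1)] Suc.prems(2)])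
  finally show ?case by (simp add: funpow_swap1)
qed simp

lemma is_weak_deriv_iff:
  assumes "u \<in> L2 \<Omega>"
  shows "is_weak_deriv \<Omega> (heis_field i) d u g \<longleftrightarrow>
    g \<in> L2 \<Omega> \<and> (\<forall>\<eta>\<in>TF. emb \<Omega> u \<bullet> cls ((D i ^^ d) \<eta>) = (-1) ^ d * (emb \<Omega> g \<bullet> cls \<eta>))"
  unfolding is_weak_deriv_def D_heis[symmetric] using assms
  by (auto simp: emb_inner[OF open_domain] TF_sqint D_power_test)

lemma S_space_iff:
  "u \<in> S_space l \<Omega> \<longleftrightarrow> u \<in> L2 \<Omega> \<and> (\<forall>d\<in>{1..l}. \<forall>i. \<exists>g. is_weak_deriv \<Omega> (heis_field i) d u g)"
proof -
  have "(\<forall>i. \<exists>g. is_weak_deriv \<Omega> (heis_field i) d u g) \<longleftrightarrow>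
      (\<forall>p. (\<exists>g. is_weak_deriv \<Omega> (X_field p) d u g) \<and> (\<exists>g. is_weak_deriv \<Omega> (Y_field p) d u g))" for d
    by (auto simp: heis_field_def split: sum.splits)
  then show ?thesis unfolding S_space_def by simp
qed

lemma S_space_weak_deriv:
  assumes "u \<in> S_space l \<Omega>" "d \<in> {1..l}"
  shows "is_weak_deriv \<Omega> (heis_field i) d u (weak_deriv \<Omega> (heis_field i) d u)"
proof -
  have "\<exists>g. is_weak_deriv \<Omega> (heis_field i) d u g" using assms by (simp add: S_space_iff)
  then show ?thesis unfolding weak_deriv_def by (rule someI_ex)
qed

lemma S_space_L2: "u \<in> S_space l \<Omega> \<Longrightarrow> u \<in> L2 \<Omega>"
  by (simp add: S_space_def)

lemma weak_deriv_diff_test: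
  assumes u: "u \<in> L2 \<Omega>" and g: "is_weak_deriv \<Omega> (heis_field i) d u g" and \<phi>: "\<phi> \<in> TF"
  shows "is_weak_deriv \<Omega> (heis_field i) d (\<lambda>z. u z - \<phi> z) (\<lambda>z. g z - (D i ^^ d) \<phi> z)"
proof -
  note L = test_functions_L2[OF open_domain]
  have gL: "g \<in> L2 \<Omega>" and eq: "\<And>\<eta>. \<eta> \<in> TF \<Longrightarrow> emb \<Omega> u \<bullet> cls ((D i ^^ d) \<eta>) = (-1) ^ d * (emb \<Omega> g \<bullet> cls \<eta>)"
    using g unfolding is_weak_deriv_iff[OF u] by auto
  show ?thesis unfolding is_weak_deriv_iff[OF L2_diff[OF open_domain u L[OF \<phi>]]]
    using gL L[OF D_power_test[OF \<phi>]] u L[OF \<phi>]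
    by (auto simp: L2_diff emb_diff open_domain emb_test[OF \<phi>] emb_test[OF D_power_test[OF \<phi>]]
        inner_diff_left eq D_power_skew[OF \<phi>] right_diff_distrib)
qed

lemma S_space_diff_test:
  assumes "u \<in> S_space l \<Omega>" "\<phi> \<in> TF"
  shows "(\<lambda>z. u z - \<phi> z) \<in> S_space l \<Omega>"
  using assms weak_deriv_diff_test[OF S_space_L2[OF assms(1)] _ assms(2)]
  unfolding S_space_iff by (blast intro: L2_diff open_domain test_functions_L2)

lemma S_norm_square:
  assumes u: "u \<in> S_space l \<Omega>"
  shows "(S_norm l \<Omega> u)\<^sup>2 = (\<Sum>d=1..l. \<Sum>i\<in>UNIV. (norm (emb \<Omega> (weak_deriv \<Omega> (heis_field i) d u)))\<^sup>2)
    + (norm (emb \<Omega> u))\<^sup>2"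
proof -
  let ?w = "\<lambda>d i. weak_deriv \<Omega> (heis_field i) d u"
  have w: "?w d i \<in> L2 \<Omega>" if "d \<in> {1..l}" for d i
    using S_space_weak_deriv[OF u that] by (simp add: is_weak_deriv_def)
  have uL: "u \<in> L2 \<Omega>" by (rule S_space_L2[OF u])
  have int: "integrable (lebesgue_on \<Omega>) (\<lambda>z. (f z)\<^sup>2)" if "f \<in> L2 \<Omega>" for f
    using that by (simp add: L2_def)
  have "S_norm l \<Omega> u = sqrt (\<integral>z. (\<Sum>d=1..l. \<Sum>i\<in>UNIV. (?w d i z)\<^sup>2) + (u z)\<^sup>2 \<partial>lebesgue_on \<Omega>)"
    by (simp add: S_norm_def sum_over_sum_type heis_field_def)
  then have "(S_norm l \<Omega> u)\<^sup>2 = (\<integral>z. (\<Sum>d=1..l. \<Sum>i\<in>UNIV. (?w d i z)\<^sup>2) + (u z)\<^sup>2 \<partial>lebesgue_on \<Omega>)"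
    by (simp add: sum_nonneg)
  also have "\<dots> = (\<integral>z. (\<Sum>d=1..l. \<Sum>i\<in>UNIV. (?w d i z)\<^sup>2) \<partial>lebesgue_on \<Omega>) + (\<integral>z. (u z)\<^sup>2 \<partial>lebesgue_on \<Omega>)"
    by (intro Bochner_Integration.integral_add Bochner_Integration.integrable_sum int w uL)
  also have "(\<integral>z. (\<Sum>d=1..l. \<Sum>i\<in>UNIV. (?w d i z)\<^sup>2) \<partial>lebesgue_on \<Omega>)
      = (\<Sum>d=1..l. \<integral>z. (\<Sum>i\<in>UNIV. (?w d i z)\<^sup>2) \<partial>lebesgue_on \<Omega>)"
    by (intro Bochner_Integration.integral_sum Bochner_Integration.integrable_sum int w)
  also have "\<dots> = (\<Sum>d=1..l. \<Sum>i\<in>UNIV. (\<integral>z. (?w d i z)\<^sup>2 \<partial>lebesgue_on \<Omega>))"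
    by (intro sum.cong refl Bochner_Integration.integral_sum int w)
  also have "\<dots> = (\<Sum>d=1..l. \<Sum>i\<in>UNIV. (norm (emb \<Omega> (?w d i)))\<^sup>2)"
    by (intro sum.cong refl norm_emb[symmetric] open_domain w)
  finally show ?thesis by (simp add: norm_emb[OF open_domain uL])
qed

lemma S_norm_ge:
  assumes u: "u \<in> S_space l \<Omega>"
  shows "norm (emb \<Omega> u) \<le> S_norm l \<Omega> u"
    and "d \<in> {1..l} \<Longrightarrow> norm (emb \<Omega> (weak_deriv \<Omega> (heis_field i) d u)) \<le> S_norm l \<Omega> u"
proof -
  have n: "S_norm l \<Omega> u \<ge> 0" by (auto simp: S_norm_def intro!: integral_nonneg_AE add_nonneg_nonneg sum_nonneg)
  show "norm (emb \<Omega> u) \<le> S_norm l \<Omega> u"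
    by (rule power2_le_imp_le[OF _ n]) (simp add: S_norm_square[OF u] sum_nonneg)
  assume d: "d \<in> {1..l}"
  let ?f = "\<lambda>d i. (norm (emb \<Omega> (weak_deriv \<Omega> (heis_field i) d u)))\<^sup>2"
  have "?f d i \<le> (\<Sum>i\<in>UNIV. ?f d i)" by (rule member_le_sum) auto
  also have "\<dots> \<le> (\<Sum>d=1..l. \<Sum>i\<in>UNIV. ?f d i)"
    by (rule member_le_sum[OF d]) (auto intro: sum_nonneg)
  finally show "norm (emb \<Omega> (weak_deriv \<Omega> (heis_field i) d u)) \<le> S_norm l \<Omega> u"
    by (intro power2_le_imp_le[OF _ n]) (simp add: S_norm_square[OF u] add_increasing2)
qed

section \<open>The domain of the closed graph is \<open>S0_space 2 \<Omega>\<close>\<close>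

text \<open>The norm makes the weak second derivatives of \<open>u - \<phi> m\<close> small, but
  these are unspecified representatives. Pairing them with test functions removes the ambiguity and
  shows that \<open>D i (D i (\<phi> m))\<close> is Cauchy for each \<open>i\<close>; the Laplacian
  is the sum of these.\<close>

lemma S0_space_approximation:
  assumes u: "u \<in> S0_space 2 \<Omega>"
  obtains \<phi> where "\<And>m. \<phi> m \<in> TF" "(\<lambda>m. cls (\<phi> m)) \<longlonglongrightarrow> emb \<Omega> u" "convergent (\<lambda>m. cls (lap (\<phi> m)))"
proof -
  have uS: "u \<in> S_space 2 \<Omega>" using u by (simp add: S0_space_def)
  note uL = S_space_L2[OF uS]
  define e where "e = (\<lambda>m::nat. 1 / real (Suc m))"
  have e0: "e \<longlonglongrightarrow> 0" unfolding e_def by (rule LIMSEQ_Suc[OF lim_1_over_n])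
  have epos: "e m > 0" for m by (simp add: e_def)
  have "\<exists>\<phi>\<in>TF. S_norm 2 \<Omega> (\<lambda>z. u z - \<phi> z) < e m" for m
    using u epos[of m] by (simp add: S0_space_def)
  then obtain \<phi> where \<phi>: "\<And>m. \<phi> m \<in> TF" "\<And>m. S_norm 2 \<Omega> (\<lambda>z. u z - \<phi> m z) < e m" by metis
  note L = test_functions_L2[OF open_domain \<phi>(1)]
  have dS: "(\<lambda>z. u z - \<phi> m z) \<in> S_space 2 \<Omega>" for m by (rule S_space_diff_test[OF uS \<phi>(1)])
  have lim: "(\<lambda>m. cls (\<phi> m)) \<longlonglongrightarrow> emb \<Omega> u"
  proof (rule LIM_zero_cancel, rule Lim_null_comparison[OF _ e0])
    have "norm (cls (\<phi> m) - emb \<Omega> u) \<le> e m" for m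
      using S_norm_ge(1)[OF dS[of m]] \<phi>(2)[of m]
      by (simp add: emb_diff open_domain uL L emb_test[OF \<phi>(1)] norm_minus_commute)
    then show "\<forall>\<^sub>F m in sequentially. norm (cls (\<phi> m) - emb \<Omega> u) \<le> e m" by simp
  qed
  have "convergent (\<lambda>m. cls (D i (D i (\<phi> m))))" for i
  proof -
    define W where "W = (\<lambda>m. emb \<Omega> (weak_deriv \<Omega> (heis_field i) 2 (\<lambda>z. u z - \<phi> m z)))"
    have W: "norm (W m) \<le> e m" for m
      unfolding W_def using S_norm_ge(2)[OF dS[of m], of 2 i] \<phi>(2)[of m] by simp
    have W_inner: "W m \<bullet> cls \<eta> = emb \<Omega> u \<bullet> cls (D i (D i \<eta>)) - cls (D i (D i (\<phi> m))) \<bullet> cls \<eta>" if \<eta>: "\<eta> \<in> TF" for m \<eta>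
    proof -
      have "emb \<Omega> (\<lambda>z. u z - \<phi> m z) \<bullet> cls ((D i ^^ 2) \<eta>) = (-1) ^ 2 * (W m \<bullet> cls \<eta>)"
        unfolding W_def using S_space_weak_deriv[OF dS[of m], of 2 i] \<eta>
        by (simp add: is_weak_deriv_iff[OF S_space_L2[OF dS]])
      then show ?thesis
        using D_power_skew[OF \<phi>(1)[of m] \<eta>, of 2 i]
        by (simp add: emb_diff open_domain uL L emb_test[OF \<phi>(1)] inner_diff_left numeral_2_eq_2)
    qed
    have bound: "norm (cls (D i (D i (\<phi> m))) - cls (D i (D i (\<phi> l)))) \<le> e m + e l" for m l
    proof -
      let ?\<eta> = "D i (D i (\<lambda>z. \<phi> m z - \<phi> l z))"
      have \<eta>: "?\<eta> \<in> TF" by (intro D_test test_functions_diff \<phi>)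
      have eq: "cls ?\<eta> = cls (D i (D i (\<phi> m))) - cls (D i (D i (\<phi> l)))"
        using D_power_diff[OF \<phi>(1)[of m] \<phi>(1)[of l], of 2 i]
        by (simp add: numeral_2_eq_2 cls_diff TF_sqint[OF D_test[OF D_test[OF \<phi>(1)]]])
      \<comment> \<open>The function is tested against itself; the term with \<open>u\<close> is the
        same for \<open>m\<close> and \<open>l\<close> and cancels.\<close>
      have "cls ?\<eta> \<bullet> cls ?\<eta> = (W l - W m) \<bullet> cls ?\<eta>"
        using W_inner[OF \<eta>, of m] W_inner[OF \<eta>, of l] by (subst (1) eq) (simp add: inner_diff_left)
      also have "\<dots> \<le> norm (W l - W m) * norm (cls ?\<eta>)" by (rule norm_cauchy_schwarz)
      finally have "norm (cls ?\<eta>) * norm (cls ?\<eta>) \<le> norm (W l - W m) * norm (cls ?\<eta>)"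
        by (simp add: power2_norm_eq_inner flip: power2_eq_square)
      then have "norm (cls ?\<eta>) \<le> norm (W l - W m)"
        by (cases "norm (cls ?\<eta>) = 0") (auto dest: mult_right_le_imp_le)
      also have "\<dots> \<le> e m + e l" using norm_triangle_ineq4[of "W l" "W m"] W[of m] W[of l] by simp
      finally show ?thesis unfolding eq .
    qed
    have "Cauchy (\<lambda>m. cls (D i (D i (\<phi> m))))"
    proof (rule CauchyI)
      fix \<epsilon> :: real assume "\<epsilon> > 0"
      then obtain N where N: "\<And>m. m \<ge> N \<Longrightarrow> e m < \<epsilon> / 2"
        using order_tendstoD(2)[OF e0, of "\<epsilon> / 2"] by (auto simp: eventually_sequentially)
      then have "norm (cls (D i (D i (\<phi> m))) - cls (D i (D i (\<phi> l)))) < \<epsilon>" if "m \<ge> N" "l \<ge> N" for m l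
        using bound[of m l] N[OF that(1)] N[OF that(2)] by linarith
      then show "\<exists>M. \<forall>m\<ge>M. \<forall>l\<ge>M. norm (cls (D i (D i (\<phi> m))) - cls (D i (D i (\<phi> l)))) < \<epsilon>" by blast
    qed
    then show ?thesis by (simp add: Cauchy_convergent_iff)
  qed
  then have "convergent (\<lambda>m. cls (lap (\<phi> m)))"
    unfolding cls_lap[OF TF_U[OF \<phi>(1)]] by (intro convergent_sum)
  then show ?thesis using that \<phi>(1) lim by blast
qed

text \<open>The converse inclusion. By the subelliptic estimates the first and second derivatives of
  the approximating sequence converge along each field; their limits are the weak derivatives of the
  limit function, so the sequence converges in the norm of \<open>S_space\<close>.\<close>

lemma lap_graph_S0_space:
  assumes "(v, g) \<in> lap_graph"
  obtains f where "f \<in> S0_space 2 \<Omega>" "emb \<Omega> f = v"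
proof -
  obtain \<phi> where \<phi>: "\<And>m. \<phi> m \<in> TF" "(\<lambda>m. cls (\<phi> m)) \<longlonglongrightarrow> v" "(\<lambda>m. cls (lap (\<phi> m))) \<longlonglongrightarrow> g"
    using assms unfolding lap_graph_iff by blast
  note L = test_functions_L2[OF open_domain]
  obtain f where f: "f \<in> L2 \<Omega>" "emb \<Omega> f = v"
    using limit_of_test_functions_emb[OF open_domain \<phi>(1,2)] by blast
  have "\<exists>w. w \<in> L2 \<Omega> \<and> (\<lambda>m. cls ((D i ^^ d) (\<phi> m))) \<longlonglongrightarrow> emb \<Omega> w" if d: "d \<in> {1..2}" for d i
  proof -
    have c: "convergent (\<lambda>m. cls (\<phi> m))" "convergent (\<lambda>m. cls (lap (\<phi> m)))"
      using \<phi> by (auto simp: convergent_def)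
    have "d = 1 \<or> d = 2" using d by auto
    then have "convergent (\<lambda>m. cls ((D i ^^ d) (\<phi> m)))"
      using test_sequence_convergent[OF UNIV_I \<phi>(1) c, of i] by (auto simp: numeral_2_eq_2)
    then obtain G where G: "(\<lambda>m. cls ((D i ^^ d) (\<phi> m))) \<longlonglongrightarrow> G" by (auto simp: convergent_def)
    obtain w where "w \<in> L2 \<Omega>" "emb \<Omega> w = G"
      using limit_of_test_functions_emb[OF open_domain D_power_test[OF \<phi>(1)] G] by blast
    then show ?thesis using G by blast
  qed
  then obtain w where w: "\<And>d i. d \<in> {1..2} \<Longrightarrow> w d i \<in> L2 \<Omega>"
    "\<And>d i. d \<in> {1..2} \<Longrightarrow> (\<lambda>m. cls ((D i ^^ d) (\<phi> m))) \<longlonglongrightarrow> emb \<Omega> (w d i)" by metis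
  have weak: "is_weak_deriv \<Omega> (heis_field i) d f (w d i)" if d: "d \<in> {1..2}" for d i
    unfolding is_weak_deriv_iff[OF f(1)]
  proof (intro conjI ballI w d)
    fix \<eta> assume \<eta>: "\<eta> \<in> TF"
    have 1: "(\<lambda>m. cls (\<phi> m) \<bullet> cls ((D i ^^ d) \<eta>)) \<longlonglongrightarrow> emb \<Omega> f \<bullet> cls ((D i ^^ d) \<eta>)"
      unfolding f(2) by (intro tendsto_intros \<phi>)
    have 2: "(\<lambda>m. (-1) ^ d * (cls ((D i ^^ d) (\<phi> m)) \<bullet> cls \<eta>)) \<longlonglongrightarrow> (-1) ^ d * (emb \<Omega> (w d i) \<bullet> cls \<eta>)"
      by (intro tendsto_intros w d)
    show "emb \<Omega> f \<bullet> cls ((D i ^^ d) \<eta>) = (-1) ^ d * (emb \<Omega> (w d i) \<bullet> cls \<eta>)"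
      using LIMSEQ_unique[OF 1] 2 by (simp add: D_power_skew[OF \<phi>(1) \<eta>])
  qed
  have fS: "f \<in> S_space 2 \<Omega>" unfolding S_space_iff using f(1) weak by blast
  have dS: "(\<lambda>z. f z - \<phi> m z) \<in> S_space 2 \<Omega>" for m by (rule S_space_diff_test[OF fS \<phi>(1)])
  \<comment> \<open>\<open>weak_deriv\<close> is an arbitrary choice, but all choices have the same
    class, and one of them is explicit here.\<close>
  have unique: "emb \<Omega> (weak_deriv \<Omega> (heis_field i) d (\<lambda>z. f z - \<phi> m z)) = emb \<Omega> (w d i) - cls ((D i ^^ d) (\<phi> m))"
    if d: "d \<in> {1..2}" for d i m
  proof -
    let ?w = "weak_deriv \<Omega> (heis_field i) d (\<lambda>z. f z - \<phi> m z)"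
    have 1: "is_weak_deriv \<Omega> (heis_field i) d (\<lambda>z. f z - \<phi> m z) ?w" by (rule S_space_weak_deriv[OF dS d])
    have 2: "is_weak_deriv \<Omega> (heis_field i) d (\<lambda>z. f z - \<phi> m z) (\<lambda>z. w d i z - (D i ^^ d) (\<phi> m) z)"
      by (rule weak_deriv_diff_test[OF f(1) weak[OF d] \<phi>(1)])
    have "emb \<Omega> ?w = emb \<Omega> (\<lambda>z. w d i z - (D i ^^ d) (\<phi> m) z)"
      using 1 2 unfolding is_weak_deriv_iff[OF S_space_L2[OF dS]]
      by (intro emb_eq_if_orthogonal[OF open_domain]) auto
    then show ?thesis
      unfolding emb_diff[OF open_domain w(1)[OF d] L[OF D_power_test[OF \<phi>(1)]]] emb_test[OF D_power_test[OF \<phi>(1)]] .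
  qed
  have "(\<lambda>m. (\<Sum>d=1..2. \<Sum>i\<in>UNIV. (norm (emb \<Omega> (w d i) - cls ((D i ^^ d) (\<phi> m))))\<^sup>2) + (norm (v - cls (\<phi> m)))\<^sup>2)
      \<longlonglongrightarrow> (\<Sum>d=1..2. \<Sum>i\<in>(UNIV :: ('n + 'n) set). (norm (emb \<Omega> (w d i) - emb \<Omega> (w d i)))\<^sup>2) + (norm (v - v))\<^sup>2"
    by (intro tendsto_intros w \<phi>) auto
  moreover have "(S_norm 2 \<Omega> (\<lambda>z. f z - \<phi> m z))\<^sup>2
      = (\<Sum>d=1..2. \<Sum>i\<in>UNIV. (norm (emb \<Omega> (w d i) - cls ((D i ^^ d) (\<phi> m))))\<^sup>2) + (norm (v - cls (\<phi> m)))\<^sup>2" for m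
    unfolding S_norm_square[OF dS] emb_diff[OF open_domain f(1) L[OF \<phi>(1)]] emb_test[OF \<phi>(1)] f(2)
    by (simp only: unique cong: sum.cong)
  ultimately have lim: "(\<lambda>m. (S_norm 2 \<Omega> (\<lambda>z. f z - \<phi> m z))\<^sup>2) \<longlonglongrightarrow> 0" by simp
  have "f \<in> S0_space 2 \<Omega>" unfolding S0_space_def
  proof (intro CollectI conjI fS allI impI)
    fix \<epsilon> :: real assume \<epsilon>: "\<epsilon> > 0"
    then have "eventually (\<lambda>m. (S_norm 2 \<Omega> (\<lambda>z. f z - \<phi> m z))\<^sup>2 < \<epsilon>\<^sup>2) sequentially"
      by (intro order_tendstoD(2)[OF lim]) simp
    then obtain m where "(S_norm 2 \<Omega> (\<lambda>z. f z - \<phi> m z))\<^sup>2 < \<epsilon>\<^sup>2" by (auto simp: eventually_sequentially)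
    then have "S_norm 2 \<Omega> (\<lambda>z. f z - \<phi> m z) < \<epsilon>" by (rule power2_less_imp_less) (use \<epsilon> in simp)
    then show "\<exists>\<phi>\<in>TF. S_norm 2 \<Omega> (\<lambda>z. f z - \<phi> z) < \<epsilon>" using \<phi>(1) by blast
  qed
  then show ?thesis using that f(2) by blast
qed

section \<open>Eigenfunctions as eigenvectors of the closed graph\<close>

lemma eigenfunction_L2: "eigenfunction \<Omega> \<mu> u \<Longrightarrow> u \<in> L2 \<Omega>"
  by (simp add: eigenfunction_def S0_space_def S_space_def)

text \<open>In the distributional equation one Laplacian is moved from the test function to
  \<open>u\<close>. The result is a closed condition on pairs, so it extends from test functions to
  the whole graph.\<close>

lemma eigenfunction_in_graph:
  assumes "eigenfunction \<Omega> \<mu> u"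
  obtains A where "(emb \<Omega> u, A) \<in> lap_graph" "\<And>v g. (v, g) \<in> lap_graph \<Longrightarrow> A \<bullet> g = \<mu> * (emb \<Omega> u \<bullet> v)"
proof -
  have u: "u \<in> S0_space 2 \<Omega>" using assms by (simp add: eigenfunction_def)
  note uL = eigenfunction_L2[OF assms]
  obtain \<phi> where \<phi>: "\<And>m. \<phi> m \<in> TF" "(\<lambda>m. cls (\<phi> m)) \<longlonglongrightarrow> emb \<Omega> u" "convergent (\<lambda>m. cls (lap (\<phi> m)))"
    using S0_space_approximation[OF u] by metis
  then obtain A where A: "(\<lambda>m. cls (lap (\<phi> m))) \<longlonglongrightarrow> A" by (auto simp: convergent_def)
  have uA: "(emb \<Omega> u, A) \<in> lap_graph" unfolding lap_graph_iff using \<phi> A by blast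
  have "lap_graph \<subseteq> {p. A \<bullet> snd p = \<mu> * (emb \<Omega> u \<bullet> fst p)}"
  proof (rule lap_graph_subset_closed)
    show "closed {p. A \<bullet> snd p = \<mu> * (emb \<Omega> u \<bullet> fst p)}" by (intro closed_Collect_eq continuous_intros)
    fix \<eta> assume \<eta>: "\<eta> \<in> TF"
    have 1: "(\<lambda>m. cls (lap (\<phi> m)) \<bullet> cls (lap \<eta>)) \<longlonglongrightarrow> A \<bullet> cls (lap \<eta>)" by (intro tendsto_intros A)
    have 2: "(\<lambda>m. cls (\<phi> m) \<bullet> cls (lap (lap \<eta>))) \<longlonglongrightarrow> emb \<Omega> u \<bullet> cls (lap (lap \<eta>))" by (intro tendsto_intros \<phi>)
    have "A \<bullet> cls (lap \<eta>) = emb \<Omega> u \<bullet> cls (lap (lap \<eta>))"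
      using LIMSEQ_unique[OF 1] 2 by (simp add: lap_self_adjoint[OF TF_U[OF \<phi>(1)] TF_U[OF lap_test[OF \<eta>]]])
    also have "\<dots> = (\<integral>z. u z * ((\<lambda>f w. - kohn_laplacian f w) ^^ 2) \<eta> z \<partial>lebesgue_on \<Omega>)"
      unfolding bilaplacian_heis[OF \<eta>] by (rule emb_inner[OF open_domain uL TF_sqint]) (intro lap_test \<eta>)
    also have "\<dots> = \<mu> * (\<integral>z. u z * \<eta> z \<partial>lebesgue_on \<Omega>)"
      using assms \<eta> by (simp add: eigenfunction_def)
    also have "\<dots> = \<mu> * (emb \<Omega> u \<bullet> cls \<eta>)" by (simp add: emb_inner[OF open_domain uL TF_sqint[OF \<eta>]])
    finally show "(cls \<eta>, cls (lap \<eta>)) \<in> {p. A \<bullet> snd p = \<mu> * (emb \<Omega> u \<bullet> fst p)}" by simp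
  qed
  then show ?thesis by (intro that[OF uA]) auto
qed

text \<open>Turns the abstract minimiser into an eigenfunction in the sense of the problem, to which
  the completeness of the listing applies.\<close>

lemma eigenfunction_of_graph:
  assumes vg: "(v, g) \<in> lap_graph" and "v \<noteq> 0"
    and eq: "\<And>v' g'. (v', g') \<in> lap_graph \<Longrightarrow> g \<bullet> g' = \<mu> * (v \<bullet> v')"
  obtains f where "eigenfunction \<Omega> \<mu> f" "emb \<Omega> f = v"
proof -
  obtain f where f: "f \<in> S0_space 2 \<Omega>" "emb \<Omega> f = v" using lap_graph_S0_space[OF vg] by metis
  have fL: "f \<in> L2 \<Omega>" using f(1) by (simp add: S0_space_def S_space_def)
  obtain \<phi> where \<phi>: "\<And>m. \<phi> m \<in> TF" "(\<lambda>m. cls (\<phi> m)) \<longlonglongrightarrow> v" "(\<lambda>m. cls (lap (\<phi> m))) \<longlonglongrightarrow> g"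
    using vg unfolding lap_graph_iff by blast
  have "eigenfunction \<Omega> \<mu> f" unfolding eigenfunction_def
  proof (intro conjI f ballI notI)
    assume "AE z in lebesgue_on \<Omega>. f z = 0"
    then have "emb \<Omega> f = emb \<Omega> (\<lambda>z. 0)" by (rule emb_cong_AE[OF open_domain fL L2_zero[OF open_domain]])
    then show False using f(2) \<open>v \<noteq> 0\<close> by (simp add: emb_zero)
  next
    fix \<eta> assume \<eta>: "\<eta> \<in> TF"
    have 1: "(\<lambda>m. cls (lap (\<phi> m)) \<bullet> cls (lap \<eta>)) \<longlonglongrightarrow> g \<bullet> cls (lap \<eta>)" by (intro tendsto_intros \<phi>)
    have 2: "(\<lambda>m. cls (\<phi> m) \<bullet> cls (lap (lap \<eta>))) \<longlonglongrightarrow> v \<bullet> cls (lap (lap \<eta>))" by (intro tendsto_intros \<phi>)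
    have "(\<integral>z. f z * ((\<lambda>f w. - kohn_laplacian f w) ^^ 2) \<eta> z \<partial>lebesgue_on \<Omega>) = emb \<Omega> f \<bullet> cls (lap (lap \<eta>))"
      unfolding bilaplacian_heis[OF \<eta>] by (rule emb_inner[OF open_domain fL TF_sqint, symmetric]) (intro lap_test \<eta>)
    also have "\<dots> = g \<bullet> cls (lap \<eta>)"
      using LIMSEQ_unique[OF 1] 2 f(2) by (simp add: lap_self_adjoint[OF TF_U[OF \<phi>(1)] TF_U[OF lap_test[OF \<eta>]]])
    also have "\<dots> = \<mu> * (v \<bullet> cls \<eta>)" by (rule eq[OF lap_graph_test[OF \<eta>]])
    also have "\<dots> = \<mu> * (\<integral>z. f z * \<eta> z \<partial>lebesgue_on \<Omega>)"
      by (simp add: emb_inner[OF open_domain fL TF_sqint[OF \<eta>]] flip: f(2))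
    finally show "(\<integral>z. f z * ((\<lambda>f w. - kohn_laplacian f w) ^^ 2) \<eta> z \<partial>lebesgue_on \<Omega>) = \<mu> * (\<integral>z. f z * \<eta> z \<partial>lebesgue_on \<Omega>)" .
  qed
  then show ?thesis using that f(2) by blast
qed

end

section \<open>Optimisation of the parameter and conclusion\<close>

text \<open>The chosen \<open>\<delta>\<close> balances the two terms; each becomes
  \<open>2 r\<close>, that is \<open>2 sqrt ((n + 1) a b)\<close>.\<close>

lemma le_sqrt_product_if_le_weighted_sums:
  fixes n :: real
  assumes n: "n > 0" and a: "a > 0" and b: "b > 0"
    and le: "\<And>\<delta>. \<delta> > 0 \<Longrightarrow> 2 * n * S \<le> \<delta> * (4 * (n + 1) * b) + (1/\<delta>) * a"
  shows "S \<le> 2 * sqrt (n + 1) / n * sqrt a * sqrt b"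
proof -
  define r where "r = sqrt (n + 1) * sqrt a * sqrt b"
  define \<delta> where "\<delta> = sqrt a / (2 * sqrt (n + 1) * sqrt b)"
  have \<delta>: "\<delta> > 0" using assms by (simp add: \<delta>_def)
  have sq: "sqrt x * sqrt x = x" if "x > 0" for x :: real using that by simp
  have "\<delta> * (4 * (n + 1) * b) = \<delta> * (4 * (sqrt (n + 1) * sqrt (n + 1)) * (sqrt b * sqrt b))"
    using sq[of "n + 1"] sq[OF b] n by simp
  also have "\<dots> = 2 * r" using assms by (simp add: \<delta>_def r_def field_simps del: real_sqrt_mult_self)
  finally have 1: "\<delta> * (4 * (n + 1) * b) = 2 * r" .
  have "(1/\<delta>) * a = (1/\<delta>) * (sqrt a * sqrt a)" using sq[OF a] by simp
  also have "\<dots> = 2 * r" using assms by (simp add: \<delta>_def r_def field_simps del: real_sqrt_mult_self)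
  finally have "2 * n * S \<le> 4 * r" using le[OF \<delta>] 1 by simp
  then show ?thesis using n by (simp add: r_def field_simps)
qed

theorem theorem4p2:
  fixes \<Omega> :: "'n::finite heis set" and lam :: "nat \<Rightarrow> real"
    and u :: "nat \<Rightarrow> 'n heis \<Rightarrow> real" and k :: nat
  assumes "bounded_smooth_domain \<Omega>"
    and "eigenvalue_listing \<Omega> lam u"
    and "k \<ge> 1"
  shows "(\<Sum>i=1..k. (lam (k + 1) - lam i)\<^sup>2)
    \<le> 2 * sqrt (real CARD('n) + 1) / real CARD('n)
      * sqrt (\<Sum>i=1..k. (lam (k + 1) - lam i) * sqrt (lam i))
      * sqrt (\<Sum>i=1..k. (lam (k + 1) - lam i)\<^sup>2 * sqrt (lam i))"
proof -
  interpret heis_domain \<Omega>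
    using assms(1) by unfold_locales (simp_all add: bounded_smooth_domain_def)
  have pos: "0 < lam i" and step: "lam i \<le> lam (Suc i)" and eigf: "eigenfunction \<Omega> (lam i) (u i)" if "i \<ge> 1" for i
    using assms(2) that by (auto simp: eigenvalue_listing_def)
  have on: "(\<integral>z. u i z * u j z \<partial>lebesgue_on \<Omega>) = (if i = j then 1 else 0)" if "i \<ge> 1" "j \<ge> 1" for i j
    using assms(2) that by (auto simp: eigenvalue_listing_def)
  have complete: "\<exists>c. AE z in lebesgue_on \<Omega>. v z = (\<Sum>i | 1 \<le> i \<and> lam i = \<mu>. c i * u i z)"
    if "eigenfunction \<Omega> \<mu> v" for \<mu> v
    using assms(2) that by (simp add: eigenvalue_listing_def)
  have mono: "lam i \<le> lam j" if "1 \<le> i" "i \<le> j" for i j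
    using that(2,1) by (induction j rule: dec_induct) (auto intro: order_trans[OF _ step])
  define L where "L = lam (k + 1)"
  have L: "L > 0" unfolding L_def by (rule pos) simp
  define J where "J = {1..k}"
  have J: "finite J" "\<And>j. j \<in> J \<Longrightarrow> j \<ge> 1" by (auto simp: J_def)
  define U where "U = (\<lambda>j. emb \<Omega> (u j))"
  have uL: "u j \<in> L2 \<Omega>" if "j \<ge> 1" for j by (rule eigenfunction_L2[OF eigf[OF that]])
  have UU: "U i \<bullet> U j = (if i = j then 1 else 0)" if "i \<ge> 1" "j \<ge> 1" for i j
    unfolding U_def using on[OF that] by (simp add: emb_inner_emb[OF open_domain uL[OF that(1)] uL[OF that(2)]])
  have "\<exists>A. \<forall>j\<in>J. (U j, A j) \<in> lap_graph \<and> (\<forall>v g. (v, g) \<in> lap_graph \<longrightarrow> A j \<bullet> g = lam j * (U j \<bullet> v))"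
    unfolding U_def by (intro bchoice ballI) (metis J(2) eigf eigenfunction_in_graph)
  then obtain A where A: "\<And>j. j \<in> J \<Longrightarrow> (U j, A j) \<in> lap_graph"
    "\<And>j v g. j \<in> J \<Longrightarrow> (v, g) \<in> lap_graph \<Longrightarrow> A j \<bullet> g = lam j * (U j \<bullet> v)" by blast
  \<comment> \<open>The variational characterisation of \<open>lam (k + 1)\<close>: a violation
    would give an eigenvalue \<open>\<mu> < L\<close> with an eigenfunction orthogonal to the first
    \<open>k\<close>, yet completeness puts it into their span.\<close>
  have low: "L * (norm v)\<^sup>2 \<le> (norm g)\<^sup>2" if vg: "(v, g) \<in> lap_graph" and orth: "\<And>j. j \<in> J \<Longrightarrow> v \<bullet> U j = 0" for v g
  proof (rule ccontr)
    assume "\<not> L * (norm v)\<^sup>2 \<le> (norm g)\<^sup>2"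
    then have less: "(norm g)\<^sup>2 < L * (norm v)\<^sup>2" by simp
    \<comment> \<open>\<open>1 / (2 * L)\<close> is the value that makes the smallness condition
      \<open>\<epsilon> * L \<le> 1/2\<close> an equality.\<close>
    obtain K :: "'n heis set" and F where K: "finite K" "\<And>v g. (v, g) \<in> lap_graph \<Longrightarrow>
      (norm v)\<^sup>2 \<le> 1 / (2 * L) * (norm g)\<^sup>2 + (\<Sum>k\<in>K. (v \<bullet> F k)\<^sup>2)"
      using lap_graph_compact[of "1 / (2 * L)"] L by auto
    have e: "1 / (2 * L) > 0" "1 / (2 * L) * L \<le> 1/2" using L by auto
    have UUJ: "U i \<bullet> U j = (if i = j then 1 else 0)" if "i \<in> J" "j \<in> J" for i j using UU J(2) that by blast
    show False
    proof (rule eigenvector_below_level[OF subspace_lap_graph closed_lap_graph K(1) e K(2) J(1) A(1) UUJ A(2) vg orth less])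
      fix w h \<mu>
      assume w: "(w, h) \<in> lap_graph" "\<mu> < L" "w \<noteq> 0" "\<And>j. j \<in> J \<Longrightarrow> w \<bullet> U j = 0"
        "\<And>v' g'. (v', g') \<in> lap_graph \<Longrightarrow> h \<bullet> g' = \<mu> * (w \<bullet> v')"
      obtain f where f: "eigenfunction \<Omega> \<mu> f" "emb \<Omega> f = w" using eigenfunction_of_graph[OF w(1,3,5)] by metis
      obtain c where c: "AE z in lebesgue_on \<Omega>. f z = (\<Sum>i | 1 \<le> i \<and> lam i = \<mu>. c i * u i z)"
        using complete[OF f(1)] by blast
      define S where "S = {i. 1 \<le> i \<and> lam i = \<mu>}"
      \<comment> \<open>By monotonicity an index beyond \<open>k\<close> has eigenvalue at least
        \<open>L\<close>, so \<open>\<mu> < L\<close> leaves only indices up to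
        \<open>k\<close>.\<close>
      have SJ: "i \<in> J" if "i \<in> S" for i
      proof (rule ccontr)
        assume "i \<notin> J"
        then have "k + 1 \<le> i" using that by (auto simp: J_def S_def)
        then have "L \<le> lam i" unfolding L_def by (intro mono) auto
        then show False using that w(2) by (simp add: S_def)
      qed
      have sum: "(\<lambda>z. \<Sum>i\<in>S. c i * u i z) \<in> L2 \<Omega>" "emb \<Omega> (\<lambda>z. \<Sum>i\<in>S. c i * u i z) = (\<Sum>i\<in>S. c i *\<^sub>R U i)"
        using L2_emb_sum[OF open_domain, of S u c] uL unfolding U_def by (auto simp: S_def)
      have "w = (\<Sum>i\<in>S. c i *\<^sub>R U i)"
        using emb_cong_AE[OF open_domain eigenfunction_L2[OF f(1)] sum(1)] c f(2) sum(2) by (simp add: S_def)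
      then have "w \<bullet> w = w \<bullet> (\<Sum>i\<in>S. c i *\<^sub>R U i)" by simp
      also have "\<dots> = 0" using SJ w(4) by (simp add: inner_sum_right)
      finally show False using w(3) by simp
    qed
  qed
  define n where "n = real CARD('n)"
  have n: "n > 0" by (simp add: n_def)
  have card: "real (card (UNIV :: ('n + 'n) set)) = 2 * n"
    by (simp add: n_def card_UNIV_sum)
  define S a b where "S = (\<Sum>i\<in>J. (L - lam i)\<^sup>2)" and "a = (\<Sum>i\<in>J. (L - lam i) * sqrt (lam i))"
    and "b = (\<Sum>i\<in>J. (L - lam i)\<^sup>2 * sqrt (lam i))"
  have lamL: "lam j \<le> L" if "j \<in> J" for j
    unfolding L_def using that by (intro mono) (auto simp: J_def)
  have le: "2 * n * S \<le> \<delta> * (4 * (n + 1) * b) + (1/\<delta>) * a" if "\<delta> > 0" for \<delta>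
  proof -
    have "2 * n * S \<le> \<delta> * ((4 + 2 * (2 * n)) * b) + (1/\<delta>) * a"
      unfolding S_def a_def b_def card[symmetric]
      by (rule yang_sum[OF J(1) A(1) _ A(2) low lamL that]) (use UU J(2) in auto)
    then show ?thesis by (simp add: algebra_simps)
  qed
  have "S \<le> 2 * sqrt (n + 1) / n * sqrt a * sqrt b"
  \<comment> \<open>Choosing \<open>\<delta>\<close> requires positive \<open>a\<close> and
    \<open>b\<close>. If all \<open>lam j\<close> equal \<open>L\<close>, then \<open>S\<close> and
    \<open>a\<close> are 0.\<close>
  proof (cases "\<exists>j\<in>J. lam j < L")
    case True
    then obtain j where j: "j \<in> J" "lam j < L" by blast
    have "0 < (L - lam j) * sqrt (lam j)" "0 < (L - lam j)\<^sup>2 * sqrt (lam j)"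
      using j pos[OF J(2)[OF j(1)]] by auto
    then have "a > 0" "b > 0" unfolding a_def b_def
      using J(1) j(1) lamL pos J(2)
      by (auto intro!: sum_pos2[of J j] mult_nonneg_nonneg simp: less_imp_le)
    then show ?thesis using le_sqrt_product_if_le_weighted_sums[OF n _ _ le] by blast
  next
    case False
    then have "lam j = L" if "j \<in> J" for j using lamL[OF that] that by force
    then have "S = 0" "a = 0" by (simp_all add: S_def a_def)
    then show ?thesis by simp
  qed
  then show ?thesis by (simp add: S_def a_def b_def n_def J_def L_def)
qed

end
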